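(* Let $K_{4,4}$ be the complete bipartite graph with both parts of size $4$ (so it has $8$ nodes and $16$ edges). Then $K_{4,4}$ is a uniformly most-reliable $(8,16)$-graph: for every simple graph $G$ with $8$ nodes and $16$ edges and every $\rho\in[0,1]$, we have $U_{K_{4,4}}(\rho)\le U_G(\rho)$, equivalently $R_{K_{4,4}}(\rho)\ge R_G(\rho)$.
   Context: All graphs are simple; an $(n,e)$-graph is a graph with $n$ nodes and $e$ edges. Nodes are perfect and each edge fails independently with the same probability $\rho\in[0,1]$. The all-terminal reliability $R_G(\rho)$ is the probability that the random spanning subgraph of surviving edges is connected, and $U_G(\rho)=1-R_G(\rho)$ is the unreliability. An $(n,e)$-graph $H$ is uniformly most-reliable if $U_H(\rho)\le U_G(\rho)$ for all $\rho\in[0,1]$ and all $(n,e)$-graphs $G$. *)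

theory Defs
  imports Complex_Main
begin

text \<open>A simple graph on the node set {0..<n}: a set of 2-element subsets of {0..<n}.\<close>
definition simple_graph :: "nat \<Rightarrow> nat set set \<Rightarrow> bool" where
  "simple_graph n E \<longleftrightarrow> (\<forall>x\<in>E. \<exists>u v. u < n \<and> v < n \<and> u \<noteq> v \<and> x = {u, v})"

text \<open>An (n,e)-graph: simple graph on n nodes with exactly e edges.\<close>
definition ne_graph :: "nat \<Rightarrow> nat \<Rightarrow> nat set set \<Rightarrow> bool" where
  "ne_graph n e E \<longleftrightarrow> simple_graph n E \<and> card E = e"

text \<open>The spanning subgraph ({0..<n}, S) is connected.\<close>
definition connected_spanning :: "nat \<Rightarrow> nat set set \<Rightarrow> bool" where
  "connected_spanning n S \<longleftrightarrow>
     (\<forall>u<n. \<forall>v<n. (u, v) \<in> {(x, y). {x, y} \<in> S}\<^sup>*)"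

text \<open>All-terminal reliability: each edge fails independently with probability \<rho>;
  probability that the surviving spanning subgraph is connected.\<close>
definition reliability :: "nat \<Rightarrow> nat set set \<Rightarrow> real \<Rightarrow> real" where
  "reliability n E \<rho> =
     (\<Sum>S\<in>{S. S \<subseteq> E \<and> connected_spanning n S}.
        (1 - \<rho>) ^ card S * \<rho> ^ card (E - S))"

definition unreliability :: "nat \<Rightarrow> nat set set \<Rightarrow> real \<Rightarrow> real" where
  "unreliability n E \<rho> = 1 - reliability n E \<rho>"

definition uniformly_most_reliable :: "nat \<Rightarrow> nat \<Rightarrow> nat set set \<Rightarrow> bool" where
  "uniformly_most_reliable n e H \<longleftrightarrow> ne_graph n e H \<and>
     (\<forall>G. ne_graph n e G \<longrightarrow>
        (\<forall>\<rho>::real. 0 \<le> \<rho> \<and> \<rho> \<le> 1 \<longrightarrow> unreliability n H \<rho> \<le> unreliability n G \<rho>))"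

text \<open>K_{4,4} on nodes {0..<8}, parts {0,1,2,3} and {4,5,6,7}.\<close>
definition K44 :: "nat set set" where
  "K44 = {{i, j} | i j. i < 4 \<and> 4 \<le> j \<and> j < 8}"

end

theory Submission
  imports Defs "HOL-Combinatorics.Permutations"
begin

text \<open>
  Reliability comparison reduces to comparing, for every i, the number of connected spanning
  subgraphs with i edges. Let G have 8 vertices and 16 edges.

  If some vertex has degree 3, with neighbours a, b, c, put H = G - v. Expanding over the edges at v,
  the terms 3 N(H) + N(H/ab) + N(H/ac) + N(H/bc) regroup into the three graphs H + ab, H + ac, H + bc,
  and only N(H/abc) is left over. Uniform bounds on N(H + ab) and N(H/abc) over all graphs H with
  7 vertices and 13 edges then add up exactly to the values of \<open>K44\<close>; smaller degrees give at most
  the same bound. These bounds are computed by removing from H a vertex of minimal degree, which is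
  at most 3, and running through the isomorphism types of the remaining graph on 6 vertices.

  Otherwise G is 4-regular, and removing two adjacent vertices leaves a graph with 6 vertices and
  9 edges, again treated type by type.
\<close>

section \<open>Counting connected spanning subgraphs\<close>

text \<open>Let N(H) be the polynomial in x whose coefficients count the connected spanning
  subgraphs of H by edges; then N(H + ab) = N(H) + x N(H/ab). Expanding at a vertex with neighbours
  a, b, c gives 3x N(H) + x^2 (N(H/ab) + N(H/ac) + N(H/bc)) + x^3 N(H/abc). Each contraction by a
  pair absorbs one of the three copies of N(H), so N(H) is only ever bounded together with such a
  contraction. H + ab may have a double edge; this is why contractions of a fixed edge set are used
  rather than new simple graphs. The degree claims come from averaging: 2 * 13 < 7 * 4 for H, and 2
  * 16 = 8 * 4 forces regularity. The extremal graph itself occurs in the regular case, with K_{3,3}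
  left over after the removal. What shapes the second half is the amount of evaluation, all of it
  done by rewriting. Polynomials of a six-vertex graph are therefore tabulated once for every
  partition of its vertices, each table being extended from that of a subgraph. The types are
  enumerated through their complements, which have 2 to 6 edges where the graphs have 13 to
  9.\<close>

definition pairs :: "nat \<Rightarrow> (nat \<times> nat) set" where
  "pairs n = {(a, b). a < b \<and> b < n}"

definition same :: "nat \<Rightarrow> (nat \<Rightarrow> nat) \<Rightarrow> (nat \<times> nat) set" where
  "same n f = {(x, y). x < n \<and> y < n \<and> f x = f y}"

text \<open>A labelling \<open>f\<close> stands for the contraction identifying all vertices with equal labels; merging the
  endpoints of an edge is then its contraction.\<close>

definition conn :: "nat \<Rightarrow> (nat \<Rightarrow> nat) \<Rightarrow> (nat \<times> nat) set \<Rightarrow> bool" where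
  "conn n f S \<longleftrightarrow> (\<forall>u<n. \<forall>v<n. (u, v) \<in> (same n f \<union> S \<union> S\<inverse>)\<^sup>*)"

text \<open>The coefficients of the polynomial N of the contracted graph. Contraction changes only
  \<open>f\<close>, never \<open>E\<close>, so edges that become loops or parallel remain distinct
  and keep being counted.\<close>

definition cnt :: "nat \<Rightarrow> (nat \<times> nat) set \<Rightarrow> (nat \<Rightarrow> nat) \<Rightarrow> nat \<Rightarrow> nat" where
  "cnt n E f i = card {S. S \<subseteq> E \<and> card S = i \<and> conn n f S}"

definition merge :: "nat \<times> nat \<Rightarrow> (nat \<Rightarrow> nat) \<Rightarrow> nat \<Rightarrow> nat" where
  "merge e f x = (if f x = f (snd e) then f (fst e) else f x)"

lemma finite_pairs [simp]: "finite (pairs n)"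
  by (rule finite_subset[of _ "{..<n} \<times> {..<n}"]) (auto simp: pairs_def)

lemma cnt_cong:
  assumes "\<And>x y. x < n \<Longrightarrow> y < n \<Longrightarrow> f x = f y \<longleftrightarrow> g x = g y"
  shows "cnt n E f i = cnt n E g i"
proof -
  have "same n f = same n g" using assms by (auto simp: same_def)
  then show ?thesis by (simp add: cnt_def conn_def)
qed

lemma cnt_mono:
  assumes "finite E" and "\<And>x y. x < n \<Longrightarrow> y < n \<Longrightarrow> f x = f y \<Longrightarrow> g x = g y"
  shows "cnt n E f i \<le> cnt n E g i"
proof -
  have "same n f \<subseteq> same n g" using assms(2) by (auto simp: same_def)
  then have "conn n f S \<Longrightarrow> conn n g S" for S
    unfolding conn_def by (meson rtrancl_mono Un_mono subsetD order_refl)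
  then show ?thesis unfolding cnt_def
    by (intro card_mono finite_subset[OF _ finite_Pow_iff[THEN iffD2, OF assms(1)]]) auto
qed

text \<open>Relabelling vertices can reverse the stored order of an edge; this shows that the
  direction in which two labels are merged does not affect the kernel.\<close>

lemma merge_swap:
  "((if x = a then b else x) = (if y = a then b else y)) \<longleftrightarrow>
   ((if x = b then a else x) = (if y = b then a else y))"
  by auto

text \<open>Both sides generate the same equivalence relation: a step between two vertices whose
  labels became equal only through the merge can be replaced by a walk through the edge
  \<open>(a, b)\<close>.\<close>

lemma conn_insert:
  assumes "a < n" "b < n"
  shows "conn n f (insert (a, b) S) \<longleftrightarrow> conn n (merge (a, b) f) S"
proof -
  let ?R = "same n f \<union> insert (a, b) S \<union> (insert (a, b) S)\<inverse>"
  let ?Q = "same n (merge (a, b) f) \<union> S \<union> S\<inverse>"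
  have ab: "(a, b) \<in> ?R" "(b, a) \<in> ?R" by auto
  have path: "(x, y) \<in> ?R\<^sup>*" if "x < n" "y < n" "f x \<in> {f a, f b}" "f y \<in> {f a, f b}" for x y
  proof -
    have 1: "(z, a) \<in> ?R\<^sup>*" "(a, z) \<in> ?R\<^sup>*" if z: "z < n" "f z \<in> {f a, f b}" for z
    proof -
      consider "f z = f a" | "f z = f b" using z by auto
      then have "(z, a) \<in> ?R\<^sup>* \<and> (a, z) \<in> ?R\<^sup>*"
      proof cases
        case 1
        then have "(z, a) \<in> ?R" "(a, z) \<in> ?R" using z assms by (auto simp: same_def)
        then show ?thesis by blast
      next
        case 2
        then have "(z, b) \<in> ?R" "(b, z) \<in> ?R" using z assms by (auto simp: same_def)
        then show ?thesis using ab by (meson converse_rtrancl_into_rtrancl r_into_rtrancl)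
      qed
      then show "(z, a) \<in> ?R\<^sup>*" "(a, z) \<in> ?R\<^sup>*" by auto
    qed
    show ?thesis using 1 that by (meson rtrancl_trans)
  qed
  have "?Q \<subseteq> ?R\<^sup>*"
  proof
    fix p assume p: "p \<in> ?Q"
    obtain x y where xy: "p = (x, y)" by fastforce
    show "p \<in> ?R\<^sup>*"
    proof (cases "p \<in> same n (merge (a, b) f)")
      case True
      then have "x < n" "y < n" and m: "merge (a, b) f x = merge (a, b) f y"
        using xy by (auto simp: same_def)
      then show ?thesis
        using path[of x y] xy by (cases "f x = f y") (auto simp: same_def merge_def split: if_splits)
    qed (use p in auto)
  qed
  moreover have "?R \<subseteq> ?Q" using assms by (auto simp: same_def merge_def)
  ultimately have "?R\<^sup>* = ?Q\<^sup>*"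
    by (simp add: rtrancl_mono rtrancl_subset_rtrancl subset_antisym)
  then show ?thesis by (simp add: conn_def)
qed

text \<open>Deletion-contraction: subgraphs avoiding the new edge are counted by the first summand,
  and those using it lose one edge and become subgraphs of the contraction by
  \<open>conn_insert\<close>.\<close>

lemma cnt_insert:
  assumes "finite E" "(a, b) \<notin> E" "a < n" "b < n"
  shows "cnt n (insert (a, b) E) f (Suc i) = cnt n E f (Suc i) + cnt n E (merge (a, b) f) i"
    and "cnt n (insert (a, b) E) f 0 = cnt n E f 0"
proof -
  let ?X = "\<lambda>i f. {S. S \<subseteq> E \<and> card S = i \<and> conn n f S}"
  have fin: "finite S" if "S \<subseteq> insert (a, b) E" for S
    using that assms(1) by (meson finite.insertI finite_subset)
  have finX: "finite (?X i f)" for i f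
    using assms(1) by (auto intro: finite_subset[of _ "Pow E"])
  have nin: "(a, b) \<notin> T" if "T \<subseteq> E" for T using that assms(2) by auto
  have eq: "{S. S \<subseteq> insert (a, b) E \<and> card S = Suc i \<and> conn n f S}
      = ?X (Suc i) f \<union> insert (a, b) ` ?X i (merge (a, b) f)" (is "?A = ?B")
  proof (intro equalityI subsetI)
    fix S assume S: "S \<in> ?A"
    show "S \<in> ?B"
    proof (cases "(a, b) \<in> S")
      case True
      have "S - {(a, b)} \<in> ?X i (merge (a, b) f)"
        using S True fin[of S] conn_insert[OF assms(3,4), of f "S - {(a, b)}"]
        by (auto simp: insert_absorb)
      then show ?thesis using True by (auto intro!: image_eqI[of _ _ "S - {(a, b)}"])
    qed (use S in auto)
  next
    fix S assume "S \<in> ?B"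
    then show "S \<in> ?A"
    proof
      assume "S \<in> insert (a, b) ` ?X i (merge (a, b) f)"
      then obtain T where T: "T \<in> ?X i (merge (a, b) f)" "S = insert (a, b) T" by blast
      moreover have "finite T" using T(1) assms(1) finite_subset by blast
      ultimately have "card S = Suc i" using nin[of T] by (auto simp: card_insert_if)
      then show ?thesis using T conn_insert[OF assms(3,4)] by auto
    qed auto
  qed
  have inj: "inj_on (insert (a, b)) (?X i (merge (a, b) f))"
    using nin by (intro inj_onI) (metis (mono_tags, lifting) insert_ident mem_Collect_eq)
  have disj: "?X (Suc i) f \<inter> insert (a, b) ` ?X i (merge (a, b) f) = {}"
    using nin by auto
  show "cnt n (insert (a, b) E) f (Suc i) = cnt n E f (Suc i) + cnt n E (merge (a, b) f) i"
    unfolding cnt_def eq by (simp add: card_Un_disjoint finX disj card_image inj)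
  have "{S. S \<subseteq> insert (a, b) E \<and> card S = 0 \<and> conn n f S} = ?X 0 f"
  proof -
    have "S = {}" if "S \<subseteq> insert (a, b) E" "card S = 0" for S
      using fin[OF that(1)] that(2) by simp
    then show ?thesis by auto
  qed
  then show "cnt n (insert (a, b) E) f 0 = cnt n E f 0" by (simp add: cnt_def)
qed

lemma cnt_empty:
  "cnt n {} f i = (if i = 0 \<and> (\<forall>x<n. \<forall>y<n. f x = f y) then 1 else 0)"
proof -
  have "trans (same n f)" by (auto simp: trans_def same_def)
  then have "(same n f)\<^sup>* = same n f \<union> Id" by (simp add: rtrancl_trancl_reflcl)
  then have c: "conn n f {} \<longleftrightarrow> (\<forall>x<n. \<forall>y<n. f x = f y)"
    by (auto simp: conn_def same_def)
  have "(S \<subseteq> {} \<and> card S = i \<and> conn n f S) \<longleftrightarrow> (S = {} \<and> i = 0 \<and> conn n f {})" for S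
    by (metis card.empty subset_empty)
  then have e: "cnt n {} f i = card {S :: (nat \<times> nat) set. S = {} \<and> i = 0 \<and> conn n f {}}"
    by (simp only: cnt_def)
  show ?thesis unfolding e c[symmetric] by (cases "i = 0 \<and> conn n f {}") simp_all
qed

text \<open>No edge of \<open>E\<close> reaches the vertex \<open>n\<close>, so only a shared label
  can tie it to the others.\<close>

lemma cnt_vertex:
  assumes "E \<subseteq> pairs n" "0 < n"
  shows "cnt (Suc n) E f i = (if \<exists>y<n. f y = f n then cnt n E f i else 0)"
proof -
  have "finite E" using assms(1) by (rule finite_subset) simp
  then show ?thesis using assms(1)
  proof (induction E arbitrary: f i rule: finite_induct)
    case empty
    have k: "(\<forall>x<Suc n. \<forall>y<Suc n. f x = f y) \<longleftrightarrow> (\<exists>y<n. f y = f n) \<and> (\<forall>x<n. \<forall>y<n. f x = f y)"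
      (is "?l \<longleftrightarrow> ?r")
    proof
      assume l: ?l
      have "f x = f y" if "x < n" "y < n" for x y
        using l[rule_format, of x y] that by simp
      moreover have "f 0 = f n" using l[rule_format, of 0 n] by simp
      ultimately show ?r using assms(2) by blast
    next
      assume r: ?r
      obtain y where y: "y < n" "f y = f n" using conjunct1[OF r] by auto
      have eq: "f x = f n" if "x < Suc n" for x
      proof (cases "x = n")
        case False
        then have "f x = f y" using that y(1) conjunct2[OF r, rule_format, of x y] by simp
        then show ?thesis using y(2) by simp
      qed simp
      show ?l
      proof (intro allI impI)
        fix x z assume "x < Suc n" "z < Suc n"
        then show "f x = f z" using eq[of x] eq[of z] by simp
      qed
    qed
    show ?case unfolding cnt_empty k
      by (cases "\<exists>y<n. f y = f n") (simp_all only: simp_thms if_True if_False)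
  next
    case (insert e E)
    obtain a b where e: "e = (a, b)" "a < n" "b < n"
      using insert.prems by (auto simp: pairs_def)
    \<comment> \<open>If merging moves the label of \<open>n\<close>, that label was the one of
      \<open>b\<close>, which is itself a partner below \<open>n\<close>. So an edge between lower
      vertices neither attaches nor detaches \<open>n\<close>.\<close>
    have m: "(\<exists>y<n. merge (a, b) f y = merge (a, b) f n) \<longleftrightarrow> (\<exists>y<n. f y = f n)"
    proof
      assume "\<exists>y<n. merge (a, b) f y = merge (a, b) f n"
      then obtain y where y: "y < n" "merge (a, b) f y = merge (a, b) f n" by blast
      then have "f n = f b \<or> f n = f a \<or> f n = f y" by (simp add: merge_def split: if_splits)
      with e(2,3) y(1) show "\<exists>y<n. f y = f n" by (elim disjE) (auto intro: exI[of _ a] exI[of _ b] exI[of _ y])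
    next
      assume "\<exists>y<n. f y = f n"
      then obtain y where "y < n" "f y = f n" by blast
      then show "\<exists>y<n. merge (a, b) f y = merge (a, b) f n"
        by (intro exI[of _ y]) (simp add: merge_def)
    qed
    have E: "E \<subseteq> pairs n" using insert.prems by simp
    have ins: "finite E" "(a, b) \<notin> E" using insert.hyps e by auto
    have s: "a < Suc n" "b < Suc n" using e by auto
    show ?case
    proof (cases i)
      case 0
      show ?thesis
        by (simp only: 0 e(1) cnt_insert(2)[OF ins s] cnt_insert(2)[OF ins e(2,3)] insert.IH[OF E])
    next
      case (Suc j)
      show ?thesis
        unfolding Suc e(1) cnt_insert(1)[OF ins s] cnt_insert(1)[OF ins e(2,3)] insert.IH[OF E] m
        by (cases "\<exists>y<n. f y = f n") (simp_all only: if_True if_False simp_thms add_0)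
    qed
  qed
qed

section \<open>Invariance under permutations of the vertices\<close>

definition relabel :: "(nat \<Rightarrow> nat) \<Rightarrow> nat \<times> nat \<Rightarrow> nat \<times> nat" where
  "relabel p e = (min (p (fst e)) (p (snd e)), max (p (fst e)) (p (snd e)))"

lemma relabel_pairs:
  assumes "p permutes {..<n}" "e \<in> pairs n"
  shows "relabel p e \<in> pairs n"
proof -
  obtain a b where e: "e = (a, b)" "a < b" "b < n" using assms(2) by (auto simp: pairs_def)
  have "p a < n" "p b < n" "p a \<noteq> p b"
    using e assms(1) permutes_in_image[OF assms(1)] permutes_inj[OF assms(1)] by (auto simp: inj_eq)
  then show ?thesis by (auto simp: e pairs_def relabel_def min_def max_def)
qed

lemma inj_on_relabel:
  assumes "p permutes {..<n}"
  shows "inj_on (relabel p) (pairs n)"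
proof (rule inj_onI)
  fix e e' assume e: "e \<in> pairs n" "e' \<in> pairs n" "relabel p e = relabel p e'"
  obtain a b c d where ab: "e = (a, b)" "e' = (c, d)" by fastforce
  have m: "{min x y, max x y} = {x, y}" for x y :: nat by (auto simp: min_def max_def)
  have "p ` {a, b} = {fst (relabel p e), snd (relabel p e)}"
    by (simp only: relabel_def ab fst_conv snd_conv m image_insert image_empty)
  also have "\<dots> = {fst (relabel p e'), snd (relabel p e')}" by (simp only: e(3))
  also have "\<dots> = p ` {c, d}"
    by (simp only: relabel_def ab fst_conv snd_conv m image_insert image_empty)
  finally have "p ` {a, b} = p ` {c, d}" .
  then have "{a, b} = {c, d}" using permutes_inj[OF assms] by (simp only: inj_image_eq_iff)
  then show "e = e'" using e(1,2) ab by (auto simp: pairs_def doubleton_eq_iff)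
qed

text \<open>Induction on the edges with \<open>f\<close> arbitrary, since the contraction branch
  changes the labelling; composing with \<open>p\<close> turns the merge along the image edge into
  the merge along the original one.\<close>

lemma cnt_relabel:
  assumes p: "p permutes {..<n}" and "E \<subseteq> pairs n"
  shows "cnt n (relabel p ` E) f i = cnt n E (f \<circ> p) i"
proof -
  have "finite E" using assms(2) by (rule finite_subset) simp
  then show ?thesis using assms(2)
  proof (induction E arbitrary: f i rule: finite_induct)
    case empty
    have "(\<forall>x\<in>p ` {..<n}. \<forall>y\<in>p ` {..<n}. f x = f y) \<longleftrightarrow> (\<forall>x<n. \<forall>y<n. (f \<circ> p) x = (f \<circ> p) y)"
      by (simp only: ball_simps lessThan_iff Ball_def comp_def) blast
    then have k: "(\<forall>x<n. \<forall>y<n. f x = f y) \<longleftrightarrow> (\<forall>x<n. \<forall>y<n. (f \<circ> p) x = (f \<circ> p) y)"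
      by (simp only: permutes_image[OF p] lessThan_iff Ball_def)
    show ?case by (simp only: image_empty cnt_empty k)
  next
    case (insert e E)
    obtain a b where e: "e = (a, b)" "a < n" "b < n"
      using insert.prems by (auto simp: pairs_def)
    obtain c d where cd: "relabel p e = (c, d)" by fastforce
    have ep: "e \<in> pairs n" and E: "E \<subseteq> pairs n" using insert.prems by auto
    have "(c, d) \<in> pairs n" using relabel_pairs[OF p ep] cd by simp
    then have c: "c < n" "d < n" by (auto simp: pairs_def)
    have nin: "(c, d) \<notin> relabel p ` E"
      using inj_on_image_mem_iff[OF inj_on_relabel[OF p] ep E] insert.hyps(2) cd by simp
    have ins: "finite E" "(a, b) \<notin> E" using insert.hyps e by auto
    have "c = p a \<and> d = p b \<or> c = p b \<and> d = p a"
      using cd e(1) by (cases "p a \<le> p b") (auto simp: relabel_def)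
    then have m: "cnt n E (merge (c, d) f \<circ> p) j = cnt n E (merge (a, b) (f \<circ> p)) j" for j
    proof
      assume "c = p b \<and> d = p a"
      then show ?thesis
        by (intro cnt_cong) (simp only: merge_def comp_def fst_conv snd_conv merge_swap)
    qed (intro cnt_cong, simp add: merge_def)
    show ?case
    proof (cases i)
      case 0
      show ?thesis
        by (simp only: 0 e(1)[symmetric] cd image_insert)
          (simp only: cnt_insert(2)[OF finite_imageI[OF ins(1)] nin c] insert.IH[OF E] e(1)
            cnt_insert(2)[OF ins e(2,3)])
    next
      case (Suc j)
      have "cnt n (relabel p ` insert e E) f i
          = cnt n (relabel p ` E) f (Suc j) + cnt n (relabel p ` E) (merge (c, d) f) j"
        by (simp only: Suc image_insert cd cnt_insert(1)[OF finite_imageI[OF ins(1)] nin c])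
      also have "\<dots> = cnt n E (f \<circ> p) (Suc j) + cnt n E (merge (c, d) f \<circ> p) j"
        by (simp only: insert.IH[OF E])
      also have "\<dots> = cnt n (insert e E) (f \<circ> p) i"
        by (simp only: Suc e(1) m cnt_insert(1)[OF ins e(2,3)])
      finally show ?thesis .
    qed
  qed
qed

section \<open>Vertices of degree at most three\<close>

text \<open>Multiplication of the generating polynomial by x.\<close>

fun shift :: "(nat \<Rightarrow> nat) \<Rightarrow> nat \<Rightarrow> nat" where
  "shift g 0 = 0"
| "shift g (Suc i) = g i"

lemma shift_mono: "(\<And>j. g j \<le> h j) \<Longrightarrow> shift g i \<le> shift h i"
  by (cases i) auto

lemma shift_add: "shift (\<lambda>j. g j + h j) i = shift g i + shift h i"
  by (cases i) auto

lemma cnt_insert_shift: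
  assumes "finite E" "(a, b) \<notin> E" "a < n" "b < n"
  shows "cnt n (insert (a, b) E) f i = cnt n E f i + shift (cnt n E (merge (a, b) f)) i"
  using cnt_insert[OF assms] by (cases i) auto

text \<open>Contraction of \<open>T\<close> to a point. \<open>Min T\<close> is merely a convenient
  representative, since \<open>cnt\<close> depends only on the kernel.\<close>

definition glue :: "nat set \<Rightarrow> nat \<Rightarrow> nat" where
  "glue T x = (if x \<in> T then Min T else x)"

lemma glue_eq:
  assumes "finite T"
  shows "glue T x = glue T y \<longleftrightarrow> x = y \<or> x \<in> T \<and> y \<in> T"
  using Min_in[OF assms] by (cases "x \<in> T"; cases "y \<in> T") (auto simp: glue_def)

lemma cnt_glue_singleton: "cnt n E (glue {v}) i = cnt n E id i"
  by (rule cnt_cong) (simp add: glue_def)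

lemma merge_glue_eq:
  assumes "finite T" "v \<in> T"
  shows "merge (t, v) (glue T) x = merge (t, v) (glue T) y \<longleftrightarrow> x = y \<or> x \<in> insert t T \<and> y \<in> insert t T"
    and "merge (v, t) (glue T) x = merge (v, t) (glue T) y \<longleftrightarrow> x = y \<or> x \<in> insert t T \<and> y \<in> insert t T"
proof -
  have m: "Min T \<in> T" using assms Min_in by blast
  have 1: "merge (t, v) (glue T) z = (if z \<in> insert t T then glue T t else z)" for z
    using assms m by (auto simp: merge_def glue_def)
  show "merge (t, v) (glue T) x = merge (t, v) (glue T) y \<longleftrightarrow> x = y \<or> x \<in> insert t T \<and> y \<in> insert t T"
    using m by (cases "x \<in> insert t T"; cases "y \<in> insert t T") (auto simp: 1 glue_def)
  have 2: "merge (v, t) (glue T) z = (if z \<in> insert t T then Min T else z)" for z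
    using assms m by (auto simp: merge_def glue_def)
  show "merge (v, t) (glue T) x = merge (v, t) (glue T) y \<longleftrightarrow> x = y \<or> x \<in> insert t T \<and> y \<in> insert t T"
    using m by (cases "x \<in> insert t T"; cases "y \<in> insert t T") (auto simp: 2)
qed

lemma cnt_merge_glue:
  assumes "finite T" "v \<in> T"
  shows "cnt n E (merge (t, v) (glue T)) i = cnt n E (glue (insert t T)) i"
    and "cnt n E (merge (v, t) (glue T)) i = cnt n E (glue (insert t T)) i"
  by (rule cnt_cong, simp only: merge_glue_eq[OF assms] glue_eq[OF finite.insertI[OF assms(1)]])+

lemma cnt_glue_vertex:
  assumes "E \<subseteq> pairs n" "T \<subseteq> {..<n}" "0 < n"
  shows "cnt (Suc n) E (glue (insert n T)) i = (if T = {} then 0 else cnt n E (glue T) i)"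
proof -
  have fin: "finite T" using assms(2) by (rule finite_subset) simp
  then have fin': "finite (insert n T)" by simp
  have "(\<exists>y<n. glue (insert n T) y = glue (insert n T) n) \<longleftrightarrow> T \<noteq> {}"
    using assms(2) by (auto simp: glue_eq[OF fin'])
  moreover have "cnt n E (glue (insert n T)) i = cnt n E (glue T) i"
    by (rule cnt_cong) (auto simp: glue_eq[OF fin'] glue_eq[OF fin])
  ultimately show ?thesis by (simp add: cnt_vertex[OF assms(1,3)])
qed

definition star :: "nat \<Rightarrow> nat set \<Rightarrow> (nat \<times> nat) set" where
  "star v T = (\<lambda>s. (s, v)) ` T"

lemma star_insert: "E \<union> star v (insert t T) = insert (t, v) (E \<union> star v T)"
  by (auto simp: star_def)

lemma star_notin: "E \<subseteq> pairs v \<Longrightarrow> t \<notin> T \<Longrightarrow> (t, v) \<notin> E \<union> star v T"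
  by (auto simp: star_def pairs_def)

lemma cnt_star_insert:
  assumes "E \<subseteq> pairs n" "finite T" "t \<notin> T" "t < n" "finite U"
  shows "cnt (Suc n) (E \<union> star n (insert t T)) (glue (insert n U)) i
    = cnt (Suc n) (E \<union> star n T) (glue (insert n U)) i
      + shift (cnt (Suc n) (E \<union> star n T) (glue (insert n (insert t U)))) i"
proof -
  have "finite (E \<union> star n T)"
    using assms(1,2) finite_subset[OF assms(1)] by (simp add: star_def)
  then have "cnt (Suc n) (E \<union> star n (insert t T)) (glue (insert n U)) i
    = cnt (Suc n) (E \<union> star n T) (glue (insert n U)) i
      + shift (cnt (Suc n) (E \<union> star n T) (merge (t, n) (glue (insert n U)))) i"
    unfolding star_insert using assms(4) by (intro cnt_insert_shift star_notin[OF assms(1,3)]) auto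
  moreover have "cnt (Suc n) (E \<union> star n T) (merge (t, n) (glue (insert n U)))
    = cnt (Suc n) (E \<union> star n T) (glue (insert n (insert t U)))"
    using assms(5) by (intro ext) (simp only: cnt_merge_glue(1) finite_insert insertI1 insert_commute[of t n])
  ultimately show ?thesis by (simp only:)
qed

text \<open>Sum over the set U of surviving edges at the new vertex: a nonempty U contributes x^|U|
  N(E/U), and the empty one nothing because the vertex stays isolated. Contracting a singleton is
  trivial, which gives the factors 2 and 3.\<close>

lemma cnt_star:
  assumes "E \<subseteq> pairs n" "0 < n"
  shows "cnt (Suc n) E id i = 0"
    and "a < n \<Longrightarrow> cnt (Suc n) (E \<union> star n {a}) id i = shift (cnt n E id) i"
    and "a < n \<Longrightarrow> b < n \<Longrightarrow> a \<noteq> b \<Longrightarrow> cnt (Suc n) (E \<union> star n {a, b}) id i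
      = 2 * shift (cnt n E id) i + shift (shift (cnt n E (glue {a, b}))) i"
    and "a < n \<Longrightarrow> b < n \<Longrightarrow> c < n \<Longrightarrow> a \<noteq> b \<Longrightarrow> a \<noteq> c \<Longrightarrow> b \<noteq> c \<Longrightarrow>
      cnt (Suc n) (E \<union> star n {a, b, c}) id i
      = 3 * shift (cnt n E id) i
        + shift (shift (cnt n E (glue {a, b}))) i + shift (shift (cnt n E (glue {a, c}))) i
        + shift (shift (cnt n E (glue {b, c}))) i
        + shift (shift (shift (cnt n E (glue {a, b, c})))) i"
proof -
  let ?X = "\<lambda>T U. cnt (Suc n) (E \<union> star n T) (glue (insert n U))"
  have s: "?X (insert t T) U = (\<lambda>i. ?X T U i + shift (?X T (insert t U)) i)"
    if "finite T" "t \<notin> T" "t < n" "finite U" for t T U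
    by (rule ext) (rule cnt_star_insert[OF assms(1) that])
  have b: "?X {} U = (if U = {} then (\<lambda>i. 0) else cnt n E (glue U))" if "U \<subseteq> {..<n}" for U
    using cnt_glue_vertex[OF assms(1) that assms(2)] by (auto simp: star_def)
  have id: "cnt (Suc n) F id = cnt (Suc n) F (glue {n})" for F
    by (rule ext) (simp add: cnt_glue_singleton)
  have sing: "cnt n E (glue {x}) = cnt n E id" for x by (rule ext) (rule cnt_glue_singleton)
  have z: "shift (\<lambda>i. 0) j = 0" for j by (cases j) auto
  note rules = s b sing z shift_add
  show "cnt (Suc n) E id i = 0" using b[of "{}"] id by (simp add: star_def)
  show "cnt (Suc n) (E \<union> star n {a}) id i = shift (cnt n E id) i" if "a < n"
    unfolding id using that by (simp add: rules)
  show "cnt (Suc n) (E \<union> star n {a, b}) id i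
      = 2 * shift (cnt n E id) i + shift (shift (cnt n E (glue {a, b}))) i"
    if "a < n" "b < n" "a \<noteq> b"
    unfolding id using that by (simp add: rules) (simp add: insert_commute)
  show "cnt (Suc n) (E \<union> star n {a, b, c}) id i
      = 3 * shift (cnt n E id) i
        + shift (shift (cnt n E (glue {a, b}))) i + shift (shift (cnt n E (glue {a, c}))) i
        + shift (shift (cnt n E (glue {b, c}))) i
        + shift (shift (shift (cnt n E (glue {a, b, c})))) i"
    if "a < n" "b < n" "c < n" "a \<noteq> b" "a \<noteq> c" "b \<noteq> c"
    unfolding id using that by (simp add: rules) (simp add: insert_commute)
qed

text \<open>The first clause bounds N(E + ab) for a pair T = {a, b}. Stated through deletion and
  contraction, it also covers the case that ab is already an edge and would become double.\<close>

definition bounded :: "(nat \<Rightarrow> nat) \<Rightarrow> (nat \<Rightarrow> nat) \<Rightarrow> nat \<Rightarrow> (nat \<times> nat) set \<Rightarrow> bool" where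
  "bounded m r n E \<longleftrightarrow>
     (\<forall>T i. T \<subseteq> {..<n} \<and> card T = 2 \<longrightarrow> cnt n E id i + shift (cnt n E (glue T)) i \<le> m i) \<and>
     (\<forall>T i. T \<subseteq> {..<n} \<and> card T = 3 \<longrightarrow> cnt n E (glue T) i \<le> r i)"

definition nbrs :: "(nat \<times> nat) set \<Rightarrow> nat \<Rightarrow> nat set" where
  "nbrs E x = {y. (x, y) \<in> E \<or> (y, x) \<in> E}"

lemma cnt_insert_glue:
  assumes "finite E" "(a, b) \<notin> E" "a < n" "b < n" "finite T" "a \<in> T \<or> b \<in> T"
  shows "cnt n (insert (a, b) E) (glue T) i
    = cnt n E (glue T) i + shift (cnt n E (glue (insert a (insert b T)))) i"
proof -
  have "cnt n E (merge (a, b) (glue T)) = cnt n E (glue (insert a (insert b T)))"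
    using assms(6)
  proof
    assume "a \<in> T"
    then show ?thesis using cnt_merge_glue(2)[OF assms(5), of a n E b]
      by (auto simp: insert_absorb insert_commute)
  next
    assume "b \<in> T"
    then show ?thesis using cnt_merge_glue(1)[OF assms(5), of b n E a]
      by (auto simp: insert_absorb)
  qed
  then show ?thesis by (simp add: cnt_insert_shift[OF assms(1-4)])
qed

lemma cnt_insert_id:
  assumes "finite E" "(a, b) \<notin> E" "a < n" "b < n"
  shows "cnt n (insert (a, b) E) id i = cnt n E id i + shift (cnt n E (glue {a, b})) i"
  using cnt_insert_glue[OF assms, of "{a}" i]
  by (simp add: cnt_glue_singleton insert_commute)

text \<open>A neighbourhood of size 3 is the regrouping itself. For a smaller one, \<open>E\<close>
  has one or two edges too many; these are split off by deletion-contraction, so that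
  \<open>bnd\<close> always speaks about a graph with exactly \<open>k\<close> edges. The target is
  3xm + x^3 r in every case.\<close>

lemma low_degree_bound:
  assumes bnd: "\<And>H. H \<subseteq> pairs n \<Longrightarrow> card H = k \<Longrightarrow> bounded m r n H"
    and E: "E \<subseteq> pairs n" and T: "T \<subseteq> {..<n}" "card T \<le> 3" "card E + card T = k + 3"
    and nb: "card T = 2 \<Longrightarrow> \<exists>a\<in>T. nbrs E a \<noteq> {}" and n: "n \<ge> 3" "n \<le> k"
  shows "cnt (Suc n) (E \<union> star n T) id i \<le> 3 * shift m i + shift (shift (shift r)) i"
proof -
  have fin: "finite E" using E by (rule finite_subset) simp
  have finT: "finite T" using T(1) by (rule finite_subset) simp
  have n0: "0 < n" using n by simp
  have pm: "cnt n H id i + shift (cnt n H (glue U)) i \<le> m i"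
    if "H \<subseteq> pairs n" "card H = k" "U \<subseteq> {..<n}" "card U = 2" for H U i
    using bnd[OF that(1,2)] that(3,4) by (simp add: bounded_def)
  \<comment> \<open>The sets that arise below may have coinciding elements. Identifying further
    vertices only increases the count, so they can be enlarged to triples.\<close>
  have pr: "cnt n H (glue U) i \<le> r i"
    if H: "H \<subseteq> pairs n" "card H = k" and U: "U \<subseteq> {..<n}" "card U \<le> 3" for H U i
  proof -
    obtain W where W: "U \<subseteq> W" "W \<subseteq> {..<n}" "card W = 3"
      using exists_subset_between[of U 3 "{..<n}"] U n by auto
    have fw: "finite U" "finite W"
      by (rule finite_subset[OF U(1)], simp, rule finite_subset[OF W(2)], simp)
    have "finite H" using H(1) by (rule finite_subset) simp
    then have "cnt n H (glue U) i \<le> cnt n H (glue W) i"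
      using W(1) by (intro cnt_mono) (auto simp: glue_eq[OF fw(1)] glue_eq[OF fw(2)])
    also have "\<dots> \<le> r i" using bnd[OF H] W by (simp add: bounded_def)
    finally show ?thesis .
  qed
  consider "card T = 0" | "card T = 1" | "card T = 2" | "card T = 3" using T(2) by linarith
  then show ?thesis
  proof cases
    case 1
    then have "T = {}" using finT by simp
    then show ?thesis using cnt_star(1)[OF E n0] by (simp add: star_def)
  next
    case 2
    then obtain a where a: "T = {a}" by (auto simp: card_1_singleton_iff)
    have kE: "card E = k + 2" using T(3) 2 by simp
    \<comment> \<open>There are k + 2 edges but at most n <= k first endpoints, so two edges share
      one. Their union then spans only the three vertices x, y, z, within reach of the bound
      \<open>r\<close>.\<close>
    have "fst ` E \<subseteq> {..<n}" using E by (auto simp: pairs_def)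
    then have "card (fst ` E) < card E" using card_mono[of "{..<n}" "fst ` E"] kE n by simp
    then have "\<not> inj_on fst E" by (simp add: pigeonhole)
    then obtain e1 e2 where ee: "e1 \<in> E" "e2 \<in> E" "fst e1 = fst e2" "e1 \<noteq> e2"
      unfolding inj_on_def by blast
    define x y z where "x = fst e1" and "y = snd e1" and "z = snd e2"
    then have "e1 = (x, y)" "e2 = (x, z)" using ee(3) by (simp_all add: prod_eq_iff)
    then have e: "(x, y) \<in> E" "(x, z) \<in> E" "y \<noteq> z" using ee by auto
    define H where "H = E - {(x, y), (x, z)}"
    have H: "H \<subseteq> pairs n" "finite H" using E fin by (auto simp: H_def)
    have kH: "card H = k" using e kE fin by (simp add: H_def card_Diff_subset)
    have xyz: "x < n" "y < n" "z < n" "x \<noteq> y" "x \<noteq> z" using e E by (auto simp: pairs_def)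
    have E_eq: "E = insert (x, y) (insert (x, z) H)" using e by (auto simp: H_def)
    have f1: "cnt n E id j = cnt n (insert (x, z) H) id j + shift (cnt n (insert (x, z) H) (glue {x, y})) j" for j
      unfolding E_eq using xyz e H by (intro cnt_insert_id) (auto simp: H_def)
    have f2: "cnt n (insert (x, z) H) id j \<le> m j" for j
    proof -
      have "cnt n (insert (x, z) H) id j = cnt n H id j + shift (cnt n H (glue {x, z})) j"
        using xyz H by (intro cnt_insert_id) (auto simp: H_def)
      also have "\<dots> \<le> m j" using xyz by (intro pm H kH) auto
      finally show ?thesis .
    qed
    \<comment> \<open>Here x N(H/xy) is below \<open>m\<close> because it is one summand of the pair
      bound, and H/xyz is a triple contraction. Together with \<open>f1\<close> and
      \<open>f2\<close> this gives N(E) <= 2m + x^2 r.\<close>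
    have f3: "shift (cnt n (insert (x, z) H) (glue {x, y})) j \<le> m j + shift (shift r) j" for j
    proof -
      have "cnt n (insert (x, z) H) (glue {x, y}) = (\<lambda>i. cnt n H (glue {x, y}) i
          + shift (cnt n H (glue {x, z, y})) i)"
        using xyz H by (intro ext, subst cnt_insert_glue) (auto simp: H_def insert_commute)
      then have "shift (cnt n (insert (x, z) H) (glue {x, y})) j
          = shift (cnt n H (glue {x, y})) j + shift (shift (cnt n H (glue {x, z, y}))) j"
        by (simp add: shift_add)
      moreover have "shift (cnt n H (glue {x, y})) j \<le> m j"
        using pm[OF H(1) kH, of "{x, y}" j] xyz by simp
      moreover have "shift (shift (cnt n H (glue {x, z, y}))) j \<le> shift (shift r) j"
        using xyz by (intro shift_mono pr H kH) (auto simp: card_insert_if)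
      ultimately show ?thesis by linarith
    qed
    have "cnt n E id j \<le> 2 * m j + shift (shift r) j" for j
      using f1[of j] f2[of j] f3[of j] by linarith
    then have "shift (cnt n E id) i \<le> shift (\<lambda>j. 2 * m j + shift (shift r) j) i"
      by (rule shift_mono)
    also have "\<dots> \<le> 3 * shift m i + shift (shift (shift r)) i" by (cases i) auto
    finally show ?thesis using cnt_star(2)[OF E n0, of a i] a T(1) by simp
  next
    case 3
    obtain a y where a: "a \<in> T" "y \<in> nbrs E a" using nb[OF 3] by blast
    then obtain b where b: "T = {a, b}" "a \<noteq> b" using 3 by (auto simp: card_2_iff)
    obtain p q where e: "(p, q) \<in> E" "{p, q} = {a, y}" using a by (auto simp: nbrs_def)
    \<comment> \<open>The edge to be split off is chosen at \<open>a\<close>, so that p, q, a, b are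
      at most three different vertices and the double contraction is again governed by
      \<open>r\<close>.\<close>
    define H where "H = E - {(p, q)}"
    have H: "H \<subseteq> pairs n" "finite H" using E fin by (auto simp: H_def)
    have kH: "card H = k" using e T(3) 3 fin by (simp add: H_def)
    have pq: "p < n" "q < n" "p \<noteq> q" using e E by (auto simp: pairs_def)
    have ab: "a < n" "b < n" using T(1) b by auto
    have ap: "a = p \<or> a = q" using e(2) by auto
    have E_eq: "E = insert (p, q) H" "(p, q) \<notin> H" using e by (auto simp: H_def)
    have 1: "cnt n E id j \<le> m j" for j
      unfolding E_eq(1) using pq by (subst cnt_insert_id[OF H(2) E_eq(2)]) (auto intro!: pm H kH)
    have "cnt n E (glue {a, b}) = (\<lambda>j. cnt n H (glue {a, b}) j
        + shift (cnt n H (glue (insert p (insert q {a, b})))) j)"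
      unfolding E_eq(1) using pq ap
      by (intro ext) (rule cnt_insert_glue[OF H(2) E_eq(2)], auto)
    then have "shift (cnt n E (glue {a, b})) j = shift (cnt n H (glue {a, b})) j
        + shift (shift (cnt n H (glue (insert p (insert q {a, b}))))) j" for j
      by (simp add: shift_add)
    then have "shift (cnt n E (glue {a, b})) j \<le> m j + shift (shift r) j"
      if "shift (shift (cnt n H (glue (insert p (insert q {a, b}))))) j \<le> shift (shift r) j"
        "shift (cnt n H (glue {a, b})) j \<le> m j" for j
      using that by simp
    moreover have "shift (cnt n H (glue {a, b})) j \<le> m j" for j
      using pm[OF H(1) kH, of "{a, b}" j] ab b by simp
    moreover have "shift (shift (cnt n H (glue (insert p (insert q {a, b}))))) j \<le> shift (shift r) j" for j
      using pq ab ap by (intro shift_mono pr H kH) (auto simp: card_insert_if)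
    ultimately have 2: "shift (cnt n E (glue {a, b})) j \<le> m j + shift (shift r) j" for j
      by blast
    have "cnt (Suc n) (E \<union> star n T) id i
        = 2 * shift (cnt n E id) i + shift (shift (cnt n E (glue {a, b}))) i"
      unfolding b(1) by (rule cnt_star(3)[OF E n0 ab b(2)])
    also have "\<dots> \<le> 2 * shift m i + shift (\<lambda>j. m j + shift (shift r) j) i"
      using 1 2 by (intro add_mono mult_left_mono shift_mono) auto
    also have "\<dots> = 3 * shift m i + shift (shift (shift r)) i" by (simp add: shift_add)
    finally show ?thesis .
  next
    case 4
    then obtain a b c where abc: "T = {a, b, c}" "a \<noteq> b" "a \<noteq> c" "b \<noteq> c"
      by (auto simp: card_3_iff)
    have l: "a < n" "b < n" "c < n" using abc T(1) by auto
    have kE: "card E = k" using T(3) 4 by simp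
    \<comment> \<open>Each of the three pairs takes one copy of x N(E); the term that remains is the
      contraction of the whole triple.\<close>
    have pair: "shift (cnt n E id) i + shift (shift (cnt n E (glue {x, y}))) i \<le> shift m i"
      if "x < n" "y < n" "x \<noteq> y" for x y
    proof -
      have "shift (\<lambda>j. cnt n E id j + shift (cnt n E (glue {x, y})) j) i \<le> shift m i"
        using that by (intro shift_mono pm E kE) auto
      then show ?thesis by (simp add: shift_add)
    qed
    have "shift (shift (shift (cnt n E (glue {a, b, c})))) i \<le> shift (shift (shift r)) i"
      using l abc by (intro shift_mono pr E kE) (auto simp: card_insert_if)
    then show ?thesis
      using cnt_star(4)[OF E n0 l abc(2-4), of i] pair[of a b] pair[of a c] pair[of b c] l abc
      by simp
  qed
qed

section \<open>Graphs and relabelling\<close>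

definition edge :: "nat \<times> nat \<Rightarrow> nat set" where
  "edge e = {fst e, snd e}"

lemma mem_edge_image: "{x, y} \<in> edge ` T \<longleftrightarrow> (x, y) \<in> T \<or> (y, x) \<in> T"
  by (force simp: edge_def doubleton_eq_iff image_iff)

lemma inj_on_edge: "inj_on edge (pairs n)"
  by (rule inj_onI) (auto simp: edge_def pairs_def doubleton_eq_iff)

lemma conn_id_iff: "conn n id T \<longleftrightarrow> connected_spanning n (edge ` T)"
proof -
  have "{(x, y). {x, y} \<in> edge ` T} = T \<union> T\<inverse>"
    by (auto simp: mem_edge_image)
  moreover have "(same n id \<union> T \<union> T\<inverse>)\<^sup>* = (T \<union> T\<inverse>)\<^sup>*"
    by (rule rtrancl_subset) (auto simp: same_def)
  ultimately show ?thesis by (simp add: conn_def connected_spanning_def)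
qed

lemma card_connected_spanning:
  assumes "E \<subseteq> pairs n"
  shows "card {S. S \<subseteq> edge ` E \<and> card S = i \<and> connected_spanning n S} = cnt n E id i"
proof -
  have inj: "inj_on edge E" using inj_on_edge assms by (rule inj_on_subset)
  have c: "card (edge ` T) = card T" if "T \<subseteq> E" for T
    using inj_on_subset[OF inj that] by (rule card_image)
  have "{S. S \<subseteq> edge ` E \<and> card S = i \<and> connected_spanning n S}
      = (\<lambda>T. edge ` T) ` {T. T \<subseteq> E \<and> card T = i \<and> conn n id T}" (is "?A = ?B")
  proof (intro equalityI subsetI)
    fix S assume S: "S \<in> ?A"
    then obtain T where "T \<subseteq> E" "S = edge ` T" by (auto simp: subset_image_iff)
    then show "S \<in> ?B" using S c by (auto simp: conn_id_iff)
  qed (auto simp: conn_id_iff c)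
  moreover have "inj_on (\<lambda>T. edge ` T) {T. T \<subseteq> E \<and> card T = i \<and> conn n id T}"
    using inj_on_image_eq_iff[OF inj] by (intro inj_onI) simp
  ultimately show ?thesis by (simp add: cnt_def card_image)
qed

lemma simple_graph_pairs:
  assumes "simple_graph n G"
  obtains E where "E \<subseteq> pairs n" "G = edge ` E"
proof
  show "{e \<in> pairs n. edge e \<in> G} \<subseteq> pairs n" by auto
  show "G = edge ` {e \<in> pairs n. edge e \<in> G}"
  proof (intro equalityI subsetI)
    fix x assume x: "x \<in> G"
    then obtain u v where uv: "u < n" "v < n" "u \<noteq> v" "x = {u, v}"
      using assms by (auto simp: simple_graph_def)
    then have "(min u v, max u v) \<in> pairs n" "edge (min u v, max u v) = x"
      by (auto simp: pairs_def edge_def min_def max_def)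
    then show "x \<in> edge ` {e \<in> pairs n. edge e \<in> G}" using x by (intro image_eqI[of _ _ "(min u v, max u v)"]) auto
  qed auto
qed

lemma reliability_eq:
  assumes "E \<subseteq> pairs n"
  shows "reliability n (edge ` E) \<rho>
    = (\<Sum>i\<le>card E. real (cnt n E id i) * ((1 - \<rho>) ^ i * \<rho> ^ (card E - i)))"
proof -
  let ?A = "{S. S \<subseteq> edge ` E \<and> connected_spanning n S}"
  let ?h = "\<lambda>S. (1 - \<rho>) ^ card S * \<rho> ^ card (edge ` E - S)"
  have finE: "finite E" using assms by (rule finite_subset) simp
  have cE: "card (edge ` E) = card E" using inj_on_subset[OF inj_on_edge assms] by (rule card_image)
  have finA: "finite ?A" using finE by (intro finite_subset[of ?A "Pow (edge ` E)"]) auto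
  have "card ` ?A \<subseteq> {..card E}" using finE cE card_mono[of "edge ` E"] by auto
  then have "reliability n (edge ` E) \<rho> = (\<Sum>i\<le>card E. sum ?h {S \<in> ?A. card S = i})"
    unfolding reliability_def using finA by (intro sum.group[symmetric]) auto
  also have "\<dots> = (\<Sum>i\<le>card E. real (cnt n E id i) * ((1 - \<rho>) ^ i * \<rho> ^ (card E - i)))"
  proof (rule sum.cong[OF refl])
    fix i
    have "?h S = (1 - \<rho>) ^ i * \<rho> ^ (card E - i)" if "S \<in> {S \<in> ?A. card S = i}" for S
    proof -
      have "S \<subseteq> edge ` E" "card S = i" using that by auto
      moreover have "finite S" using calculation(1) finE by (meson finite_imageI finite_subset)
      ultimately show ?thesis by (simp add: card_Diff_subset cE)
    qed
    then have "sum ?h {S \<in> ?A. card S = i} = (\<Sum>S\<in>{S \<in> ?A. card S = i}. (1 - \<rho>) ^ i * \<rho> ^ (card E - i))"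
      by (rule sum.cong[OF refl])
    then have "sum ?h {S \<in> ?A. card S = i} = real (card {S \<in> ?A. card S = i}) * ((1 - \<rho>) ^ i * \<rho> ^ (card E - i))"
      by (simp only: sum_constant)
    moreover have "{S \<in> ?A. card S = i} = {S. S \<subseteq> edge ` E \<and> card S = i \<and> connected_spanning n S}"
      by auto
    ultimately show "sum ?h {S \<in> ?A. card S = i} = real (cnt n E id i) * ((1 - \<rho>) ^ i * \<rho> ^ (card E - i))"
      using card_connected_spanning[OF assms, of i] by simp
  qed
  finally show ?thesis .
qed

lemma uniformly_most_reliableI:
  assumes K: "K \<subseteq> pairs n" "card K = e"
    and le: "\<And>E i. E \<subseteq> pairs n \<Longrightarrow> card E = e \<Longrightarrow> cnt n E id i \<le> cnt n K id i"
  shows "uniformly_most_reliable n e (edge ` K)"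
proof -
  have ce: "card (edge ` E) = card E" if "E \<subseteq> pairs n" for E
    using inj_on_subset[OF inj_on_edge that] by (rule card_image)
  have "simple_graph n (edge ` K)"
    unfolding simple_graph_def
  proof
    fix x assume "x \<in> edge ` K"
    then obtain a b where "x = {a, b}" "(a, b) \<in> K" by (auto simp: edge_def)
    then show "\<exists>u v. u < n \<and> v < n \<and> u \<noteq> v \<and> x = {u, v}"
      using K(1) by (intro exI[of _ a] exI[of _ b]) (auto simp: pairs_def)
  qed
  then have "ne_graph n e (edge ` K)" using ce[OF K(1)] K(2) by (simp add: ne_graph_def)
  moreover have "unreliability n (edge ` K) \<rho> \<le> unreliability n G \<rho>"
    if G: "ne_graph n e G" and \<rho>: "0 \<le> \<rho>" "\<rho> \<le> 1" for G and \<rho> :: real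
  proof -
    have "simple_graph n G" using G by (simp add: ne_graph_def)
    from simple_graph_pairs[OF this] obtain E where E: "E \<subseteq> pairs n" "G = edge ` E"
      by blast
    have cE: "card E = e" using ce[OF E(1)] G E(2) by (simp add: ne_graph_def)
    have "reliability n G \<rho> \<le> reliability n (edge ` K) \<rho>"
      unfolding E(2) reliability_eq[OF E(1)] reliability_eq[OF K(1)] cE K(2)
      using le[OF E(1) cE] \<rho> by (intro sum_mono mult_right_mono) auto
    then show ?thesis by (simp add: unreliability_def)
  qed
  ultimately show ?thesis by (simp add: uniformly_most_reliable_def)
qed

section \<open>Degrees and the choice of a vertex of minimal degree\<close>

lemma nbrs_iff: "y \<in> nbrs E x \<longleftrightarrow> {x, y} \<in> edge ` E"
  by (auto simp: nbrs_def mem_edge_image)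

lemma sum_degree:
  assumes "E \<subseteq> pairs n"
  shows "(\<Sum>x<n. card (nbrs E x)) = 2 * card E"
proof -
  have fin: "finite {y. (x, y) \<in> E}" "finite {y. (y, x) \<in> E}" for x
    using assms by (auto intro!: finite_subset[of _ "{..<n}"] simp: pairs_def)
  have lt: "a < b" if "(a, b) \<in> E" for a b using that assms by (auto simp: pairs_def)
  have "card (nbrs E x) = card {y. (x, y) \<in> E} + card {y. (y, x) \<in> E}" for x
  proof -
    have "nbrs E x = {y. (x, y) \<in> E} \<union> {y. (y, x) \<in> E}" by (auto simp: nbrs_def)
    moreover have "{y. (x, y) \<in> E} \<inter> {y. (y, x) \<in> E} = {}" by (auto dest!: lt)
    ultimately show ?thesis using fin by (simp add: card_Un_disjoint)
  qed
  moreover have "(\<Sum>x<n. card {y. (x, y) \<in> E}) = card E"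
  proof -
    have "E = Sigma {..<n} (\<lambda>x. {y. (x, y) \<in> E})" using assms by (auto simp: pairs_def)
    then have "card E = card (Sigma {..<n} (\<lambda>x. {y. (x, y) \<in> E}))" by simp
    then show ?thesis using fin by (simp add: card_SigmaI)
  qed
  moreover have "(\<Sum>x<n. card {y. (y, x) \<in> E}) = card E"
  proof -
    have "E\<inverse> = Sigma {..<n} (\<lambda>x. {y. (y, x) \<in> E})" using assms by (auto simp: pairs_def)
    then have "card (E\<inverse>) = card (Sigma {..<n} (\<lambda>x. {y. (y, x) \<in> E}))" by simp
    then show ?thesis using fin by (simp add: card_SigmaI)
  qed
  ultimately show ?thesis by (simp add: sum.distrib)
qed

lemma edge_relabel: "edge (relabel p e) = p ` edge e"
  by (auto simp: edge_def relabel_def min_def max_def)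

lemma nbrs_relabel:
  assumes "p permutes {..<n}"
  shows "nbrs (relabel p ` E) (p x) = p ` nbrs E x"
proof -
  have inj: "inj p" using assms by (rule permutes_inj)
  have mem: "p y \<in> nbrs (relabel p ` E) (p x) \<longleftrightarrow> y \<in> nbrs E x" for y
  proof -
    have "edge ` relabel p ` E = (\<lambda>s. p ` s) ` edge ` E"
      by (simp only: image_image edge_relabel)
    moreover have "{p x, p y} = p ` {x, y}" by simp
    moreover have "inj (\<lambda>s. p ` s)" using inj by (simp add: inj_image_eq_iff inj_def)
    ultimately show ?thesis by (simp only: nbrs_iff inj_image_mem_iff)
  qed
  show ?thesis
  proof (rule set_eqI)
    fix z
    obtain y where "z = p y" using permutes_surj[OF assms] by (auto simp: surj_def)
    then show "z \<in> nbrs (relabel p ` E) (p x) \<longleftrightarrow> z \<in> p ` nbrs E x"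
      by (simp add: mem inj_image_mem_iff[OF inj])
  qed
qed

lemma relabel_image_pairs: "p permutes {..<n} \<Longrightarrow> E \<subseteq> pairs n \<Longrightarrow> relabel p ` E \<subseteq> pairs n"
  using relabel_pairs by blast

lemma card_relabel: "p permutes {..<n} \<Longrightarrow> E \<subseteq> pairs n \<Longrightarrow> card (relabel p ` E) = card E"
  using inj_on_subset[OF inj_on_relabel] by (intro card_image) blast

lemma cnt_relabel_id:
  assumes "p permutes {..<n}" "E \<subseteq> pairs n"
  shows "cnt n (relabel p ` E) id i = cnt n E id i"
  unfolding cnt_relabel[OF assms]
  by (rule cnt_cong) (simp add: inj_eq[OF permutes_inj[OF assms(1)]])

lemma cnt_relabel_glue:
  assumes "p permutes {..<n}" "E \<subseteq> pairs n" "finite T"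
  shows "cnt n (relabel p ` E) (glue (p ` T)) i = cnt n E (glue T) i"
  unfolding cnt_relabel[OF assms(1,2)]
  by (rule cnt_cong)
    (simp only: comp_def glue_eq[OF finite_imageI[OF assms(3)]] glue_eq[OF assms(3)]
      inj_eq[OF permutes_inj[OF assms(1)]] inj_image_mem_iff[OF permutes_inj[OF assms(1)]])

lemma bounded_relabel:
  assumes p: "p permutes {..<n}" and E: "E \<subseteq> pairs n" and b: "bounded m r n (relabel p ` E)"
  shows "bounded m r n E"
proof -
  have T: "finite T" "p ` T \<subseteq> {..<n}" "card (p ` T) = card T" if "T \<subseteq> {..<n}" for T
    using that permutes_image[OF p] finite_subset[OF that] permutes_inj_on[OF p]
    by (auto intro: card_image)
  have e: "cnt n (relabel p ` E) (glue (p ` T)) = cnt n E (glue T)" if "T \<subseteq> {..<n}" for T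
    by (rule ext) (rule cnt_relabel_glue[OF p E T(1)[OF that]])
  show ?thesis
    unfolding bounded_def
  proof (intro conjI allI impI; elim conjE)
    fix T i assume t: "T \<subseteq> {..<n}" "card T = 2"
    then show "cnt n E id i + shift (cnt n E (glue T)) i \<le> m i"
      using b[unfolded bounded_def, THEN conjunct1, rule_format, of "p ` T" i] T[OF t(1)]
      by (simp add: e cnt_relabel_id[OF p E])
  next
    fix T i assume t: "T \<subseteq> {..<n}" "card T = 3"
    then show "cnt n E (glue T) i \<le> r i"
      using b[unfolded bounded_def, THEN conjunct2, rule_format, of "p ` T" i] T[OF t(1)]
      by (simp add: e)
  qed
qed

lemma pairs_split:
  assumes "E \<subseteq> pairs (Suc n)"
  shows "E = (E \<inter> pairs n) \<union> star n (nbrs E n)" "nbrs E n \<subseteq> {..<n}"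
    and "card E = card (E \<inter> pairs n) + card (nbrs E n)"
proof -
  show E: "E = (E \<inter> pairs n) \<union> star n (nbrs E n)"
    using assms by (auto simp: star_def nbrs_def pairs_def less_Suc_eq)
  show n: "nbrs E n \<subseteq> {..<n}" using assms by (auto simp: nbrs_def pairs_def)
  have "finite (nbrs E n)" using n by (rule finite_subset) simp
  moreover have "inj_on (\<lambda>s. (s, n)) (nbrs E n)" by (auto intro: inj_onI)
  moreover have "(E \<inter> pairs n) \<inter> star n (nbrs E n) = {}" by (auto simp: star_def pairs_def)
  ultimately have "card ((E \<inter> pairs n) \<union> star n (nbrs E n)) = card (E \<inter> pairs n) + card (nbrs E n)"
    by (simp add: card_Un_disjoint card_image star_def)
  then show "card E = card (E \<inter> pairs n) + card (nbrs E n)" using E by simp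
qed

lemma relabel_star:
  assumes "p permutes {..<n}" "S \<subseteq> {..<n}" "p v = v" "n \<le> v"
  shows "relabel p ` star v S = star v (p ` S)"
proof -
  have "relabel p (s, v) = (p s, v)" if "s \<in> S" for s
  proof -
    have "p s < n" using that assms permutes_in_image[OF assms(1), of s] by auto
    then show ?thesis using assms(3,4) by (simp add: relabel_def)
  qed
  then show ?thesis by (auto simp: star_def image_image)
qed

lemma ex_min_degree:
  assumes "0 < n"
  obtains v where "v < n" "\<And>x. x < n \<Longrightarrow> card (nbrs E v) \<le> card (nbrs E x)"
proof -
  define v where "v = arg_min_on (\<lambda>x. card (nbrs E x)) {..<n}"
  have ne: "finite {..<n}" "{..<n} \<noteq> {}" using assms by auto
  have "v \<in> {..<n}" unfolding v_def by (rule arg_min_if_finite(1)[OF ne])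
  moreover have "card (nbrs E v) \<le> card (nbrs E x)" if "x \<in> {..<n}" for x
    unfolding v_def by (rule arg_min_least[OF ne that])
  ultimately show ?thesis using that[of v] by simp
qed

text \<open>Brings the vertex to be removed to the last index, where \<open>pairs_split\<close> and
  the star expansion apply.\<close>

lemma min_degree_last:
  assumes E: "E \<subseteq> pairs (Suc n)"
  obtains p where "p permutes {..<Suc n}"
    "\<And>x. x < Suc n \<Longrightarrow> card (nbrs (relabel p ` E) n) \<le> card (nbrs (relabel p ` E) x)"
proof -
  obtain v where v: "v < Suc n" "\<And>x. x < Suc n \<Longrightarrow> card (nbrs E v) \<le> card (nbrs E x)"
    using ex_min_degree[of "Suc n" E] by auto
  define p where "p = Transposition.transpose v n"
  have p: "p permutes {..<Suc n}" unfolding p_def using v(1) by (intro permutes_swap_id) auto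
  have c: "card (nbrs (relabel p ` E) (p x)) = card (nbrs E x)" for x
    unfolding nbrs_relabel[OF p] using permutes_inj_on[OF p] by (rule card_image)
  have pv: "p v = n" by (simp add: p_def)
  have "card (nbrs (relabel p ` E) n) \<le> card (nbrs (relabel p ` E) x)" if x: "x < Suc n" for x
  proof -
    obtain y where y: "y < Suc n" "x = p y" using x permutes_image[OF p] by blast
    show ?thesis using v(2)[OF y(1)] c[of v] c[of y] pv y(2) by simp
  qed
  then show ?thesis using that p by blast
qed

text \<open>Removing a vertex of minimal degree, not just of low degree, supplies the extra premise
  of \<open>low_degree_bound\<close>: if the minimum is 2, each neighbour of the removed vertex has
  another edge, which survives in the rest.\<close>

lemma cnt_le_of_low_degree:
  assumes bnd: "\<And>H. H \<subseteq> pairs n \<Longrightarrow> card H = k \<Longrightarrow> bounded m r n H"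
    and E: "E \<subseteq> pairs (Suc n)" "card E = k + 3" and low: "\<exists>x<Suc n. card (nbrs E x) \<le> 3"
    and n: "n \<ge> 3" "n \<le> k"
  shows "cnt (Suc n) E id i \<le> 3 * shift m i + shift (shift (shift r)) i"
proof -
  obtain p where p: "p permutes {..<Suc n}"
    and min: "\<And>x. x < Suc n \<Longrightarrow> card (nbrs (relabel p ` E) n) \<le> card (nbrs (relabel p ` E) x)"
    using min_degree_last[OF E(1)] by blast
  define F where "F = relabel p ` E"
  have F: "F \<subseteq> pairs (Suc n)" "card F = k + 3"
    using relabel_image_pairs[OF p E(1)] card_relabel[OF p E(1)] E(2) by (simp_all add: F_def)
  let ?T = "nbrs F n"
  note sp = pairs_split[OF F(1)]
  obtain x where x: "x < Suc n" "card (nbrs E x) \<le> 3" using low by blast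
  have "card (nbrs F (p x)) = card (nbrs E x)"
    unfolding F_def nbrs_relabel[OF p] using permutes_inj_on[OF p] by (rule card_image)
  moreover have "p x < Suc n" using permutes_in_image[OF p, of x] x(1) by simp
  ultimately have T3: "card ?T \<le> 3" using min[of "p x"] x(2) by (simp add: F_def)
  have "cnt (Suc n) ((F \<inter> pairs n) \<union> star n ?T) id i \<le> 3 * shift m i + shift (shift (shift r)) i"
  proof (rule low_degree_bound[OF bnd])
    show "card (F \<inter> pairs n) + card ?T = k + 3" using sp(3) F(2) by simp
    show "\<exists>a\<in>?T. nbrs (F \<inter> pairs n) a \<noteq> {}" if 2: "card ?T = 2"
    proof -
      obtain a where a: "a \<in> ?T" using 2 by fastforce
      then have an: "a < Suc n" using sp(2) by auto
      have "nbrs F a \<subseteq> insert n (nbrs (F \<inter> pairs n) a)"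
        using F(1) a by (auto simp: nbrs_def pairs_def)
      moreover have "2 \<le> card (nbrs F a)" using min[OF an] 2 by (simp add: F_def)
      ultimately have "nbrs (F \<inter> pairs n) a \<noteq> {}"
        using card_mono[of "{n}" "nbrs F a"] by auto
      then show ?thesis using a by blast
    qed
  qed (use sp(2) T3 n in auto)
  then have "cnt (Suc n) F id i \<le> 3 * shift m i + shift (shift (shift r)) i" using sp(1) by simp
  then show ?thesis unfolding F_def cnt_relabel_id[OF p E(1)] .
qed

section \<open>Computing with partitions of six vertices\<close>

fun coeff :: "nat list \<Rightarrow> nat \<Rightarrow> nat" where
  "coeff [] i = 0"
| "coeff (a # p) 0 = a"
| "coeff (a # p) (Suc i) = coeff p i"

fun padd :: "nat list \<Rightarrow> nat list \<Rightarrow> nat list" where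
  "padd [] q = q"
| "padd (a # p) [] = a # p"
| "padd (a # p) (b # q) = (a + b) # padd p q"

fun ple :: "nat list \<Rightarrow> nat list \<Rightarrow> bool" where
  "ple [] q = True"
| "ple (a # p) [] = (a = 0 \<and> ple p [])"
| "ple (a # p) (b # q) = (a \<le> b \<and> ple p q)"

lemma coeff_padd: "coeff (padd p q) i = coeff p i + coeff q i"
proof (induction p q arbitrary: i rule: padd.induct)
  case (3 a p b q)
  then show ?case by (cases i) auto
qed auto

lemma coeff_shift: "coeff (0 # p) = shift (coeff p)"
proof
  show "coeff (0 # p) i = shift (coeff p) i" for i by (cases i) auto
qed

lemma coeff_if: "coeff (if P then [1] else []) i = (if i = 0 \<and> P then 1 else 0)"
  by (cases i) auto

lemma ple_coeff: "ple p q \<Longrightarrow> coeff p i \<le> coeff q i"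
proof (induction p q arbitrary: i rule: ple.induct)
  case (2 a p)
  then show ?case by (cases i) auto
next
  case (3 a p b q)
  then show ?case by (cases i) auto
qed auto

definition subst :: "nat \<Rightarrow> nat \<Rightarrow> nat \<Rightarrow> nat" where
  "subst y x z = (if z = y then x else z)"

text \<open>A partition is stored as the list assigning to each vertex the least vertex of its block; joining
  two blocks keeps the smaller label, so that lists remain canonical keys for the tables.\<close>

definition join :: "nat \<Rightarrow> nat \<Rightarrow> nat list \<Rightarrow> nat list" where
  "join x y l = (if x = y then l else if x < y then map (subst y x) l else map (subst x y) l)"

definition lmerge :: "nat \<times> nat \<Rightarrow> nat list \<Rightarrow> nat list" where
  "lmerge e l = join (l ! fst e) (l ! snd e) l"

lemma length_lmerge [simp]: "length (lmerge e l) = length l"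
  by (simp add: lmerge_def join_def)

lemma merge_eq_iff:
  "merge (a, b) f x = merge (a, b) f y \<longleftrightarrow>
    f x = f y \<or> (f x = f a \<or> f x = f b) \<and> (f y = f a \<or> f y = f b)"
  by (simp add: merge_def) metis

text \<open>Counterpart of \<open>merge_eq_iff\<close>. \<open>merge\<close> keeps the label of the
  first endpoint and \<open>join\<close> the smaller one, so the two labellings differ but have the
  same kernel.\<close>

lemma lmerge_eq_iff:
  assumes "a < length l" "b < length l" "x < length l" "y < length l"
  shows "lmerge (a, b) l ! x = lmerge (a, b) l ! y \<longleftrightarrow>
    l ! x = l ! y \<or> (l ! x = l ! a \<or> l ! x = l ! b) \<and> (l ! y = l ! a \<or> l ! y = l ! b)"
proof -
  consider "l ! a = l ! b" | "l ! a < l ! b" | "l ! b < l ! a" by linarith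
  then show ?thesis
  proof cases
    case 1
    then show ?thesis by (simp add: lmerge_def join_def) metis
  next
    case 2
    then show ?thesis using assms by (simp add: lmerge_def join_def subst_def) metis
  next
    case 3
    then show ?thesis using assms by (simp add: lmerge_def join_def subst_def) metis
  qed
qed

fun csg :: "(nat \<times> nat) list \<Rightarrow> nat list \<Rightarrow> nat list" where
  "csg [] l = (if list_all (\<lambda>x. x = hd l) l then [1] else [])"
| "csg (e # es) l = padd (csg es l) (0 # csg es (lmerge e l))"

lemma coeff_csg:
  assumes "distinct es" "set es \<subseteq> pairs 6" "length l = 6"
  shows "coeff (csg es l) i = cnt 6 (set es) ((!) l) i"
  using assms
proof (induction es arbitrary: l i)
  case Nil
  have k: "list_all (\<lambda>x. x = hd l) l \<longleftrightarrow> (\<forall>x<6. \<forall>y<6. l ! x = l ! y)" (is "?l \<longleftrightarrow> ?r")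
  proof
    assume ?l
    then have "l ! x = hd l" if "x < 6" for x using that Nil(3) by (simp add: list_all_length)
    then show ?r by simp
  next
    assume r: ?r
    have "hd l = l ! 0" using Nil(3) by (intro hd_conv_nth) auto
    then have "l ! x = hd l" if "x < 6" for x using r[rule_format, of x 0] that by simp
    then show ?l using Nil(3) by (simp add: list_all_length)
  qed
  show ?case
    unfolding csg.simps(1) k list.set cnt_empty by (rule coeff_if)
next
  case (Cons e es)
  obtain a b where e: "e = (a, b)" "a < 6" "b < 6" using Cons.prems by (auto simp: pairs_def)
  have "cnt 6 (set es) (merge (a, b) ((!) l)) j = cnt 6 (set es) ((!) (lmerge (a, b) l)) j" for j
    using Cons.prems(3) e by (intro cnt_cong) (simp only: merge_eq_iff lmerge_eq_iff)
  then have "cnt 6 (set es) (merge (a, b) ((!) l)) = coeff (csg es (lmerge e l))"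
    using Cons by (intro ext) (simp add: e(1))
  moreover have "cnt 6 (set (e # es)) ((!) l) i
      = cnt 6 (set es) ((!) l) i + shift (cnt 6 (set es) (merge (a, b) ((!) l))) i"
    unfolding e(1) list.set using Cons.prems(1) e by (intro cnt_insert_shift) auto
  ultimately show ?case using Cons by (simp add: coeff_padd coeff_shift)
qed

text \<open>Expansion over the edges from an extra vertex to \<open>S\<close>: the extra vertex is either still isolated
  (\<open>None\<close>) or already joined to the block of a vertex \<open>a\<close> (\<open>Some a\<close>), so lists over six vertices suffice.\<close>

fun sweep :: "(nat option \<Rightarrow> nat list \<Rightarrow> nat list) \<Rightarrow> nat list \<Rightarrow> nat option \<Rightarrow> nat list \<Rightarrow> nat list" where
  "sweep W [] c l = W c l"
| "sweep W (s # S) None l = padd (sweep W S None l) (0 # sweep W S (Some s) l)"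
| "sweep W (s # S) (Some a) l = padd (sweep W S (Some a) l) (0 # sweep W S (Some a) (lmerge (a, s) l))"

text \<open>Applied when all edges at the extra vertex have been decided: if it is still isolated,
  no connected subgraph is left and the polynomial is zero.\<close>

fun attached :: "(nat list \<Rightarrow> nat list) \<Rightarrow> nat option \<Rightarrow> nat list \<Rightarrow> nat list" where
  "attached W None l = []"
| "attached W (Some a) l = W l"

definition labels :: "nat list \<Rightarrow> (nat \<Rightarrow> nat) \<Rightarrow> bool" where
  "labels l f \<longleftrightarrow> length l = 6 \<and> (\<forall>x<6. \<forall>y<6. f x = f y \<longleftrightarrow> l ! x = l ! y)"

definition rep :: "nat \<Rightarrow> nat option \<Rightarrow> nat list \<Rightarrow> (nat \<Rightarrow> nat) \<Rightarrow> bool" where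
  "rep v c l f \<longleftrightarrow> labels l f \<and>
     (case c of None \<Rightarrow> (\<forall>x<6. f v \<noteq> f x) | Some a \<Rightarrow> a < 6 \<and> f v = f a)"

lemma rep_kernel: "rep v c l f \<Longrightarrow> x < 6 \<Longrightarrow> y < 6 \<Longrightarrow> f x = f y \<longleftrightarrow> l ! x = l ! y"
  unfolding rep_def labels_def by blast

lemma rep_None:
  assumes "rep v None l f" "s < 6"
  shows "rep v (Some s) l (merge (s, v) f)"
proof -
  have f: "f x \<noteq> f v" if "x < 6" for x using assms(1) that by (auto simp: rep_def)
  have "merge (s, v) f x = f x" if "x < 6" for x using f[OF that] by (simp add: merge_def)
  moreover have "merge (s, v) f v = f s" by (simp add: merge_def)
  ultimately show ?thesis
    using rep_kernel[OF assms(1)] assms by (simp add: rep_def labels_def)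
qed

text \<open>The extra vertex \<open>v\<close> already carries the label of \<open>a\<close>, so
  contracting the edge from \<open>s\<close> to \<open>v\<close> identifies \<open>s\<close> with
  \<open>a\<close> among the six vertices.\<close>

lemma rep_Some:
  assumes "rep v (Some a) l f" "s < 6"
  shows "rep v (Some a) (lmerge (a, s) l) (merge (s, v) f)"
proof -
  have a: "a < 6" "f v = f a" "length l = 6" using assms(1) by (simp_all add: rep_def labels_def)
  have k: "f x = f y \<longleftrightarrow> l ! x = l ! y" if "x < 6" "y < 6" for x y
    using rep_kernel[OF assms(1) that] .
  have m: "merge (s, v) f x = merge (s, v) f y \<longleftrightarrow> lmerge (a, s) l ! x = lmerge (a, s) l ! y"
    if x: "x < 6" and y: "y < 6" for x y
    unfolding merge_eq_iff a(2) k[OF x y] k[OF x a(1)] k[OF y a(1)] k[OF x assms(2)] k[OF y assms(2)]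
    using lmerge_eq_iff[of a l s x y] a assms(2) x y by auto
  moreover have "merge (s, v) f v = merge (s, v) f a" by (simp add: merge_def a(2))
  ultimately show ?thesis using a by (simp add: rep_def labels_def)
qed

text \<open>The state of the sweep says nothing about a second extra vertex. The invariant
  \<open>I\<close> carries that information along; it has to survive merges at
  \<open>v\<close>.\<close>

lemma coeff_sweep:
  assumes W: "\<And>c l f i. rep v c l f \<Longrightarrow> I f \<Longrightarrow> coeff (W c l) i = cnt n E f i"
    and I: "\<And>f s. I f \<Longrightarrow> s < 6 \<Longrightarrow> I (merge (s, v) f)"
    and v: "E \<subseteq> pairs v" "v < n" "6 \<le> v"
    and S: "distinct S" "set S \<subseteq> {..<6}"
    and f: "rep v c l f" "I f"
  shows "coeff (sweep W S c l) i = cnt n (E \<union> star v (set S)) f i"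
  using S f
proof (induction S arbitrary: c l f i)
  case Nil
  then show ?case using W by (simp add: star_def)
next
  case (Cons s S)
  have s: "s < 6" "s < n" using Cons.prems(2) v by auto
  have S: "distinct S" "set S \<subseteq> {..<6}" using Cons.prems by auto
  have "finite (E \<union> star v (set S))" using finite_subset[OF v(1)] by (simp add: star_def)
  then have "cnt n (E \<union> star v (set (s # S))) f i = cnt n (E \<union> star v (set S)) f i
      + shift (cnt n (E \<union> star v (set S)) (merge (s, v) f)) i"
    unfolding list.set star_insert
    using star_notin[OF v(1), of s "set S"] Cons.prems(1) s v(2) by (intro cnt_insert_shift) auto
  moreover have "cnt n (E \<union> star v (set S)) (merge (s, v) f)
      = coeff (case c of None \<Rightarrow> sweep W S (Some s) l | Some a \<Rightarrow> sweep W S (Some a) (lmerge (a, s) l))"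
  proof (cases c)
    case None
    show ?thesis
      using Cons.IH[OF S rep_None[OF Cons.prems(3)[unfolded None] s(1)] I[OF Cons.prems(4) s(1)]] None
      by (intro ext) simp
  next
    case (Some a)
    show ?thesis
      using Cons.IH[OF S rep_Some[OF Cons.prems(3)[unfolded Some] s(1)] I[OF Cons.prems(4) s(1)]] Some
      by (intro ext) simp
  qed
  moreover have "coeff (sweep W S c l) i = cnt n (E \<union> star v (set S)) f i"
    by (rule Cons.IH[OF S Cons.prems(3,4)])
  ultimately show ?case by (cases c) (simp_all add: coeff_padd coeff_shift)
qed

lemma coeff_attached:
  assumes W: "\<And>l f i. labels l f \<Longrightarrow> coeff (W l) i = cnt 6 E f i" and E: "E \<subseteq> pairs 6"
    and f: "rep 6 c l f"
  shows "coeff (attached W c l) i = cnt 7 E f i"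
proof -
  have c: "cnt 7 E f i = (if \<exists>y<6. f y = f 6 then cnt 6 E f i else 0)"
    using cnt_vertex[OF E, of f i] by simp
  show ?thesis
  proof (cases c)
    case None
    then have "\<not> (\<exists>y<6. f y = f 6)" using f by (auto simp: rep_def)
    then show ?thesis by (simp only: c None attached.simps coeff.simps if_False)
  next
    case (Some a)
    then have "\<exists>y<6. f y = f 6" using f by (auto simp: rep_def)
    moreover have "coeff (W l) i = cnt 6 E f i" using f by (intro W) (simp add: rep_def)
    ultimately show ?thesis by (simp only: c Some attached.simps if_True)
  qed
qed

lemma coeff_csg_labels:
  assumes "distinct es" "set es \<subseteq> pairs 6" "labels l f"
  shows "coeff (csg es l) i = cnt 6 (set es) f i"
proof -
  have "cnt 6 (set es) ((!) l) i = cnt 6 (set es) f i"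
    using assms(3) by (intro cnt_cong) (simp only: labels_def)
  then show ?thesis using coeff_csg[OF assms(1,2)] assms(3) by (simp only: labels_def)
qed

lemma coeff_star6:
  assumes "distinct es" "set es \<subseteq> pairs 6" "distinct S" "set S \<subseteq> {..<6}" "rep 6 c l f"
  shows "coeff (sweep (attached (csg es)) S c l) i = cnt 7 (set es \<union> star 6 (set S)) f i"
  by (rule coeff_sweep[where I = "\<lambda>f. True"])
    (use assms in \<open>auto intro!: coeff_attached coeff_csg_labels\<close>)

text \<open>Deletion and contraction of the edge between the two extra vertices 6 and 7.\<close>

definition two_hubs :: "(nat list \<Rightarrow> nat list) \<Rightarrow> nat list \<Rightarrow> nat list \<Rightarrow> nat list \<Rightarrow> nat list" where
  "two_hubs V S T l = padd (sweep (attached (sweep (attached V) S None)) T None l)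
    (0 # sweep (sweep (attached V) S) T None l)"

definition id6 :: "nat list" where "id6 = [0, 1, 2, 3, 4, 5]"

lemma less6: "x < 6 \<longleftrightarrow> x = 0 \<or> x = 1 \<or> x = 2 \<or> x = 3 \<or> x = 4 \<or> x = (5 :: nat)"
  by linarith

lemma labels_id6:
  assumes "\<And>x y. x < 6 \<Longrightarrow> y < 6 \<Longrightarrow> f x = f y \<longleftrightarrow> x = y"
  shows "labels id6 f"
proof -
  have "id6 ! x = x" if "x < 6" for x using that unfolding less6 by (auto simp: id6_def)
  then show ?thesis using assms by (simp add: labels_def id6_def)
qed

lemma coeff_two_hubs:
  assumes es: "distinct es" "set es \<subseteq> pairs 6" and S: "distinct S" "set S \<subseteq> {..<6}"
    and T: "distinct T" "set T \<subseteq> {..<6}"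
  shows "coeff (two_hubs (csg es) S T id6) i
    = cnt 8 (insert (6, 7) (set es \<union> star 6 (set S) \<union> star 7 (set T))) id i"
proof -
  let ?E = "set es \<union> star 6 (set S)"
  have E7: "?E \<subseteq> pairs 7" using es(2) S(2) by (auto simp: star_def pairs_def)
  have E8: "cnt 8 ?E f i = (if \<exists>y<7. f y = f 7 then cnt 7 ?E f i else 0)" for f i
    using cnt_vertex[OF E7, of f i] by simp
  let ?F = "?E \<union> star 7 (set T)"
  have fin: "finite ?F" by (simp add: star_def)
  have "(6, 7) \<notin> ?F" using es(2) S(2) T(2) by (auto simp: star_def pairs_def)
  then have 0: "cnt 8 (insert (6, 7) ?F) id i = cnt 8 ?F id i + shift (cnt 8 ?F (merge (6, 7) id)) i"
    using fin by (intro cnt_insert_shift) auto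
  have 1: "coeff (sweep (attached (sweep (attached (csg es)) S None)) T None id6) i = cnt 8 ?F id i"
  \<comment> \<open>Edge between the hubs deleted: while the edges at 7 are decided, 6 stays alone,
    so the inner sweep starts afresh from \<open>None\<close>.\<close>
  proof (rule coeff_sweep[where I = "\<lambda>f. (\<forall>x<6. f 6 \<noteq> f x) \<and> f 6 \<noteq> f 7"])
    fix c l i and f :: "nat \<Rightarrow> nat" assume r: "rep 7 c l f" and I: "(\<forall>x<6. f 6 \<noteq> f x) \<and> f 6 \<noteq> f 7"
    have r6: "rep 6 None l f" using r I by (simp add: rep_def)
    show "coeff (attached (sweep (attached (csg es)) S None) c l) i = cnt 8 ?E f i"
    proof (cases c)
      case None
      have "f y \<noteq> f 7" if "y < 7" for y
      proof (cases "y = 6")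
        case False
        then have "y < 6" using that by simp
        then show ?thesis using r None by (auto simp: rep_def)
      qed (use I in simp)
      then have "\<not> (\<exists>y<7. f y = f 7)" by blast
      then show ?thesis by (simp only: E8 None attached.simps coeff.simps if_False)
    next
      case (Some a)
      then have "a < 7" "f a = f 7" using r by (simp_all add: rep_def)
      then have "\<exists>y<7. f y = f 7" by blast
      moreover have "coeff (sweep (attached (csg es)) S None l) i = cnt 7 ?E f i"
        by (rule coeff_star6[OF es S r6])
      ultimately show ?thesis by (simp only: E8 Some attached.simps if_True)
    qed
  next
    fix f :: "nat \<Rightarrow> nat" and s assume I: "(\<forall>x<6. f 6 \<noteq> f x) \<and> f 6 \<noteq> f 7" and s: "s < (6 :: nat)"
    have m: "merge (s, 7) f 6 = f 6" using I by (simp add: merge_def)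
    have "f 6 \<noteq> merge (s, 7) f x" if "f 6 \<noteq> f x" for x
      using that conjunct1[OF I, rule_format, OF s] by (simp add: merge_def)
    then show "(\<forall>x<6. merge (s, 7) f 6 \<noteq> merge (s, 7) f x) \<and> merge (s, 7) f 6 \<noteq> merge (s, 7) f 7"
      unfolding m using I by blast
  next
    show "rep 7 None id6 id" by (simp add: rep_def labels_id6)
  qed (use E7 T in auto)
  have 2: "coeff (sweep (sweep (attached (csg es)) S) T None id6) i = cnt 8 ?F (merge (6, 7) id) i" for i
  \<comment> \<open>Edge between the hubs contracted: 6 and 7 share a label, so the state reached
    after the edges at 7 is the starting state for the edges at 6.\<close>
  proof (rule coeff_sweep[where I = "\<lambda>f. f 6 = f 7"])
    fix c l i and f :: "nat \<Rightarrow> nat" assume r: "rep 7 c l f" and I: "f 6 = f 7"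
    have r6: "rep 6 c l f" using r by (simp only: rep_def I)
    have "\<exists>y<7. f y = f 7" using I by (intro exI[of _ 6]) simp
    then show "coeff (sweep (attached (csg es)) S c l) i = cnt 8 ?E f i"
      by (simp only: E8 coeff_star6[OF es S r6] if_True)
  next
    show "rep 7 None id6 (merge (6, 7) id)" by (auto simp: rep_def merge_def intro!: labels_id6)
  qed (use E7 T in \<open>auto simp: merge_def\<close>)
  then have "coeff (sweep (sweep (attached (csg es)) S) T None id6) = cnt 8 ?F (merge (6, 7) id)"
    by (rule ext)
  then show ?thesis by (simp only: two_hubs_def coeff_padd coeff_shift 0 1)
qed

section \<open>Testing the bounds on all pairs and triples among seven vertices\<close>

definition pairs6 :: "(nat \<times> nat) list" where
  "pairs6 = [(0, 1), (0, 2), (0, 3), (0, 4), (0, 5), (1, 2), (1, 3), (1, 4), (1, 5), (2, 3),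
    (2, 4), (2, 5), (3, 4), (3, 5), (4, 5)]"

lemma set_pairs6: "set pairs6 = pairs 6"
proof (intro equalityI subrelI)
  fix a b assume "(a, b) \<in> pairs 6"
  then have "a < b" "b < 6" by (auto simp: pairs_def)
  moreover from this have "a < 6" by simp
  ultimately show "(a, b) \<in> set pairs6"
    unfolding less6 by (elim disjE) (simp_all add: pairs6_def)
qed (auto simp: pairs6_def pairs_def)

lemma set_id6: "set id6 = {..<6}"
  by (auto simp: id6_def less6)

definition triples6 :: "(nat \<times> nat \<times> nat) list" where
  "triples6 = [(0, 1, 2), (0, 1, 3), (0, 1, 4), (0, 1, 5), (0, 2, 3), (0, 2, 4), (0, 2, 5),
    (0, 3, 4), (0, 3, 5), (0, 4, 5), (1, 2, 3), (1, 2, 4), (1, 2, 5), (1, 3, 4), (1, 3, 5),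
    (1, 4, 5), (2, 3, 4), (2, 3, 5), (2, 4, 5), (3, 4, 5)]"

lemma triples6: "a < b \<Longrightarrow> b < c \<Longrightarrow> c < 6 \<Longrightarrow> (a, b, c) \<in> set triples6"
proof -
  assume l: "a < b" "b < c" "c < 6"
  then have "a < 6" "b < 6" by simp_all
  with l show ?thesis unfolding less6 by (elim disjE) (simp_all add: triples6_def)
qed

text \<open>\<open>3 x m7 + x^3 r7\<close> is bounded by \<open>k8\<close>, the polynomial of \<open>K44\<close>. The entries of \<open>m7\<close> are the exact maxima;
  \<open>r7\<close> is what they leave.\<close>

definition m7 :: "nat list" where
  "m7 = [0, 0, 0, 0, 0, 0, 1200, 2460, 2668, 1932, 994, 364, 91, 14, 1]"

definition r7 :: "nat list" where
  "r7 = [0, 0, 0, 0, 496, 1044, 1548, 1668, 1290, 720, 286, 78, 13, 1]"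

text \<open>For an edge e = {a, b} of the complete graph on six vertices, this treats the pair {a,
  b} and also the triple {a, b, 6}: gluing 6 to a block is the state \<open>Some\<close>. Pairs {a,
  6} are left to \<open>check_vertex\<close> and triples without 6 to
  \<open>check_triple\<close>.\<close>

definition check_pair ::
  "(nat option \<Rightarrow> nat list \<Rightarrow> nat list) \<Rightarrow> nat list \<Rightarrow> nat \<times> nat \<Rightarrow> bool" where
  "check_pair W p e \<longleftrightarrow>
    ple (padd p (0 # W None (lmerge e id6))) m7 \<and> ple (W (Some (fst e)) (lmerge e id6)) r7"

definition check_vertex ::
  "(nat option \<Rightarrow> nat list \<Rightarrow> nat list) \<Rightarrow> nat list \<Rightarrow> nat \<Rightarrow> bool" where
  "check_vertex W p a \<longleftrightarrow> ple (padd p (0 # W (Some a) id6)) m7"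

definition check_triple ::
  "(nat option \<Rightarrow> nat list \<Rightarrow> nat list) \<Rightarrow> nat \<times> nat \<times> nat \<Rightarrow> bool" where
  "check_triple W t \<longleftrightarrow>
    ple (W None (lmerge (fst t, snd (snd t)) (lmerge (fst t, fst (snd t)) id6))) r7"

definition check_all :: "(nat option \<Rightarrow> nat list \<Rightarrow> nat list) \<Rightarrow> nat list \<Rightarrow> bool" where
  "check_all W p \<longleftrightarrow> list_all (check_pair W p) pairs6 \<and> list_all (check_vertex W p) id6 \<and>
    list_all (check_triple W) triples6"

definition check :: "(nat list \<Rightarrow> nat list) \<Rightarrow> nat list \<Rightarrow> bool" where
  "check V S \<longleftrightarrow> check_all (sweep (attached V) S) (sweep (attached V) S None id6)"

lemma labels_lmerge:
  assumes l: "labels l (glue T)" and T: "finite T" "a \<in> T" "a < 6" "b < 6"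
  shows "labels (lmerge (a, b) l) (glue (insert b T))"
proof -
  have len: "length l = 6" using l by (simp add: labels_def)
  have k: "l ! x = l ! y \<longleftrightarrow> x = y \<or> x \<in> T \<and> y \<in> T" if "x < 6" "y < 6" for x y
    using l that glue_eq[OF T(1)] unfolding labels_def by blast
  have "lmerge (a, b) l ! x = lmerge (a, b) l ! y \<longleftrightarrow> glue (insert b T) x = glue (insert b T) y"
    if x: "x < 6" and y: "y < 6" for x y
    using T(2) len x y T(3,4)
    by (simp add: lmerge_eq_iff k glue_eq[OF finite.insertI[OF T(1)]]) blast
  then show ?thesis using len by (simp add: labels_def)
qed

lemma rep_glue_None:
  assumes "labels l (glue T)" "T \<subseteq> {..<6}"
  shows "rep 6 None l (glue T)"
proof -
  have fin: "finite T" using assms(2) by (rule finite_subset) simp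
  have "\<forall>x<6. glue T 6 \<noteq> glue T x" using assms(2) by (auto simp: glue_eq[OF fin])
  then show ?thesis using assms(1) by (simp add: rep_def)
qed

lemma rep_glue_Some:
  assumes l: "labels l (glue T)" and T: "T \<subseteq> {..<6}" "a \<in> T"
  shows "rep 6 (Some a) l (glue (insert 6 T))"
proof -
  have fin: "finite T" using T(1) by (rule finite_subset) simp
  note g = glue_eq[OF fin] glue_eq[OF finite.insertI[OF fin]]
  have "glue (insert 6 T) x = glue (insert 6 T) y \<longleftrightarrow> glue T x = glue T y" if "x < 6" "y < 6" for x y
    using that by (auto simp: g)
  then have "labels l (glue (insert 6 T))" using l by (simp add: labels_def)
  moreover have "glue (insert 6 T) 6 = glue (insert 6 T) a" using T by (simp add: g)
  ultimately show ?thesis using T by (auto simp: rep_def)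
qed

lemma labels_singleton: "labels id6 (glue {a})"
  by (rule labels_id6) (simp add: glue_def)

lemma check_sound:
  assumes es: "distinct es" "set es \<subseteq> pairs 6" and S: "distinct S" "set S \<subseteq> {..<6}"
    and chk: "check (csg es) S"
  shows "bounded (coeff m7) (coeff r7) 7 (set es \<union> star 6 (set S))"
proof -
  let ?W = "sweep (attached (csg es)) S" and ?E = "set es \<union> star 6 (set S)"
  have W: "coeff (?W c l) = cnt 7 ?E f" if "rep 6 c l f" for c l f
    by (rule ext) (rule coeff_star6[OF es S that])
  have id: "coeff (?W None id6) = cnt 7 ?E id"
    by (rule W) (simp add: rep_def labels_id6)
  have c: "\<And>e. e \<in> set pairs6 \<Longrightarrow> check_pair ?W (?W None id6) e"
    "\<And>a. a \<in> set id6 \<Longrightarrow> check_vertex ?W (?W None id6) a"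
    "\<And>t. t \<in> set triples6 \<Longrightarrow> check_triple ?W t"
    using chk by (auto simp: check_def check_all_def list_all_iff)
  have l2: "labels (lmerge (a, b) id6) (glue {b, a})" if "a < 6" "b < 6" for a b
    using labels_lmerge[OF labels_singleton, of a a b] that by simp
  have l3: "labels (lmerge (a, c) (lmerge (a, b) id6)) (glue {c, b, a})"
    if "a < 6" "b < 6" "c < 6" for a b c
    using labels_lmerge[OF l2, of a b a c] that by simp
  show ?thesis
    unfolding bounded_def
  proof (intro conjI allI impI; elim conjE)
    fix T :: "nat set" and i assume T: "T \<subseteq> {..<7}" "card T = 2"
    then obtain a b where ab: "T = {b, a}" "a < b" "b < 7"
      by (auto simp: card_2_iff insert_commute) (metis insert_commute nat_neq_iff)
    have "ple (padd (?W None id6) (0 # (if b = 6 then ?W (Some a) id6 else ?W None (lmerge (a, b) id6)))) m7"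
    proof (cases "b = 6")
      case True
      then show ?thesis using c(2)[of a] ab by (simp add: check_vertex_def set_id6)
    next
      case False
      then show ?thesis using c(1)[of "(a, b)"] ab by (simp add: check_pair_def set_pairs6 pairs_def)
    qed
    moreover have "coeff (if b = 6 then ?W (Some a) id6 else ?W None (lmerge (a, b) id6)) = cnt 7 ?E (glue T)"
    proof (cases "b = 6")
      case True
      have "rep 6 (Some a) id6 (glue {6, a})"
        using ab True by (intro rep_glue_Some labels_singleton) auto
      then show ?thesis using True ab W by simp
    next
      case False
      have "rep 6 None (lmerge (a, b) id6) (glue {b, a})"
        using ab False by (intro rep_glue_None l2) auto
      then show ?thesis using False ab W by simp
    qed
    ultimately show "cnt 7 ?E id i + shift (cnt 7 ?E (glue T)) i \<le> coeff m7 i"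
      using ple_coeff[of "padd (?W None id6) (0 # (if b = 6 then ?W (Some a) id6 else ?W None (lmerge (a, b) id6)))" m7 i]
      by (simp only: coeff_padd coeff_shift id)
  next
    fix T :: "nat set" and i assume T: "T \<subseteq> {..<7}" "card T = 3"
    have fin: "finite T" using T(2) card.infinite by fastforce
    \<comment> \<open>With the maximum singled out, the triple contains 6 exactly when
      \<open>c' = 6\<close>, which decides between the two kinds of test.\<close>
    define c' where "c' = Max T"
    have c': "c' \<in> T" "\<And>x. x \<in> T \<Longrightarrow> x \<le> c'" using fin T(2) by (auto simp: c'_def intro!: Max_in)
    have "card (T - {c'}) = 2" using c'(1) T(2) fin by simp
    then obtain a b where ab: "T - {c'} = {b, a}" "a < b"
      by (auto simp: card_2_iff insert_commute) (metis insert_commute nat_neq_iff)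
    have Teq: "T = {c', b, a}" using ab c'(1) by auto
    have "b \<in> T" "b \<noteq> c'" using ab(1) by auto
    then have l: "b < c'" "c' < 7" using c'(2)[of b] c'(1) T(1) by auto
    have "ple (if c' = 6 then ?W (Some a) (lmerge (a, b) id6)
        else ?W None (lmerge (a, c') (lmerge (a, b) id6))) r7"
    proof (cases "c' = 6")
      case True
      then show ?thesis using c(1)[of "(a, b)"] ab l by (simp add: check_pair_def set_pairs6 pairs_def)
    next
      case False
      then show ?thesis using c(3)[OF triples6[of a b c']] ab l by (simp add: check_triple_def)
    qed
    moreover have "coeff (if c' = 6 then ?W (Some a) (lmerge (a, b) id6)
        else ?W None (lmerge (a, c') (lmerge (a, b) id6))) = cnt 7 ?E (glue T)"
    proof (cases "c' = 6")
      case True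
      have "rep 6 (Some a) (lmerge (a, b) id6) (glue {6, b, a})"
        using ab l True by (intro rep_glue_Some l2) auto
      then show ?thesis using True Teq W by simp
    next
      case False
      have "rep 6 None (lmerge (a, c') (lmerge (a, b) id6)) (glue {c', b, a})"
        using ab l False by (intro rep_glue_None l3) auto
      then show ?thesis using False Teq W by simp
    qed
    ultimately show "cnt 7 ?E (glue T) i \<le> coeff r7 i" using ple_coeff by metis
  qed
qed

section \<open>Enumerating the admissible neighbourhoods of the removed vertices\<close>

primrec mem :: "'a \<Rightarrow> 'a list \<Rightarrow> bool" where
  "mem x [] \<longleftrightarrow> False"
| "mem x (y # ys) \<longleftrightarrow> x = y \<or> mem x ys"

lemma mem_iff [simp]: "mem x ys \<longleftrightarrow> x \<in> set ys"
  by (induction ys) auto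

fun picks :: "nat \<Rightarrow> 'a list \<Rightarrow> 'a list list" where
  "picks 0 xs = [[]]"
| "picks (Suc d) [] = []"
| "picks (Suc d) (x # xs) = map (Cons x) (picks d xs) @ picks (Suc d) xs"

lemma picks_complete:
  assumes "A \<subseteq> set xs" "distinct xs"
  shows "\<exists>ys\<in>set (picks (card A) xs). set ys = A \<and> distinct ys"
  using assms
proof (induction xs arbitrary: A)
  case Nil
  then show ?case by simp
next
  case (Cons x xs)
  have fin: "finite A" using Cons.prems(1) finite_subset by blast
  have dist: "distinct xs" using Cons.prems(2) by simp
  show ?case
  proof (cases "x \<in> A")
    case True
    have "A - {x} \<subseteq> set xs" using Cons.prems by auto
    from Cons.IH[OF this dist]
    obtain ys where ys: "ys \<in> set (picks (card (A - {x})) xs)" "set ys = A - {x}" "distinct ys"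
      by blast
    have c: "card A = Suc (card (A - {x}))" using card_Suc_Diff1[OF fin True] by (rule sym)
    have "x # ys \<in> set (picks (card A) (x # xs))"
      using ys(1) by (simp only: c picks.simps set_append set_map) blast
    moreover have "set (x # ys) = A" "distinct (x # ys)" using ys(2,3) True by auto
    ultimately show ?thesis by blast
  next
    case False
    then have "A \<subseteq> set xs" using Cons.prems by auto
    from Cons.IH[OF this dist]
    obtain ys where ys: "ys \<in> set (picks (card A) xs)" "set ys = A" "distinct ys" by blast
    then have "ys \<in> set (picks (card A) (x # xs))" by (cases "card A") simp_all
    then show ?thesis using ys by blast
  qed
qed

fun dg :: "nat \<Rightarrow> (nat \<times> nat) list \<Rightarrow> nat" where
  "dg x [] = 0"
| "dg x (e # es) = (if fst e = x \<or> snd e = x then Suc (dg x es) else dg x es)"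

lemma dg: "distinct es \<Longrightarrow> set es \<subseteq> pairs n \<Longrightarrow> dg x es = card (nbrs (set es) x)"
proof (induction es)
  case Nil
  then show ?case by (simp add: nbrs_def)
next
  case (Cons e es)
  obtain a b where e: "e = (a, b)" "a < b" using Cons.prems by (auto simp: pairs_def)
  have lt: "u < v" if "(u, v) \<in> set es" for u v using Cons.prems that by (auto simp: pairs_def)
  have sub: "nbrs (set es) x \<subseteq> {..<n}" using Cons.prems(2) by (auto simp: nbrs_def pairs_def)
  have fin: "finite (nbrs (set es) x)" using sub by (rule finite_subset) simp
  have new: "(a, b) \<notin> set es" "(b, a) \<notin> set es" using Cons.prems e lt[of b a] by auto
  have IH: "dg x es = card (nbrs (set es) x)" using Cons by simp
  consider "x = a" | "x = b" "x \<noteq> a" | "x \<noteq> a" "x \<noteq> b" by blast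
  then show ?case
  proof cases
    case 1
    then have "nbrs (set (e # es)) x = insert b (nbrs (set es) x)" "b \<notin> nbrs (set es) x"
      using e new by (auto simp: nbrs_def)
    then show ?thesis using 1 e IH fin by simp
  next
    case 2
    then have "nbrs (set (e # es)) x = insert a (nbrs (set es) x)" "a \<notin> nbrs (set es) x"
      using e new by (auto simp: nbrs_def)
    then show ?thesis using 2 e IH fin by simp
  next
    case 3
    then have "nbrs (set (e # es)) x = nbrs (set es) x" using e by (auto simp: nbrs_def)
    then show ?thesis using 3 e IH by auto
  qed
qed

definition hub_degree :: "(nat \<times> nat) list \<Rightarrow> nat list \<Rightarrow> nat \<Rightarrow> nat" where
  "hub_degree es S x = (if mem x S then Suc (dg x es) else dg x es)"

definition big_at :: "nat \<Rightarrow> (nat \<times> nat) list \<Rightarrow> nat list \<Rightarrow> nat \<Rightarrow> bool" where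
  "big_at d es S x \<longleftrightarrow> d \<le> hub_degree es S x"

definition big :: "nat \<Rightarrow> (nat \<times> nat) list \<Rightarrow> nat list \<Rightarrow> bool" where
  "big d es S \<longleftrightarrow> list_all (big_at d es S) id6"

text \<open>The degree condition says that the added vertex 6, of degree \<open>d\<close>, has
  minimal degree in the seven-vertex graph; only such neighbourhoods arise in
  \<open>bounded_of_good\<close>.\<close>

definition good :: "nat \<Rightarrow> (nat \<times> nat) set \<Rightarrow> bool" where
  "good d J \<longleftrightarrow> (\<forall>S. S \<subseteq> {..<6} \<and> card S = d \<and>
      (\<forall>x<6. d \<le> card (nbrs J x) + (if x \<in> S then 1 else 0)) \<longrightarrow>
    bounded (coeff m7) (coeff r7) 7 (J \<union> star 6 S))"

lemma distinct_id6: "distinct id6"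
  by (simp add: id6_def)

text \<open>Two listings of the same edges: \<open>es\<close> has the order in which the polynomial
  tables are built up, while \<open>fs\<close> is an explicit list from which degrees can be read
  off.\<close>

lemma goodI:
  assumes es: "distinct es" "set es \<subseteq> pairs 6" and fs: "distinct fs" "set fs = set es"
    and chk: "list_all (check (csg es)) (filter (big d fs) (picks d id6))"
  shows "good d (set es)"
  unfolding good_def
proof (intro allI impI; elim conjE)
  fix S assume S: "S \<subseteq> {..<6}" "card S = d"
    "\<forall>x<6. d \<le> card (nbrs (set es) x) + (if x \<in> S then 1 else 0)"
  obtain ys where ys: "ys \<in> set (picks d id6)" "set ys = S" "distinct ys"
    using picks_complete[of S id6] S(1,2) distinct_id6 set_id6 by auto
  have dg: "dg x fs = card (nbrs (set es) x)" for x using dg[OF fs(1), of 6] fs(2) es(2) by simp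
  have "big d fs ys"
    using S(3) by (auto simp: big_def big_at_def hub_degree_def list_all_iff set_id6 dg ys(2))
  then have "check (csg es) ys" using chk ys(1) by (simp add: list_all_iff)
  then show "bounded (coeff m7) (coeff r7) 7 (set es \<union> star 6 S)"
    using check_sound[OF es ys(3)] ys(2) S(1) by simp
qed

text \<open>\<open>cnt_K44\<close> identifies these as the counts of K_{4,4}. For orientation: 4096
  = 4^3 * 4^3 is the number of spanning trees, and 1812 = C(16,4) - 8 because four edges disconnect
  only when they form the star of a vertex.\<close>

definition k8 :: "nat list" where
  "k8 = [0, 0, 0, 0, 0, 0, 0, 4096, 8424, 9552, 7464, 4272, 1812, 560, 120, 16, 1]"

definition four_at :: "(nat \<times> nat) list \<Rightarrow> nat list \<Rightarrow> nat list \<Rightarrow> nat \<Rightarrow> bool" where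
  "four_at es S T x \<longleftrightarrow>
    (if mem x T then Suc (hub_degree es S x) else hub_degree es S x) = Suc (Suc (Suc (Suc 0)))"

definition four :: "(nat \<times> nat) list \<Rightarrow> nat list \<Rightarrow> nat list \<Rightarrow> bool" where
  "four es S T \<longleftrightarrow> list_all (four_at es S T) id6"

definition check_hubs :: "(nat list \<Rightarrow> nat list) \<Rightarrow> nat list \<Rightarrow> nat list \<Rightarrow> bool" where
  "check_hubs V S T \<longleftrightarrow> ple (two_hubs V S T id6) k8"

definition check_regular :: "(nat list \<Rightarrow> nat list) \<Rightarrow> (nat \<times> nat) list \<Rightarrow> nat list \<Rightarrow> bool" where
  "check_regular V es S \<longleftrightarrow>
    list_all (check_hubs V S) (filter (four es S) (picks (Suc (Suc (Suc 0))) id6))"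

text \<open>The two removed vertices 6 and 7 are adjacent, so 4-regularity leaves three further
  neighbours for each; \<open>S\<close> and \<open>T\<close> may overlap.\<close>

definition good_regular :: "(nat \<times> nat) set \<Rightarrow> bool" where
  "good_regular K \<longleftrightarrow> (\<forall>S T i. S \<subseteq> {..<6} \<and> T \<subseteq> {..<6} \<and> card S = 3 \<and> card T = 3 \<and>
      (\<forall>x<6. card (nbrs K x) + (if x \<in> S then 1 else 0) + (if x \<in> T then 1 else 0) = 4) \<longrightarrow>
    cnt 8 (insert (6, 7) (K \<union> star 6 S \<union> star 7 T)) id i \<le> coeff k8 i)"

lemma good_regularI:
  assumes es: "distinct es" "set es \<subseteq> pairs 6" and fs: "distinct fs" "set fs = set es"
    and chk: "list_all (check_regular (csg es) fs) (picks (Suc (Suc (Suc 0))) id6)"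
  shows "good_regular (set es)"
  unfolding good_regular_def
proof (intro allI impI; elim conjE)
  fix S T i assume S: "S \<subseteq> {..<6}" "card S = 3" and T: "T \<subseteq> {..<6}" "card T = 3"
    and deg: "\<forall>x<6. card (nbrs (set es) x) + (if x \<in> S then 1 else 0) + (if x \<in> T then 1 else 0) = 4"
  have 3: "Suc (Suc (Suc 0)) = 3" "Suc (Suc (Suc (Suc 0))) = 4" by simp_all
  obtain ys where ys: "ys \<in> set (picks 3 id6)" "set ys = S" "distinct ys"
    using picks_complete[of S id6] S distinct_id6 set_id6 by auto
  obtain zs where zs: "zs \<in> set (picks 3 id6)" "set zs = T" "distinct zs"
    using picks_complete[of T id6] T distinct_id6 set_id6 by auto
  have dg: "dg x fs = card (nbrs (set es) x)" for x using dg[OF fs(1), of 6] fs(2) es(2) by simp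
  have "four fs ys zs"
    unfolding four_def list_all_iff set_id6
  proof
    fix x assume x: "x \<in> {..<6 :: nat}"
    then show "four_at fs ys zs x"
      using deg[rule_format, of x] ys(2) zs(2)
      by (simp add: four_at_def hub_degree_def dg 3 split: if_splits)
  qed
  then have "check_hubs (csg es) ys zs"
    using chk ys(1) zs(1) by (simp add: list_all_iff check_regular_def 3 del: picks.simps)
  then have "coeff (two_hubs (csg es) ys zs id6) i \<le> coeff k8 i"
    unfolding check_hubs_def by (rule ple_coeff)
  then show "cnt 8 (insert (6, 7) (set es \<union> star 6 S \<union> star 7 T)) id i \<le> coeff k8 i"
    using coeff_two_hubs[OF es, of ys zs i] ys zs S T by simp
qed

section \<open>Isomorphism types on six vertices\<close>

fun ins :: "('a \<Rightarrow> 'a \<Rightarrow> bool) \<Rightarrow> 'a \<Rightarrow> 'a list \<Rightarrow> 'a list" where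
  "ins lt x [] = [x]"
| "ins lt x (y # ys) = (if lt x y then x # y # ys else y # ins lt x ys)"

fun isort :: "('a \<Rightarrow> 'a \<Rightarrow> bool) \<Rightarrow> 'a list \<Rightarrow> 'a list" where
  "isort lt [] = []"
| "isort lt (x # xs) = ins lt x (isort lt xs)"

lemma set_ins [simp]: "set (ins lt x ys) = insert x (set ys)"
  by (induction ys) auto

lemma set_isort [simp]: "set (isort lt xs) = set xs"
  by (induction xs) auto

lemma distinct_ins [simp]: "distinct (ins lt x ys) \<longleftrightarrow> x \<notin> set ys \<and> distinct ys"
  by (induction ys) auto

lemma distinct_isort [simp]: "distinct (isort lt xs) \<longleftrightarrow> distinct xs"
  by (induction xs) auto

definition pair_less :: "nat \<times> nat \<Rightarrow> nat \<times> nat \<Rightarrow> bool" where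
  "pair_less e f \<longleftrightarrow> fst e < fst f \<or> fst e = fst f \<and> snd e < snd f"

text \<open>Comparing the sorted list with \<open>id6\<close> settles length, range and distinctness
  in one evaluation.\<close>

definition is_perm :: "nat list \<Rightarrow> bool" where
  "is_perm p \<longleftrightarrow> isort (<) p = id6"

definition perm_of :: "nat list \<Rightarrow> nat \<Rightarrow> nat" where
  "perm_of p x = (if x < 6 then p ! x else x)"

lemma length_ins [simp]: "length (ins lt x ys) = Suc (length ys)"
  by (induction ys) auto

lemma length_isort [simp]: "length (isort lt xs) = length xs"
  by (induction xs) auto

lemma perm_of_permutes:
  assumes "is_perm p"
  shows "perm_of p permutes {..<6}"
proof (rule bij_imp_permutes)
  have p: "isort (<) p = id6" using assms by (simp add: is_perm_def)
  have "length p = length id6" using arg_cong[OF p, of length] by simp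
  then have l: "length p = 6" by (simp add: id6_def)
  have "bij_betw ((!) p) {..<6} {..<6}"
  proof (rule bij_betw_nth)
    show "distinct p" using arg_cong[OF p, of distinct] distinct_id6 by simp
    show "{..<6} = set p" using arg_cong[OF p, of set] set_id6 by simp
  qed (simp add: l)
  then show "bij_betw (perm_of p) {..<6} {..<6}"
    by (rule bij_betw_cong[THEN iffD1, rotated]) (simp add: perm_of_def)
qed (simp add: perm_of_def)

definition lrelabel :: "nat list \<Rightarrow> nat \<times> nat \<Rightarrow> nat \<times> nat" where
  "lrelabel p e = (if p ! fst e < p ! snd e then (p ! fst e, p ! snd e) else (p ! snd e, p ! fst e))"

lemma lrelabel_eq: "e \<in> pairs 6 \<Longrightarrow> lrelabel p e = relabel (perm_of p) e"
  by (auto simp: pairs_def lrelabel_def relabel_def perm_of_def)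

lemma relabel_comp: "relabel p (relabel q e) = relabel (p \<circ> q) e"
  by (cases "q (fst e) \<le> q (snd e)") (auto simp: relabel_def min.commute max.commute min_def max_def)

text \<open>\<open>R\<close> meets every isomorphism type of graphs with \<open>k\<close> edges on
  six vertices. Only completeness is asked for; that the members are pairwise non-isomorphic is not
  claimed.\<close>

definition covers :: "(nat \<times> nat) list list \<Rightarrow> nat \<Rightarrow> bool" where
  "covers R k \<longleftrightarrow> (\<forall>C. C \<subseteq> pairs 6 \<and> card C = k \<longrightarrow>
     (\<exists>p r. p permutes {..<6} \<and> r \<in> set R \<and> relabel p ` C = set r))"

text \<open>\<open>grow R r es ps\<close>: for each edge outside \<open>r\<close>, the next permutation in \<open>ps\<close> carries \<open>r\<close> plus that edge
  to a member of \<open>R\<close>.\<close>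

fun grow :: "(nat \<times> nat) list list \<Rightarrow> (nat \<times> nat) list \<Rightarrow> (nat \<times> nat) list \<Rightarrow> nat list list \<Rightarrow> bool" where
  "grow R r [] ps \<longleftrightarrow> True"
| "grow R r (e # es) [] \<longleftrightarrow> mem e r \<and> grow R r es []"
| "grow R r (e # es) (p # ps) \<longleftrightarrow>
    (if mem e r then grow R r es (p # ps)
     else is_perm p \<and> mem (isort pair_less (map (lrelabel p) (e # r))) R \<and> grow R r es ps)"

lemma growD:
  assumes "grow R r es ps" "e \<in> set es" "e \<notin> set r"
  shows "\<exists>p. is_perm p \<and> isort pair_less (map (lrelabel p) (e # r)) \<in> set R"
  using assms by (induction R r es ps rule: grow.induct) (auto split: if_splits simp del: isort.simps)

definition grows :: "(nat \<times> nat) list list \<Rightarrow> (nat \<times> nat) list \<times> nat list list \<Rightarrow> bool" where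
  "grows R d \<longleftrightarrow> grow R (fst d) pairs6 (snd d)"

text \<open>Remove an edge \<open>c\<close> from \<open>C\<close> and carry the rest onto a listed
  \<open>r\<close>. The image of \<open>c\<close> is then an edge outside \<open>r\<close>, for
  which \<open>D\<close> stores a permutation leading into \<open>R\<close>; composing the two
  permutations finishes, without any search for isomorphisms.\<close>

lemma covers_Suc:
  assumes D: "covers (map fst D) k" and g: "list_all (grows R) D"
  shows "covers R (Suc k)"
  unfolding covers_def
proof (intro allI impI; elim conjE)
  fix C assume C: "C \<subseteq> pairs 6" "card C = Suc k"
  then have "C \<noteq> {}" by auto
  then obtain c where c: "c \<in> C" by blast
  have c6: "c \<in> pairs 6" and C': "C - {c} \<subseteq> pairs 6" using c C(1) by auto
  have "card (C - {c}) = k" using c C(2) by simp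
  then obtain q r where q: "q permutes {..<6}" "r \<in> set (map fst D)" "relabel q ` (C - {c}) = set r"
    using D C' unfolding covers_def by blast
  then obtain ps where ps: "(r, ps) \<in> set D" by auto
  define e where "e = relabel q c"
  have e: "e \<in> set pairs6" "e \<notin> set r"
    using relabel_pairs[OF q(1) c6] inj_on_image_mem_iff[OF inj_on_relabel[OF q(1)] c6 C'] q(3)
    by (simp_all add: e_def set_pairs6)
  have r6: "set r \<subseteq> pairs 6" using relabel_image_pairs[OF q(1) C'] q(3) by simp
  have "grow R r pairs6 ps" using g ps by (auto simp: list_all_iff grows_def)
  then obtain p where p: "is_perm p" "isort pair_less (map (lrelabel p) (e # r)) \<in> set R"
    using growD[OF _ e] by blast
  have pq: "perm_of p \<circ> q permutes {..<6}"
    using permutes_compose[OF q(1) perm_of_permutes[OF p(1)]] .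
  have "relabel (perm_of p \<circ> q) ` C = relabel (perm_of p) ` relabel q ` insert c (C - {c})"
    using c by (simp add: image_image relabel_comp insert_absorb)
  also have "\<dots> = relabel (perm_of p) ` set (e # r)"
    by (simp only: image_insert q(3) e_def list.set)
  also have "\<dots> = lrelabel p ` set (e # r)"
    using e(1) r6 by (intro image_cong refl lrelabel_eq[symmetric]) (auto simp: set_pairs6)
  also have "\<dots> = set (isort pair_less (map (lrelabel p) (e # r)))"
    by (simp only: set_isort set_map)
  finally show "\<exists>p r. p permutes {..<6} \<and> r \<in> set R \<and> relabel p ` C = set r"
    using pq p(2) by blast
qed

text \<open>A permutation of the vertices maps the set of all 15 pairs onto itself and so commutes
  with complements. This transfers the enumeration from sparse graphs to the dense ones that are
  needed.\<close>

lemma covers_complement: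
  assumes R: "covers R k" and J: "J \<subseteq> pairs 6" "card J + k = 15"
  obtains p r where "p permutes {..<6}" "r \<in> set R" "relabel p ` J = pairs 6 - set r"
proof -
  have fin: "finite J" using J(1) by (rule finite_subset) simp
  have "card (pairs 6) = 15"
    unfolding set_pairs6[symmetric] by (simp add: pairs6_def)
  then have "card (pairs 6 - J) = k" using J fin by (simp add: card_Diff_subset)
  then obtain p r where p: "p permutes {..<6}" "r \<in> set R" "relabel p ` (pairs 6 - J) = set r"
    using R unfolding covers_def by blast
  have a: "relabel p ` pairs 6 = pairs 6"
    using relabel_image_pairs[OF p(1) order_refl] card_relabel[OF p(1) order_refl]
    by (intro card_subset_eq) auto
  have b: "relabel p ` (pairs 6 - J) = relabel p ` pairs 6 - relabel p ` J"
    using J(1) by (intro inj_on_image_set_diff[OF inj_on_relabel[OF p(1)]]) auto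
  have "set r = pairs 6 - relabel p ` J" using p(3) unfolding b a by (rule sym)
  then have "relabel p ` J = pairs 6 - set r"
    using relabel_image_pairs[OF p(1) J(1)] by (simp add: double_diff)
  then show ?thesis using that[OF p(1,2)] by simp
qed

section \<open>Reduction of the seven- and eight-vertex graphs to six vertices\<close>

lemma good_relabel:
  assumes p: "p permutes {..<6}" and J: "J \<subseteq> pairs 6" and g: "good d (relabel p ` J)"
  shows "good d J"
  unfolding good_def
proof (intro allI impI; elim conjE)
  fix S assume S: "S \<subseteq> {..<6}" "card S = d"
    and deg: "\<forall>x<6. d \<le> card (nbrs J x) + (if x \<in> S then 1 else 0)"
  have inj: "inj p" using p by (rule permutes_inj)
  have p7: "p permutes {..<7}" using p by (rule permutes_subset) auto
  have J7: "J \<union> star 6 S \<subseteq> pairs 7" using J S by (auto simp: star_def pairs_def)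
  have "d \<le> card (nbrs (relabel p ` J) x) + (if x \<in> p ` S then 1 else 0)" if x: "x < 6" for x
  proof -
    obtain y where y: "x = p y" "y < 6" using x permutes_image[OF p] by blast
    have "card (nbrs (relabel p ` J) (p y)) = card (nbrs J y)"
      unfolding nbrs_relabel[OF p] using permutes_inj_on[OF p] by (rule card_image)
    then show ?thesis using deg y by (simp add: inj_image_mem_iff[OF inj])
  qed
  moreover have "p ` S \<subseteq> {..<6}" using S(1) permutes_image[OF p] by blast
  moreover have "card (p ` S) = d" using S(2) permutes_inj_on[OF p] by (simp add: card_image)
  ultimately have "bounded (coeff m7) (coeff r7) 7 (relabel p ` J \<union> star 6 (p ` S))"
    using g unfolding good_def by blast
  moreover have "p 6 = 6" using permutes_not_in[OF p, of 6] by simp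
  ultimately have "bounded (coeff m7) (coeff r7) 7 (relabel p ` (J \<union> star 6 S))"
    using relabel_star[OF p S(1), of 6] by (simp add: image_Un)
  then show "bounded (coeff m7) (coeff r7) 7 (J \<union> star 6 S)"
    using bounded_relabel[OF p7 J7] by blast
qed

lemma good_regular_relabel:
  assumes p: "p permutes {..<6}" and K: "K \<subseteq> pairs 6" and g: "good_regular (relabel p ` K)"
  shows "good_regular K"
  unfolding good_regular_def
proof (intro allI impI; elim conjE)
  fix S T i assume S: "S \<subseteq> {..<6}" "card S = 3" and T: "T \<subseteq> {..<6}" "card T = 3"
    and deg: "\<forall>x<6. card (nbrs K x) + (if x \<in> S then 1 else 0) + (if x \<in> T then 1 else 0) = 4"
  let ?E = "insert (6, 7) (K \<union> star 6 S \<union> star 7 T)"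
  have inj: "inj p" using p by (rule permutes_inj)
  have p8: "p permutes {..<8}" using p by (rule permutes_subset) auto
  have E8: "?E \<subseteq> pairs 8" using K S T by (auto simp: star_def pairs_def)
  have "card (nbrs (relabel p ` K) x) + (if x \<in> p ` S then 1 else 0) + (if x \<in> p ` T then 1 else 0) = 4"
    if x: "x < 6" for x
  proof -
    obtain y where y: "x = p y" "y < 6" using x permutes_image[OF p] by blast
    have "card (nbrs (relabel p ` K) (p y)) = card (nbrs K y)"
      unfolding nbrs_relabel[OF p] using permutes_inj_on[OF p] by (rule card_image)
    then show ?thesis using deg[rule_format, OF y(2)] y(1) by (simp add: inj_image_mem_iff[OF inj])
  qed
  moreover have "p ` S \<subseteq> {..<6}" "p ` T \<subseteq> {..<6}" using S(1) T(1) permutes_image[OF p] by blast+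
  moreover have "card (p ` S) = 3" "card (p ` T) = 3"
    using S(2) T(2) permutes_inj_on[OF p] by (simp_all add: card_image)
  ultimately have "cnt 8 (insert (6, 7) (relabel p ` K \<union> star 6 (p ` S) \<union> star 7 (p ` T))) id i \<le> coeff k8 i"
    using g unfolding good_regular_def by blast
  moreover have p67: "p 6 = 6" "p 7 = 7" using permutes_not_in[OF p] by simp_all
  moreover have "relabel p ` ?E = insert (6, 7) (relabel p ` K \<union> star 6 (p ` S) \<union> star 7 (p ` T))"
    using relabel_star[OF p S(1), of 6] relabel_star[OF p T(1), of 7] p67
    by (simp add: image_Un relabel_def)
  ultimately show "cnt 8 ?E id i \<le> coeff k8 i"
    using cnt_relabel_id[OF p8 E8, of i] by simp
qed

lemma bounded_of_good:
  assumes g: "\<And>d J. d \<le> 3 \<Longrightarrow> J \<subseteq> pairs 6 \<Longrightarrow> card J + d = 13 \<Longrightarrow> good d J"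
    and H: "H \<subseteq> pairs 7" "card H = 13"
  shows "bounded (coeff m7) (coeff r7) 7 H"
proof -
  have H': "H \<subseteq> pairs (Suc 6)" using H by simp
  obtain p where p: "p permutes {..<7}"
    and min: "\<And>x. x < 7 \<Longrightarrow> card (nbrs (relabel p ` H) 6) \<le> card (nbrs (relabel p ` H) x)"
    using min_degree_last[OF H'] by auto
  define F where "F = relabel p ` H"
  have F: "F \<subseteq> pairs 7" "card F = 13"
    using relabel_image_pairs[OF p H(1)] card_relabel[OF p H(1)] H(2) by (simp_all add: F_def)
  have F': "F \<subseteq> pairs (Suc 6)" using F by simp
  note sp = pairs_split[OF F']
  define J where "J = F \<inter> pairs 6"
  define S where "S = nbrs F 6"
  have J: "J \<subseteq> pairs 6" by (simp add: J_def)
  \<comment> \<open>Seven degrees of at least 4 would add up to 28, but the sum is 26.\<close>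
  have "(\<Sum>x<(7::nat). card S) \<le> (\<Sum>x<7. card (nbrs F x))"
    using min by (intro sum_mono) (simp add: S_def F_def)
  then have d: "card S \<le> 3" using sum_degree[OF F(1)] F(2) by simp
  have "card S \<le> card (nbrs J x) + (if x \<in> S then 1 else 0)" if x: "x < 6" for x
  proof -
    have lt: "a < b \<and> b < 7" if "(a, b) \<in> F" for a b using that F(1) by (auto simp: pairs_def)
    have "nbrs F x = nbrs J x \<union> (if x \<in> S then {6} else {})"
    proof (rule set_eqI)
      fix y :: nat
      show "y \<in> nbrs F x \<longleftrightarrow> y \<in> nbrs J x \<union> (if x \<in> S then {6} else {})"
        using x lt[of x y] lt[of y x] by (cases "y = 6") (auto simp: nbrs_def J_def S_def pairs_def)
    qed
    then have "card (nbrs F x) \<le> card (nbrs J x) + (if x \<in> S then 1 else 0)"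
      using card_Un_le[of "nbrs J x" "if x \<in> S then {6} else {}"] by (auto split: if_splits)
    moreover have "card S \<le> card (nbrs F x)" using min[of x] x by (simp add: S_def F_def)
    ultimately show ?thesis by (rule order_trans[rotated])
  qed
  moreover have "good (card S) J"
    using sp(3) F(2) by (intro g d J) (simp add: J_def S_def)
  ultimately have "bounded (coeff m7) (coeff r7) 7 (J \<union> star 6 S)"
    using sp(2) unfolding good_def S_def by blast
  then have "bounded (coeff m7) (coeff r7) 7 F" using sp(1) by (simp add: J_def S_def)
  then show ?thesis unfolding F_def by (rule bounded_relabel[OF p H(1)])
qed

lemma cnt_le_of_regular:
  assumes g: "\<And>K. K \<subseteq> pairs 6 \<Longrightarrow> card K = 9 \<Longrightarrow> good_regular K"
    and E: "E \<subseteq> pairs 8" "card E = 16" and reg: "\<And>x. x < 8 \<Longrightarrow> card (nbrs E x) = 4"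
  shows "cnt 8 E id i \<le> coeff k8 i"
proof -
  have "E \<noteq> {}" using E(2) by auto
  then obtain u v where uv: "(u, v) \<in> E" by fast
  then have l: "u < 8" "v < 8" "u \<noteq> v" using E(1) by (auto simp: pairs_def)
  \<comment> \<open>\<open>u\<close> is moved to 6 first; \<open>w\<close> is where that leaves
    \<open>v\<close>, which matters if \<open>v\<close> was 6. As \<open>w\<close> is not 6, moving
    \<open>w\<close> to 7 does not disturb the image of \<open>u\<close>.\<close>
  define w where "w = Transposition.transpose u 6 v"
  define p where "p = Transposition.transpose w 7 \<circ> Transposition.transpose u 6"
  have w: "w < 8" "w \<noteq> 6" using l by (auto simp: w_def Transposition.transpose_def)
  have p: "p permutes {..<8}"
    unfolding p_def using l w by (intro permutes_compose permutes_swap_id) auto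
  have pv: "p v = 7" by (simp only: p_def comp_apply w_def[symmetric] transpose_apply_first)
  have pu: "p u = 6" using w by (simp add: p_def transpose_apply_other)
  define F where "F = relabel p ` E"
  have F: "F \<subseteq> pairs 8" "card F = 16"
    using relabel_image_pairs[OF p E(1)] card_relabel[OF p E(1)] E(2) by (simp_all add: F_def)
  have deg: "card (nbrs F x) = 4" if x: "x < 8" for x
  proof -
    obtain y where y: "x = p y" "y < 8" using x permutes_image[OF p] by blast
    have "card (nbrs F (p y)) = card (nbrs E y)"
      unfolding F_def nbrs_relabel[OF p] using permutes_inj_on[OF p] by (rule card_image)
    then show ?thesis using reg y by simp
  qed
  have e67: "(6, 7) \<in> F"
    using imageI[OF uv, of "relabel p"] by (simp add: F_def relabel_def pu pv)
  define K where "K = F \<inter> pairs 6"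
  define S where "S = nbrs F 6 - {7}"
  define T where "T = nbrs F 7 - {6}"
  have K: "K \<subseteq> pairs 6" by (simp add: K_def)
  have F_eq: "F = insert (6, 7) (K \<union> star 6 S \<union> star 7 T)"
  proof (intro equalityI subrelI)
    fix a b assume ab: "(a, b) \<in> F"
    then have "a < b" "b < 8" using F(1) by (auto simp: pairs_def)
    then consider "b < 6" | "b = 6" | "b = 7" "a = 6" | "b = 7" "a < 6" by linarith
    then show "(a, b) \<in> insert (6, 7) (K \<union> star 6 S \<union> star 7 T)"
      using ab \<open>a < b\<close> by cases (auto simp: K_def S_def T_def star_def nbrs_def pairs_def)
  next
    fix a b assume "(a, b) \<in> insert (6, 7) (K \<union> star 6 S \<union> star 7 T)"
    then show "(a, b) \<in> F"
      using e67 F(1) by (auto simp: K_def S_def T_def star_def nbrs_def pairs_def)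
  qed
  have lt: "a < b \<and> b < 8" if "(a, b) \<in> F" for a b using that F(1) by (auto simp: pairs_def)
  have S6: "S \<subseteq> {..<6}" and T6: "T \<subseteq> {..<6}"
    using F(1) by (auto simp: S_def T_def nbrs_def pairs_def)
  have n67: "7 \<in> nbrs F 6" "6 \<in> nbrs F 7" using e67 by (auto simp: nbrs_def)
  have cS: "card S = 3" and cT: "card T = 3" using n67 deg[of 6] deg[of 7] by (simp_all add: S_def T_def)
  have F': "F \<subseteq> pairs (Suc 7)" using F by simp
  have F7: "F \<inter> pairs 7 \<subseteq> pairs (Suc 6)" by auto
  have "nbrs (F \<inter> pairs 7) 6 = S" using F(1) by (auto simp: S_def nbrs_def pairs_def)
  moreover have "F \<inter> pairs 7 \<inter> pairs 6 = K" by (force simp: K_def pairs_def)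
  \<comment> \<open>Of the 16 edges, 4 lie at 7 and another 3 at 6, since their common edge is
    already counted at 7.\<close>
  ultimately have cK: "card K = 9"
    using pairs_split(3)[OF F'] pairs_split(3)[OF F7] F(2) deg[of 7] cS by simp
  have "card (nbrs K x) + (if x \<in> S then 1 else 0) + (if x \<in> T then 1 else 0) = 4"
    if x: "x < 6" for x
  proof -
    have n: "nbrs F x = nbrs K x \<union> (if x \<in> S then {6} else {}) \<union> (if x \<in> T then {7} else {})"
    proof (rule set_eqI)
      fix y :: nat
      consider "y = 6" | "y = 7" | "y < 6" | "y > 7" by linarith
      then show "y \<in> nbrs F x \<longleftrightarrow> y \<in> nbrs K x \<union> (if x \<in> S then {6} else {}) \<union> (if x \<in> T then {7} else {})"
        using x lt[of x y] lt[of y x] by cases (auto simp: nbrs_def K_def S_def T_def pairs_def)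
    qed
    have "nbrs K x \<subseteq> {..<6}" by (auto simp: nbrs_def K_def pairs_def)
    then have "finite (nbrs K x)" "6 \<notin> nbrs K x" "7 \<notin> nbrs K x" using finite_subset by auto
    then show ?thesis using n deg[of x] x by (auto split: if_splits)
  qed
  then have "cnt 8 F id i \<le> coeff k8 i"
    using g[OF K cK] S6 T6 cS cT unfolding F_eq good_regular_def by blast
  then show ?thesis unfolding F_def cnt_relabel_id[OF p E(1)] .
qed

lemma cnt_le_k8:
  assumes g: "\<And>d J. d \<le> 3 \<Longrightarrow> J \<subseteq> pairs 6 \<Longrightarrow> card J + d = 13 \<Longrightarrow> good d J"
    and r: "\<And>K. K \<subseteq> pairs 6 \<Longrightarrow> card K = 9 \<Longrightarrow> good_regular K"
    and E: "E \<subseteq> pairs 8" "card E = 16"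
  shows "cnt 8 E id i \<le> coeff k8 i"
proof (cases "\<exists>x<8. card (nbrs E x) \<le> 3")
  case True
  have "cnt (Suc 7) E id i \<le> 3 * shift (coeff m7) i + shift (shift (shift (coeff r7))) i"
  proof (rule cnt_le_of_low_degree[where k = 13])
    show "bounded (coeff m7) (coeff r7) 7 H" if "H \<subseteq> pairs 7" "card H = 13" for H
      by (rule bounded_of_good[OF g that])
  qed (use E True in auto)
  also have "\<dots> = coeff (padd (0 # m7) (padd (0 # m7) (padd (0 # m7) (0 # 0 # 0 # r7)))) i"
    by (simp only: coeff_padd coeff_shift)
  \<comment> \<open>Equality holds in every degree but 13, where the left side is 559 and
    \<open>k8\<close> has 560 = C(16,3): three edges at a vertex of degree 3 form a cut.\<close>
  also have "\<dots> \<le> coeff k8 i" by (rule ple_coeff) (simp add: m7_def r7_def k8_def)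
  finally show ?thesis by simp
next
  case False
  \<comment> \<open>All degrees are at least 4 and their sum is 32, so none can exceed 4.\<close>
  have "(\<Sum>x<8. card (nbrs E x)) = (\<Sum>x<(8::nat). 4)" using sum_degree[OF E(1)] E(2) by simp
  then have "card (nbrs E x) = 4" if "x < 8" for x
    using False that sum_mono_inv[of "\<lambda>x. 4" "{..<8}" "\<lambda>x. card (nbrs E x)" x] by force
  then show ?thesis by (intro cnt_le_of_regular[OF r E])
qed

section \<open>Graphs given by their non-edges, and the rules for evaluation\<close>

primrec rest :: "'a list \<Rightarrow> 'a list \<Rightarrow> 'a list" where
  "rest r [] = []"
| "rest r (e # es) = (if mem e r then rest r es else e # rest r es)"

lemma set_rest [simp]: "set (rest r es) = set es - set r"
  by (induction es) auto

lemma distinct_rest: "distinct es \<Longrightarrow> distinct (rest r es)"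
  by (induction es) auto

text \<open>A graph on six vertices is presented by the list \<open>r\<close> of its non-edges.\<close>

definition complementary :: "(nat \<times> nat) list \<Rightarrow> (nat \<times> nat) list \<Rightarrow> bool" where
  "complementary es r \<longleftrightarrow> isort pair_less es = rest r pairs6"

lemma complementaryD:
  assumes "complementary es r"
  shows "distinct es" "set es = pairs 6 - set r" "distinct (rest r pairs6)" "set (rest r pairs6) = set es"
proof -
  have e: "isort pair_less es = rest r pairs6" using assms by (simp add: complementary_def)
  show r: "distinct (rest r pairs6)" by (rule distinct_rest) (simp add: pairs6_def)
  show "distinct es" using arg_cong[OF e, of distinct] r by simp
  show s: "set es = pairs 6 - set r" using arg_cong[OF e, of set] by (simp add: set_pairs6)
  show "set (rest r pairs6) = set es" using s by (simp add: set_pairs6)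
qed

lemma good_complementI:
  assumes c: "complementary es r"
    and chk: "list_all (check (csg es)) (filter (big d (rest r pairs6)) (picks d id6))"
  shows "good d (pairs 6 - set r)"
proof -
  note es = complementaryD[OF c]
  have "set es \<subseteq> pairs 6" using es(2) by auto
  from goodI[OF es(1) this es(3,4) chk] show ?thesis by (simp only: es(2))
qed

lemma good_regular_complementI:
  assumes c: "complementary es r"
    and chk: "list_all (check_regular (csg es) (rest r pairs6)) (picks (Suc (Suc (Suc 0))) id6)"
  shows "good_regular (pairs 6 - set r)"
proof -
  note es = complementaryD[OF c]
  have "set es \<subseteq> pairs 6" using es(2) by auto
  from good_regularI[OF es(1) this es(3,4) chk] show ?thesis by (simp only: es(2))
qed

text \<open>Builds partitions vertex by vertex, starting from the end of the list; \<open>rs\<close>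
  holds the representatives so far. A new vertex joins a block, taking its representative as label,
  or opens its own. As vertices come in increasing order in \<open>parts6\<close>, every label is
  the least vertex of its block, the normal form that \<open>join\<close> preserves.\<close>

primrec parts :: "nat list \<Rightarrow> (nat list \<times> nat list) list" where
  "parts [] = [([], [])]"
| "parts (v # vs) =
    concat (map (\<lambda>(l, rs). map (\<lambda>r. (l @ [r], rs)) rs @ [(l @ [v], rs @ [v])]) (parts vs))"

definition parts6 :: "nat list list" where
  "parts6 = map fst (parts [5, 4, 3, 2, 1, 0])"

text \<open>The schematic statements below are computed tables: one polynomial for each of the 203 partitions
  of six vertices. Printing them would exhaust the memory of the build.\<close>

declare [[show_results = false]]

schematic_goal parts6_eq: "parts6 = ?x"
  by (simp add: parts6_def del: One_nat_def)

lemma nth_small: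
  "(x # xs) ! 0 = x" "(x # xs) ! 1 = xs ! 0" "(x # xs) ! 2 = xs ! 1"
  "(x # xs) ! 3 = xs ! 2" "(x # xs) ! 4 = xs ! 3" "(x # xs) ! 5 = xs ! 4"
  by (simp_all add: numeral_eq_Suc)

lemma eq_small:
  "((0::nat) = 1) = False" "((0::nat) = 2) = False" "((0::nat) = 3) = False" "((0::nat) = 4) = False"
  "((0::nat) = 5) = False" "((1::nat) = 0) = False" "((1::nat) = 2) = False" "((1::nat) = 3) = False"
  "((1::nat) = 4) = False" "((1::nat) = 5) = False" "((2::nat) = 0) = False" "((2::nat) = 1) = False"
  "((2::nat) = 3) = False" "((2::nat) = 4) = False" "((2::nat) = 5) = False" "((3::nat) = 0) = False"
  "((3::nat) = 1) = False" "((3::nat) = 2) = False" "((3::nat) = 4) = False" "((3::nat) = 5) = False"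
  "((4::nat) = 0) = False" "((4::nat) = 1) = False" "((4::nat) = 2) = False" "((4::nat) = 3) = False"
  "((4::nat) = 5) = False" "((5::nat) = 0) = False" "((5::nat) = 1) = False" "((5::nat) = 2) = False"
  "((5::nat) = 3) = False" "((5::nat) = 4) = False"
  by simp_all

lemma less_small:
  "((0::nat) < 1) = True" "((0::nat) < 2) = True" "((0::nat) < 3) = True" "((0::nat) < 4) = True"
  "((0::nat) < 5) = True" "((1::nat) < 0) = False" "((1::nat) < 2) = True" "((1::nat) < 3) = True"
  "((1::nat) < 4) = True" "((1::nat) < 5) = True" "((2::nat) < 0) = False" "((2::nat) < 1) = False"
  "((2::nat) < 3) = True" "((2::nat) < 4) = True" "((2::nat) < 5) = True" "((3::nat) < 0) = False"
  "((3::nat) < 1) = False" "((3::nat) < 2) = False" "((3::nat) < 4) = True" "((3::nat) < 5) = True"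
  "((4::nat) < 0) = False" "((4::nat) < 1) = False" "((4::nat) < 2) = False" "((4::nat) < 3) = False"
  "((4::nat) < 5) = True" "((5::nat) < 0) = False" "((5::nat) < 1) = False" "((5::nat) < 2) = False"
  "((5::nat) < 3) = False" "((5::nat) < 4) = False"
  by simp_all

lemma not_Suc_le_0: "(Suc n \<le> 0) = False"
  by simp

text \<open>A closed set of rules on ground terms replaces general simplification. The congruence
  \<open>if_weak_cong\<close> used with it keeps both branches of a conditional untouched until its
  condition is decided.\<close>

lemmas calc_rules = padd.simps ple.simps subst_def join_def lmerge_def nth_small eq_small less_small order_less_irrefl
  if_True if_False list.map fst_conv snd_conv simp_thms
  add_0 add_0_right one_add_one one_plus_numeral numeral_plus_one add_num_simps numeral_plus_numeral

lemmas sort_rules = isort.simps ins.simps pair_less_def mem.simps rest.simps prod.inject list.inject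

lemmas check_rules = check_def check_all_def check_pair_def check_vertex_def check_triple_def
  check_regular_def check_hubs_def two_hubs_def four_def four_at_def big_def big_at_def
  hub_degree_def dg.simps mem.simps rest.simps picks.simps filter.simps append.simps
  list.pred_inject sweep.simps attached.simps pairs6_def triples6_def id6_def m7_def r7_def k8_def
  prod.inject Suc_le_mono le0 not_Suc_le_0 nat.inject nat.distinct
  num.simps le_num_simps less_num_simps numeral_le_iff le_zero_eq one_le_numeral le_numeral_extra
  numeral_le_one_iff zero_neq_numeral numeral_neq_zero zero_neq_one one_neq_zero


section \<open>Polynomial tables for the six-vertex graphs\<close>

definition g0 :: "(nat \<times> nat) list" where
  "g0 = [(1, 3), (1, 4), (2, 3)]"

\<comment> \<open>Only this table is computed from the empty graph, by unfolding all three edges of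
  \<open>g0\<close>.\<close>
schematic_goal g0_table: "map (csg g0) parts6 = ?x"
  by (simp only: parts6_eq g0_def csg.simps list.pred_inject list.sel calc_rules cong: if_weak_cong)

text \<open>Splits the equation between lists into one rewrite rule per partition, so that later
  evaluation looks polynomials up.\<close>

lemmas g0_csg = g0_table[simplified parts6_eq list.map list.inject simp_thms]

text \<open>The common subgraph of all graphs below. Each later graph adds edges in front of an
  earlier one, and deletion-contraction of these edges leads only to partitions found in the earlier
  table. \<open>g2\<close> to \<open>g12\<close> have 9 edges, \<open>g13\<close> to
  \<open>g24\<close> have 10, \<open>g25\<close>, \<open>g26\<close> and \<open>g28\<close> to
  \<open>g34\<close> have 11, \<open>g35\<close> to \<open>g39\<close> have 12, \<open>g40\<close>
  and \<open>g41\<close> have 13; \<open>g27\<close> is a stepping stone to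
  \<open>g28\<close>.\<close>

definition g1 :: "(nat \<times> nat) list" where
  "g1 = (0, 3) # (0, 4) # (0, 5) # g0"

schematic_goal g1_table: "map (csg g1) parts6 = ?x"
  by (simp only: parts6_eq g1_def csg.simps(2) g0_csg calc_rules cong: if_weak_cong)

lemmas g1_csg = g1_table[simplified parts6_eq list.map list.inject simp_thms]

definition g2 :: "(nat \<times> nat) list" where
  "g2 = (0, 1) # (1, 5) # (2, 4) # g1"

schematic_goal g2_table: "map (csg g2) parts6 = ?x"
  by (simp only: parts6_eq g2_def csg.simps(2) g1_csg calc_rules cong: if_weak_cong)

lemmas g2_csg = g2_table[simplified parts6_eq list.map list.inject simp_thms]

definition g3 :: "(nat \<times> nat) list" where
  "g3 = (0, 1) # (2, 5) # (3, 4) # g1"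

schematic_goal g3_table: "map (csg g3) parts6 = ?x"
  by (simp only: parts6_eq g3_def csg.simps(2) g1_csg calc_rules cong: if_weak_cong)

lemmas g3_csg = g3_table[simplified parts6_eq list.map list.inject simp_thms]

definition g4 :: "(nat \<times> nat) list" where
  "g4 = (0, 1) # (1, 2) # (3, 5) # g1"

schematic_goal g4_table: "map (csg g4) parts6 = ?x"
  by (simp only: parts6_eq g4_def csg.simps(2) g1_csg calc_rules cong: if_weak_cong)

lemmas g4_csg = g4_table[simplified parts6_eq list.map list.inject simp_thms]

definition g5 :: "(nat \<times> nat) list" where
  "g5 = (0, 1) # (1, 2) # (4, 5) # g1"

schematic_goal g5_table: "map (csg g5) parts6 = ?x"
  by (simp only: parts6_eq g5_def csg.simps(2) g1_csg calc_rules cong: if_weak_cong)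

lemmas g5_csg = g5_table[simplified parts6_eq list.map list.inject simp_thms]

definition g6 :: "(nat \<times> nat) list" where
  "g6 = (0, 1) # (2, 4) # (3, 5) # g1"

schematic_goal g6_table: "map (csg g6) parts6 = ?x"
  by (simp only: parts6_eq g6_def csg.simps(2) g1_csg calc_rules cong: if_weak_cong)

lemmas g6_csg = g6_table[simplified parts6_eq list.map list.inject simp_thms]

definition g7 :: "(nat \<times> nat) list" where
  "g7 = (0, 1) # (2, 5) # (4, 5) # g1"

schematic_goal g7_table: "map (csg g7) parts6 = ?x"
  by (simp only: parts6_eq g7_def csg.simps(2) g1_csg calc_rules cong: if_weak_cong)

lemmas g7_csg = g7_table[simplified parts6_eq list.map list.inject simp_thms]

definition g8 :: "(nat \<times> nat) list" where
  "g8 = (0, 1) # (2, 4) # (2, 5) # g1"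

schematic_goal g8_table: "map (csg g8) parts6 = ?x"
  by (simp only: parts6_eq g8_def csg.simps(2) g1_csg calc_rules cong: if_weak_cong)

lemmas g8_csg = g8_table[simplified parts6_eq list.map list.inject simp_thms]

definition g9 :: "(nat \<times> nat) list" where
  "g9 = (0, 2) # (1, 2) # (4, 5) # g1"

schematic_goal g9_table: "map (csg g9) parts6 = ?x"
  by (simp only: parts6_eq g9_def csg.simps(2) g1_csg calc_rules cong: if_weak_cong)

lemmas g9_csg = g9_table[simplified parts6_eq list.map list.inject simp_thms]

definition g10 :: "(nat \<times> nat) list" where
  "g10 = (0, 2) # (1, 2) # (1, 5) # g1"

schematic_goal g10_table: "map (csg g10) parts6 = ?x"
  by (simp only: parts6_eq g10_def csg.simps(2) g1_csg calc_rules cong: if_weak_cong)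

lemmas g10_csg = g10_table[simplified parts6_eq list.map list.inject simp_thms]

definition g11 :: "(nat \<times> nat) list" where
  "g11 = (1, 2) # (2, 5) # (4, 5) # g1"

schematic_goal g11_table: "map (csg g11) parts6 = ?x"
  by (simp only: parts6_eq g11_def csg.simps(2) g1_csg calc_rules cong: if_weak_cong)

lemmas g11_csg = g11_table[simplified parts6_eq list.map list.inject simp_thms]

text \<open>This is K_{3,3} with parts {0, 1, 2} and {3, 4, 5}, which K_{4,4} becomes when two
  adjacent vertices are removed.\<close>

definition g12 :: "(nat \<times> nat) list" where
  "g12 = (1, 5) # (2, 4) # (2, 5) # g1"

schematic_goal g12_table: "map (csg g12) parts6 = ?x"
  by (simp only: parts6_eq g12_def csg.simps(2) g1_csg calc_rules cong: if_weak_cong)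

lemmas g12_csg = g12_table[simplified parts6_eq list.map list.inject simp_thms]

definition g13 :: "(nat \<times> nat) list" where
  "g13 = (0, 1) # g10"

schematic_goal g13_table: "map (csg g13) parts6 = ?x"
  by (simp only: parts6_eq g13_def csg.simps(2) g10_csg calc_rules cong: if_weak_cong)

lemmas g13_csg = g13_table[simplified parts6_eq list.map list.inject simp_thms]

definition g14 :: "(nat \<times> nat) list" where
  "g14 = (0, 2) # g4"

schematic_goal g14_table: "map (csg g14) parts6 = ?x"
  by (simp only: parts6_eq g14_def csg.simps(2) g4_csg calc_rules cong: if_weak_cong)

lemmas g14_csg = g14_table[simplified parts6_eq list.map list.inject simp_thms]

definition g15 :: "(nat \<times> nat) list" where
  "g15 = (0, 2) # g3"

schematic_goal g15_table: "map (csg g15) parts6 = ?x"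
  by (simp only: parts6_eq g15_def csg.simps(2) g3_csg calc_rules cong: if_weak_cong)

lemmas g15_csg = g15_table[simplified parts6_eq list.map list.inject simp_thms]

definition g16 :: "(nat \<times> nat) list" where
  "g16 = (0, 2) # g2"

schematic_goal g16_table: "map (csg g16) parts6 = ?x"
  by (simp only: parts6_eq g16_def csg.simps(2) g2_csg calc_rules cong: if_weak_cong)

lemmas g16_csg = g16_table[simplified parts6_eq list.map list.inject simp_thms]

definition g17 :: "(nat \<times> nat) list" where
  "g17 = (0, 2) # g7"

schematic_goal g17_table: "map (csg g17) parts6 = ?x"
  by (simp only: parts6_eq g17_def csg.simps(2) g7_csg calc_rules cong: if_weak_cong)

lemmas g17_csg = g17_table[simplified parts6_eq list.map list.inject simp_thms]

definition g18 :: "(nat \<times> nat) list" where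
  "g18 = (3, 4) # g2"

schematic_goal g18_table: "map (csg g18) parts6 = ?x"
  by (simp only: parts6_eq g18_def csg.simps(2) g2_csg calc_rules cong: if_weak_cong)

lemmas g18_csg = g18_table[simplified parts6_eq list.map list.inject simp_thms]

definition g19 :: "(nat \<times> nat) list" where
  "g19 = (3, 5) # g2"

schematic_goal g19_table: "map (csg g19) parts6 = ?x"
  by (simp only: parts6_eq g19_def csg.simps(2) g2_csg calc_rules cong: if_weak_cong)

lemmas g19_csg = g19_table[simplified parts6_eq list.map list.inject simp_thms]

definition g20 :: "(nat \<times> nat) list" where
  "g20 = (2, 5) # g2"

schematic_goal g20_table: "map (csg g20) parts6 = ?x"
  by (simp only: parts6_eq g20_def csg.simps(2) g2_csg calc_rules cong: if_weak_cong)

lemmas g20_csg = g20_table[simplified parts6_eq list.map list.inject simp_thms]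

definition g21 :: "(nat \<times> nat) list" where
  "g21 = (4, 5) # g4"

schematic_goal g21_table: "map (csg g21) parts6 = ?x"
  by (simp only: parts6_eq g21_def csg.simps(2) g4_csg calc_rules cong: if_weak_cong)

lemmas g21_csg = g21_table[simplified parts6_eq list.map list.inject simp_thms]

definition g22 :: "(nat \<times> nat) list" where
  "g22 = (4, 5) # g6"

schematic_goal g22_table: "map (csg g22) parts6 = ?x"
  by (simp only: parts6_eq g22_def csg.simps(2) g6_csg calc_rules cong: if_weak_cong)

lemmas g22_csg = g22_table[simplified parts6_eq list.map list.inject simp_thms]

definition g23 :: "(nat \<times> nat) list" where
  "g23 = (2, 5) # g5"

schematic_goal g23_table: "map (csg g23) parts6 = ?x"
  by (simp only: parts6_eq g23_def csg.simps(2) g5_csg calc_rules cong: if_weak_cong)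

lemmas g23_csg = g23_table[simplified parts6_eq list.map list.inject simp_thms]

definition g24 :: "(nat \<times> nat) list" where
  "g24 = (1, 5) # g9"

schematic_goal g24_table: "map (csg g24) parts6 = ?x"
  by (simp only: parts6_eq g24_def csg.simps(2) g9_csg calc_rules cong: if_weak_cong)

lemmas g24_csg = g24_table[simplified parts6_eq list.map list.inject simp_thms]

definition g25 :: "(nat \<times> nat) list" where
  "g25 = (2, 4) # g13"

schematic_goal g25_table: "map (csg g25) parts6 = ?x"
  by (simp only: parts6_eq g25_def csg.simps(2) g13_csg calc_rules cong: if_weak_cong)

lemmas g25_csg = g25_table[simplified parts6_eq list.map list.inject simp_thms]

definition g26 :: "(nat \<times> nat) list" where
  "g26 = (4, 5) # g13"

schematic_goal g26_table: "map (csg g26) parts6 = ?x"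
  by (simp only: parts6_eq g26_def csg.simps(2) g13_csg calc_rules cong: if_weak_cong)

lemmas g26_csg = g26_table[simplified parts6_eq list.map list.inject simp_thms]

definition g27 :: "(nat \<times> nat) list" where
  "g27 = (0, 1) # (0, 2) # g1"

schematic_goal g27_table: "map (csg g27) parts6 = ?x"
  by (simp only: parts6_eq g27_def csg.simps(2) g1_csg calc_rules cong: if_weak_cong)

lemmas g27_csg = g27_table[simplified parts6_eq list.map list.inject simp_thms]

definition g28 :: "(nat \<times> nat) list" where
  "g28 = (1, 2) # (2, 4) # (3, 4) # g27"

schematic_goal g28_table: "map (csg g28) parts6 = ?x"
  by (simp only: parts6_eq g28_def csg.simps(2) g27_csg calc_rules cong: if_weak_cong)

lemmas g28_csg = g28_table[simplified parts6_eq list.map list.inject simp_thms]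

definition g29 :: "(nat \<times> nat) list" where
  "g29 = (2, 4) # g14"

schematic_goal g29_table: "map (csg g29) parts6 = ?x"
  by (simp only: parts6_eq g29_def csg.simps(2) g14_csg calc_rules cong: if_weak_cong)

lemmas g29_csg = g29_table[simplified parts6_eq list.map list.inject simp_thms]

definition g30 :: "(nat \<times> nat) list" where
  "g30 = (4, 5) # g14"

schematic_goal g30_table: "map (csg g30) parts6 = ?x"
  by (simp only: parts6_eq g30_def csg.simps(2) g14_csg calc_rules cong: if_weak_cong)

lemmas g30_csg = g30_table[simplified parts6_eq list.map list.inject simp_thms]

definition g31 :: "(nat \<times> nat) list" where
  "g31 = (2, 5) # g16"

schematic_goal g31_table: "map (csg g31) parts6 = ?x"
  by (simp only: parts6_eq g31_def csg.simps(2) g16_csg calc_rules cong: if_weak_cong)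

lemmas g31_csg = g31_table[simplified parts6_eq list.map list.inject simp_thms]

definition g32 :: "(nat \<times> nat) list" where
  "g32 = (4, 5) # g19"

schematic_goal g32_table: "map (csg g32) parts6 = ?x"
  by (simp only: parts6_eq g32_def csg.simps(2) g19_csg calc_rules cong: if_weak_cong)

lemmas g32_csg = g32_table[simplified parts6_eq list.map list.inject simp_thms]

definition g33 :: "(nat \<times> nat) list" where
  "g33 = (2, 5) # g18"

schematic_goal g33_table: "map (csg g33) parts6 = ?x"
  by (simp only: parts6_eq g33_def csg.simps(2) g18_csg calc_rules cong: if_weak_cong)

lemmas g33_csg = g33_table[simplified parts6_eq list.map list.inject simp_thms]

definition g34 :: "(nat \<times> nat) list" where
  "g34 = (2, 4) # g21"

schematic_goal g34_table: "map (csg g34) parts6 = ?x"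
  by (simp only: parts6_eq g34_def csg.simps(2) g21_csg calc_rules cong: if_weak_cong)

lemmas g34_csg = g34_table[simplified parts6_eq list.map list.inject simp_thms]

definition g35 :: "(nat \<times> nat) list" where
  "g35 = (2, 5) # g25"

schematic_goal g35_table: "map (csg g35) parts6 = ?x"
  by (simp only: parts6_eq g35_def csg.simps(2) g25_csg calc_rules cong: if_weak_cong)

lemmas g35_csg = g35_table[simplified parts6_eq list.map list.inject simp_thms]

definition g36 :: "(nat \<times> nat) list" where
  "g36 = (3, 4) # g25"

schematic_goal g36_table: "map (csg g36) parts6 = ?x"
  by (simp only: parts6_eq g36_def csg.simps(2) g25_csg calc_rules cong: if_weak_cong)

lemmas g36_csg = g36_table[simplified parts6_eq list.map list.inject simp_thms]

definition g37 :: "(nat \<times> nat) list" where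
  "g37 = (3, 5) # g25"

schematic_goal g37_table: "map (csg g37) parts6 = ?x"
  by (simp only: parts6_eq g37_def csg.simps(2) g25_csg calc_rules cong: if_weak_cong)

lemmas g37_csg = g37_table[simplified parts6_eq list.map list.inject simp_thms]

definition g38 :: "(nat \<times> nat) list" where
  "g38 = (4, 5) # g29"

schematic_goal g38_table: "map (csg g38) parts6 = ?x"
  by (simp only: parts6_eq g38_def csg.simps(2) g29_csg calc_rules cong: if_weak_cong)

lemmas g38_csg = g38_table[simplified parts6_eq list.map list.inject simp_thms]

definition g39 :: "(nat \<times> nat) list" where
  "g39 = (2, 5) # g34"

schematic_goal g39_table: "map (csg g39) parts6 = ?x"
  by (simp only: parts6_eq g39_def csg.simps(2) g34_csg calc_rules cong: if_weak_cong)

lemmas g39_csg = g39_table[simplified parts6_eq list.map list.inject simp_thms]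

definition g40 :: "(nat \<times> nat) list" where
  "g40 = (3, 4) # g35"

schematic_goal g40_table: "map (csg g40) parts6 = ?x"
  by (simp only: parts6_eq g40_def csg.simps(2) g35_csg calc_rules cong: if_weak_cong)

lemmas g40_csg = g40_table[simplified parts6_eq list.map list.inject simp_thms]

definition g41 :: "(nat \<times> nat) list" where
  "g41 = (4, 5) # g37"

schematic_goal g41_table: "map (csg g41) parts6 = ?x"
  by (simp only: parts6_eq g41_def csg.simps(2) g37_csg calc_rules cong: if_weak_cong)

lemmas g41_csg = g41_table[simplified parts6_eq list.map list.inject simp_thms]

section \<open>Sparse graphs on six vertices with the permutations for adding an edge\<close>

definition grow0 :: "((nat \<times> nat) list \<times> nat list list) list" where
  "grow0 = [([],
    [[4, 5, 0, 1, 2, 3], [4, 0, 5, 1, 2, 3], [4, 0, 1, 5, 2, 3], [4, 0, 1, 2, 5, 3], [4, 0, 1, 2,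
    3, 5], [0, 4, 5, 1, 2, 3], [0, 4, 1, 5, 2, 3], [0, 4, 1, 2, 5, 3], [0, 4, 1, 2, 3, 5], [0, 1,
    4, 5, 2, 3], [0, 1, 4, 2, 5, 3], [0, 1, 4, 2, 3, 5], [0, 1, 2, 4, 5, 3], [0, 1, 2, 4, 3, 5],
    [0, 1, 2, 3, 4, 5]])]"

definition grow1 :: "((nat \<times> nat) list \<times> nat list list) list" where
  "grow1 = [([(4, 5)],
    [[2, 5, 0, 1, 3, 4], [2, 0, 5, 1, 3, 4], [2, 0, 1, 5, 3, 4], [3, 0, 1, 2, 5, 4], [3, 0, 1, 2,
    4, 5], [0, 2, 5, 1, 3, 4], [0, 2, 1, 5, 3, 4], [0, 3, 1, 2, 5, 4], [0, 3, 1, 2, 4, 5], [0, 1,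
    2, 5, 3, 4], [0, 1, 3, 2, 5, 4], [0, 1, 3, 2, 4, 5], [0, 1, 2, 3, 5, 4], [0, 1, 2, 3, 4,
    5]])]"

definition grow2 :: "((nat \<times> nat) list \<times> nat list list) list" where
  "grow2 = [([(3, 5), (4, 5)],
    [[3, 4, 0, 1, 2, 5], [3, 0, 4, 1, 2, 5], [2, 0, 1, 5, 3, 4], [2, 0, 1, 3, 5, 4], [2, 0, 1, 3,
    4, 5], [0, 3, 4, 1, 2, 5], [0, 2, 1, 5, 3, 4], [0, 2, 1, 3, 5, 4], [0, 2, 1, 3, 4, 5], [0, 1,
    2, 5, 3, 4], [0, 1, 2, 3, 5, 4], [0, 1, 2, 3, 4, 5], [0, 1, 2, 3, 4, 5]]),
   ([(2, 5), (3, 4)],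
    [[0, 2, 1, 3, 4, 5], [1, 0, 5, 3, 4, 2], [1, 0, 3, 5, 2, 4], [1, 0, 3, 2, 5, 4], [1, 0, 2, 3,
    4, 5], [0, 1, 5, 3, 4, 2], [0, 1, 3, 5, 2, 4], [0, 1, 3, 2, 5, 4], [0, 1, 2, 3, 4, 5], [0, 1,
    4, 5, 2, 3], [0, 1, 4, 2, 5, 3], [0, 1, 2, 4, 3, 5], [0, 1, 2, 3, 4, 5]])]"

definition grow3 :: "((nat \<times> nat) list \<times> nat list list) list" where
  "grow3 = [([(3, 4), (3, 5), (4, 5)],
    [[1, 2, 0, 3, 4, 5], [1, 0, 2, 3, 4, 5], [2, 0, 1, 5, 3, 4], [2, 0, 1, 3, 5, 4], [2, 0, 1, 3,
    4, 5], [0, 1, 2, 3, 4, 5], [0, 2, 1, 5, 3, 4], [0, 2, 1, 3, 5, 4], [0, 2, 1, 3, 4, 5], [0, 1,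
    2, 5, 3, 4], [0, 1, 2, 3, 5, 4], [0, 1, 2, 3, 4, 5]]),
   ([(2, 5), (3, 5), (4, 5)],
    [[3, 4, 0, 1, 5, 2], [3, 0, 4, 1, 2, 5], [3, 0, 1, 4, 2, 5], [3, 0, 1, 2, 4, 5], [1, 0, 2, 3,
    4, 5], [0, 3, 4, 1, 2, 5], [0, 3, 1, 4, 2, 5], [0, 3, 1, 2, 4, 5], [0, 1, 2, 3, 4, 5], [0, 1,
    3, 4, 2, 5], [0, 1, 3, 2, 4, 5], [0, 1, 2, 3, 4, 5]]),
   ([(2, 5), (3, 4), (4, 5)],
    [[3, 4, 0, 1, 5, 2], [1, 0, 5, 3, 4, 2], [1, 0, 3, 5, 2, 4], [1, 0, 3, 2, 5, 4], [1, 0, 2, 3,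
    4, 5], [0, 1, 5, 3, 4, 2], [0, 1, 3, 5, 2, 4], [0, 1, 3, 2, 5, 4], [0, 1, 2, 3, 4, 5], [0, 1,
    2, 4, 3, 5], [0, 1, 3, 2, 5, 4], [0, 1, 2, 3, 4, 5]]),
   ([(1, 5), (2, 5), (3, 4)],
    [[0, 2, 1, 3, 4, 5], [0, 1, 2, 3, 4, 5], [0, 3, 4, 2, 1, 5], [0, 3, 4, 1, 2, 5], [0, 1, 5, 3,
    4, 2], [0, 3, 4, 1, 2, 5], [0, 2, 1, 4, 3, 5], [0, 2, 1, 3, 4, 5], [0, 1, 2, 4, 3, 5], [0, 1,
    2, 3, 4, 5], [0, 1, 2, 4, 3, 5], [0, 1, 2, 3, 4, 5]]),
   ([(0, 2), (1, 5), (3, 4)],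
    [[2, 5, 0, 3, 4, 1], [2, 3, 0, 5, 1, 4], [2, 3, 0, 1, 5, 4], [2, 1, 0, 3, 4, 5], [0, 5, 2, 3,
    4, 1], [3, 2, 4, 5, 1, 0], [3, 2, 4, 1, 5, 0], [0, 3, 2, 5, 1, 4], [0, 3, 2, 1, 5, 4], [0, 1,
    2, 3, 4, 5], [3, 0, 4, 5, 1, 2], [3, 0, 4, 1, 5, 2]])]"

definition grow4 :: "((nat \<times> nat) list \<times> nat list list) list" where
  "grow4 = [([(2, 5), (3, 4), (3, 5), (4, 5)],
    [[3, 4, 0, 1, 5, 2], [1, 0, 2, 3, 4, 5], [1, 0, 3, 5, 2, 4], [1, 0, 3, 2, 5, 4], [1, 0, 2, 3,
    4, 5], [0, 1, 2, 3, 4, 5], [0, 1, 3, 5, 2, 4], [0, 1, 3, 2, 5, 4], [0, 1, 2, 3, 4, 5], [0, 1,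
    2, 4, 3, 5], [0, 1, 2, 3, 4, 5]]),
   ([(2, 4), (2, 5), (3, 4), (3, 5)],
    [[0, 1, 2, 3, 4, 5], [3, 0, 5, 2, 1, 4], [3, 0, 2, 5, 1, 4], [3, 0, 1, 4, 5, 2], [3, 0, 1, 4,
    2, 5], [0, 3, 5, 2, 1, 4], [0, 3, 2, 5, 1, 4], [0, 3, 1, 4, 5, 2], [0, 3, 1, 4, 2, 5], [0, 1,
    4, 5, 2, 3], [0, 1, 2, 3, 4, 5]]),
   ([(1, 5), (2, 5), (3, 5), (4, 5)],
    [[3, 4, 0, 1, 2, 5], [3, 0, 4, 1, 2, 5], [3, 0, 1, 4, 2, 5], [3, 0, 1, 2, 4, 5], [0, 1, 2, 3,
    4, 5], [0, 3, 4, 1, 2, 5], [0, 3, 1, 4, 2, 5], [0, 3, 1, 2, 4, 5], [0, 1, 3, 4, 2, 5], [0, 1,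
    3, 2, 4, 5], [0, 1, 2, 3, 4, 5]]),
   ([(1, 5), (2, 5), (3, 4), (4, 5)],
    [[1, 5, 0, 3, 4, 2], [1, 0, 5, 3, 4, 2], [3, 0, 1, 4, 5, 2], [0, 3, 4, 1, 2, 5], [0, 1, 2, 3,
    4, 5], [0, 3, 4, 1, 2, 5], [0, 1, 3, 2, 4, 5], [0, 2, 1, 3, 4, 5], [0, 3, 1, 2, 4, 5], [0, 1,
    2, 3, 4, 5], [0, 1, 2, 3, 4, 5]]),
   ([(1, 5), (2, 4), (2, 5), (3, 4)],
    [[0, 2, 3, 1, 5, 4], [0, 1, 2, 3, 4, 5], [0, 1, 3, 2, 4, 5], [0, 3, 5, 1, 2, 4], [0, 1, 5, 3,
    4, 2], [0, 3, 5, 1, 2, 4], [0, 1, 3, 2, 4, 5], [0, 1, 4, 3, 5, 2], [0, 1, 5, 3, 4, 2], [0, 3,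
    1, 4, 2, 5], [0, 1, 2, 3, 4, 5]]),
   ([(1, 2), (3, 4), (3, 5), (4, 5)],
    [[0, 2, 1, 3, 4, 5], [0, 1, 2, 3, 4, 5], [0, 3, 4, 2, 1, 5], [0, 3, 4, 1, 2, 5], [0, 3, 4, 1,
    5, 2], [0, 2, 1, 5, 3, 4], [0, 2, 1, 3, 5, 4], [0, 2, 1, 3, 4, 5], [0, 1, 2, 5, 3, 4], [0, 1,
    2, 3, 5, 4], [0, 1, 2, 3, 4, 5]]),
   ([(0, 2), (1, 2), (2, 5), (3, 4)],
    [[1, 5, 2, 3, 4, 0], [5, 0, 2, 4, 3, 1], [5, 0, 2, 3, 4, 1], [1, 0, 2, 3, 4, 5], [0, 5, 2, 4,
    3, 1], [0, 5, 2, 3, 4, 1], [0, 1, 2, 3, 4, 5], [0, 1, 5, 4, 3, 2], [0, 1, 5, 3, 4, 2], [0, 1,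
    2, 4, 3, 5], [0, 1, 2, 3, 4, 5]]),
   ([(0, 2), (1, 2), (3, 5), (4, 5)],
    [[3, 4, 5, 0, 1, 2], [3, 1, 5, 4, 0, 2], [3, 1, 5, 0, 4, 2], [5, 3, 4, 0, 1, 2], [0, 4, 2, 3,
    1, 5], [0, 4, 2, 1, 3, 5], [3, 5, 4, 0, 1, 2], [0, 1, 2, 5, 3, 4], [0, 1, 2, 3, 5, 4], [0, 1,
    2, 3, 4, 5], [0, 1, 2, 3, 4, 5]]),
   ([(0, 2), (1, 5), (2, 5), (3, 4)],
    [[2, 4, 5, 0, 1, 3], [3, 0, 4, 5, 1, 2], [3, 0, 4, 1, 5, 2], [1, 0, 5, 3, 4, 2], [0, 1, 2, 3,
    4, 5], [0, 3, 2, 5, 1, 4], [0, 3, 2, 1, 5, 4], [0, 1, 2, 4, 3, 5], [0, 1, 2, 3, 4, 5], [1, 0,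
    5, 4, 3, 2], [1, 0, 5, 3, 4, 2]])]"

definition grow5 :: "((nat \<times> nat) list \<times> nat list list) list" where
  "grow5 = [([(2, 4), (2, 5), (3, 4), (3, 5), (4, 5)],
    [[0, 1, 2, 3, 4, 5], [1, 0, 5, 2, 3, 4], [1, 0, 2, 5, 3, 4], [1, 0, 2, 3, 5, 4], [1, 0, 2, 3,
    4, 5], [0, 1, 5, 2, 3, 4], [0, 1, 2, 5, 3, 4], [0, 1, 2, 3, 5, 4], [0, 1, 2, 3, 4, 5], [0, 1,
    2, 3, 4, 5]]),
   ([(1, 5), (2, 5), (3, 4), (3, 5), (4, 5)],
    [[1, 4, 0, 2, 3, 5], [1, 0, 4, 2, 3, 5], [2, 0, 1, 4, 3, 5], [2, 0, 1, 3, 4, 5], [0, 1, 2, 3,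
    4, 5], [0, 1, 4, 2, 3, 5], [0, 2, 1, 4, 3, 5], [0, 2, 1, 3, 4, 5], [0, 1, 2, 4, 3, 5], [0, 1,
    2, 3, 4, 5]]),
   ([(1, 5), (2, 4), (2, 5), (3, 4), (4, 5)],
    [[3, 4, 1, 0, 2, 5], [0, 1, 2, 3, 4, 5], [3, 0, 1, 4, 5, 2], [0, 2, 3, 1, 5, 4], [0, 1, 3, 2,
    4, 5], [0, 2, 3, 1, 5, 4], [0, 2, 1, 3, 4, 5], [0, 2, 3, 1, 5, 4], [0, 1, 3, 2, 4, 5], [0, 1,
    2, 3, 4, 5]]),
   ([(1, 2), (1, 5), (2, 4), (3, 5), (4, 5)],
    [[0, 2, 4, 1, 3, 5], [0, 1, 2, 3, 4, 5], [0, 2, 4, 1, 3, 5], [0, 3, 4, 1, 2, 5], [0, 2, 4, 1,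
    3, 5], [0, 4, 3, 1, 2, 5], [0, 3, 2, 1, 4, 5], [0, 1, 4, 2, 3, 5], [0, 2, 4, 1, 3, 5], [0, 2,
    3, 1, 4, 5]]),
   ([(1, 2), (2, 5), (3, 4), (3, 5), (4, 5)],
    [[0, 2, 1, 3, 4, 5], [0, 1, 2, 3, 4, 5], [0, 3, 4, 2, 1, 5], [0, 3, 4, 1, 2, 5], [0, 1, 4, 2,
    3, 5], [0, 2, 3, 5, 1, 4], [0, 2, 3, 1, 5, 4], [0, 1, 4, 2, 3, 5], [0, 1, 5, 3, 2, 4], [0, 1,
    5, 2, 3, 4]]),
   ([(1, 2), (1, 5), (2, 4), (3, 4), (3, 5)],
    [[0, 2, 1, 3, 5, 4], [0, 1, 2, 3, 4, 5], [0, 3, 5, 2, 1, 4], [0, 3, 4, 1, 2, 5], [0, 1, 5, 4,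
    3, 2], [0, 4, 3, 5, 2, 1], [0, 4, 1, 2, 5, 3], [0, 2, 5, 4, 1, 3], [0, 1, 4, 2, 3, 5], [0, 2,
    3, 1, 4, 5]]),
   ([(0, 5), (1, 5), (2, 5), (3, 5), (4, 5)],
    [[3, 4, 0, 1, 2, 5], [3, 0, 4, 1, 2, 5], [3, 0, 1, 4, 2, 5], [3, 0, 1, 2, 4, 5], [0, 3, 4, 1,
    2, 5], [0, 3, 1, 4, 2, 5], [0, 3, 1, 2, 4, 5], [0, 1, 3, 4, 2, 5], [0, 1, 3, 2, 4, 5], [0, 1,
    2, 3, 4, 5]]),
   ([(0, 5), (1, 5), (2, 5), (3, 4), (4, 5)],
    [[2, 3, 0, 1, 4, 5], [2, 0, 3, 1, 4, 5], [2, 0, 1, 4, 3, 5], [3, 0, 1, 2, 4, 5], [0, 2, 3, 1,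
    4, 5], [0, 2, 1, 4, 3, 5], [0, 3, 1, 2, 4, 5], [0, 1, 2, 4, 3, 5], [0, 1, 3, 2, 4, 5], [0, 1,
    2, 3, 4, 5]]),
   ([(0, 2), (1, 2), (2, 5), (3, 5), (4, 5)],
    [[3, 4, 5, 0, 1, 2], [3, 1, 5, 4, 0, 2], [3, 1, 5, 0, 4, 2], [3, 2, 4, 0, 1, 5], [0, 4, 2, 3,
    1, 5], [0, 4, 2, 1, 3, 5], [2, 3, 4, 0, 1, 5], [0, 1, 5, 3, 2, 4], [0, 1, 5, 2, 3, 4], [0, 1,
    2, 3, 4, 5]]),
   ([(0, 2), (1, 2), (2, 5), (3, 4), (4, 5)],
    [[3, 4, 5, 0, 2, 1], [1, 0, 2, 5, 3, 4], [1, 0, 2, 3, 5, 4], [1, 0, 2, 3, 4, 5], [0, 1, 2, 5,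
    3, 4], [0, 1, 2, 3, 5, 4], [0, 1, 2, 3, 4, 5], [0, 1, 5, 2, 4, 3], [0, 1, 5, 2, 4, 3], [0, 1,
    2, 3, 4, 5]]),
   ([(0, 2), (1, 2), (3, 4), (3, 5), (4, 5)],
    [[0, 1, 2, 3, 4, 5], [1, 0, 2, 5, 3, 4], [1, 0, 2, 3, 5, 4], [1, 0, 2, 3, 4, 5], [0, 1, 2, 5,
    3, 4], [0, 1, 2, 3, 5, 4], [0, 1, 2, 3, 4, 5], [0, 1, 2, 5, 3, 4], [0, 1, 2, 3, 5, 4], [0, 1,
    2, 3, 4, 5]]),
   ([(0, 2), (1, 5), (2, 4), (2, 5), (3, 4)],
    [[2, 4, 5, 0, 1, 3], [2, 0, 5, 4, 3, 1], [1, 3, 5, 0, 2, 4], [1, 0, 5, 3, 4, 2], [0, 2, 5, 1,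
    4, 3], [0, 3, 2, 5, 1, 4], [0, 3, 2, 1, 5, 4], [0, 1, 5, 2, 3, 4], [0, 1, 2, 3, 4, 5], [0, 1,
    2, 3, 4, 5]]),
   ([(0, 2), (1, 2), (1, 5), (2, 5), (3, 4)],
    [[2, 4, 5, 0, 1, 3], [1, 3, 5, 2, 0, 4], [1, 3, 5, 0, 2, 4], [2, 3, 4, 0, 1, 5], [0, 5, 2, 4,
    3, 1], [0, 5, 2, 3, 4, 1], [0, 2, 5, 4, 1, 3], [0, 2, 5, 1, 4, 3], [0, 1, 2, 4, 3, 5], [0, 1,
    2, 3, 4, 5]]),
   ([(0, 2), (1, 5), (2, 4), (3, 4), (3, 5)],
    [[0, 1, 2, 3, 4, 5], [2, 0, 4, 5, 3, 1], [3, 0, 4, 1, 5, 2], [1, 0, 5, 4, 3, 2], [0, 1, 2, 3,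
    4, 5], [0, 3, 2, 5, 1, 4], [0, 2, 1, 3, 5, 4], [0, 3, 2, 5, 1, 4], [0, 1, 2, 3, 4, 5], [3, 0,
    4, 1, 5, 2]]),
   ([(0, 1), (2, 4), (2, 5), (3, 4), (3, 5)],
    [[1, 0, 5, 4, 2, 3], [1, 0, 4, 5, 2, 3], [1, 0, 2, 3, 5, 4], [1, 0, 2, 3, 4, 5], [0, 1, 5, 4,
    2, 3], [0, 1, 4, 5, 2, 3], [0, 1, 2, 3, 5, 4], [0, 1, 2, 3, 4, 5], [0, 1, 4, 5, 2, 3], [0, 1,
    2, 3, 4, 5]])]"

text \<open>The last level carries no permutations, as nothing is grown from it. The lengths 1, 1,
  2, 5, 9, 15, 21 of the successive lists are the numbers of isomorphism types with 0 to 6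
  edges.\<close>

definition reps6 :: "(nat \<times> nat) list list" where
  "reps6 = [[(2, 3), (2, 4), (2, 5), (3, 4), (3, 5), (4, 5)],
    [(1, 5), (2, 4), (2, 5), (3, 4), (3, 5), (4, 5)],
    [(1, 5), (2, 3), (2, 4), (3, 4), (3, 5), (4, 5)],
    [(1, 4), (1, 5), (2, 4), (2, 5), (3, 4), (3, 5)],
    [(1, 4), (1, 5), (2, 3), (2, 5), (3, 5), (4, 5)],
    [(1, 4), (1, 5), (2, 3), (2, 5), (3, 4), (4, 5)],
    [(0, 5), (1, 5), (2, 5), (3, 4), (3, 5), (4, 5)],
    [(0, 5), (1, 5), (2, 4), (3, 4), (3, 5), (4, 5)],
    [(0, 5), (1, 5), (2, 4), (2, 5), (3, 4), (3, 5)],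
    [(0, 2), (1, 2), (2, 5), (3, 4), (3, 5), (4, 5)],
    [(0, 2), (1, 2), (1, 5), (2, 4), (3, 5), (4, 5)],
    [(0, 2), (1, 5), (2, 4), (2, 5), (3, 4), (4, 5)],
    [(0, 5), (1, 4), (2, 3), (2, 5), (3, 5), (4, 5)],
    [(0, 2), (1, 5), (2, 4), (2, 5), (3, 4), (3, 5)],
    [(0, 2), (1, 2), (1, 5), (2, 5), (3, 4), (4, 5)],
    [(0, 2), (1, 2), (1, 5), (2, 4), (3, 4), (3, 5)],
    [(0, 2), (1, 2), (1, 5), (3, 4), (3, 5), (4, 5)],
    [(0, 1), (1, 5), (2, 4), (2, 5), (3, 4), (3, 5)],
    [(0, 1), (2, 4), (2, 5), (3, 4), (3, 5), (4, 5)],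
    [(0, 1), (0, 2), (1, 5), (2, 4), (3, 4), (3, 5)],
    [(0, 1), (0, 2), (1, 2), (3, 4), (3, 5), (4, 5)]]"

section \<open>Verification of the bounds type by type\<close>

lemma good2_0: "good 0 (pairs 6 - set [(3, 5), (4, 5)])"
proof (rule good_complementI)
  show "complementary g40 [(3, 5), (4, 5)]"
    by (simp only: g40_def g35_def g25_def g13_def g10_def g1_def g0_def complementary_def pairs6_def calc_rules sort_rules cong: if_weak_cong)
  show "list_all (check (csg g40)) (filter (big 0 (rest [(3, 5), (4, 5)] pairs6)) (picks 0 id6))"
    by (simp only: g40_csg check_rules calc_rules cong: if_weak_cong)
qed

lemma good2_1: "good 0 (pairs 6 - set [(2, 5), (3, 4)])"
proof (rule good_complementI)
  show "complementary g41 [(2, 5), (3, 4)]"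
    by (simp only: g41_def g37_def g25_def g13_def g10_def g1_def g0_def complementary_def pairs6_def calc_rules sort_rules cong: if_weak_cong)
  show "list_all (check (csg g41)) (filter (big 0 (rest [(2, 5), (3, 4)] pairs6)) (picks 0 id6))"
    by (simp only: g41_csg check_rules calc_rules cong: if_weak_cong)
qed

lemma good3_0: "good (Suc 0) (pairs 6 - set [(3, 4), (3, 5), (4, 5)])"
proof (rule good_complementI)
  show "complementary g35 [(3, 4), (3, 5), (4, 5)]"
    by (simp only: g35_def g25_def g13_def g10_def g1_def g0_def complementary_def pairs6_def calc_rules sort_rules cong: if_weak_cong)
  show "list_all (check (csg g35)) (filter (big (Suc 0) (rest [(3, 4), (3, 5), (4, 5)] pairs6))
    (picks (Suc 0) id6))"
    by (simp only: g35_csg check_rules calc_rules cong: if_weak_cong)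
qed

lemma good3_1: "good (Suc 0) (pairs 6 - set [(2, 5), (3, 5), (4, 5)])"
proof (rule good_complementI)
  show "complementary g36 [(2, 5), (3, 5), (4, 5)]"
    by (simp only: g36_def g25_def g13_def g10_def g1_def g0_def complementary_def pairs6_def calc_rules sort_rules cong: if_weak_cong)
  show "list_all (check (csg g36)) (filter (big (Suc 0) (rest [(2, 5), (3, 5), (4, 5)] pairs6))
    (picks (Suc 0) id6))"
    by (simp only: g36_csg check_rules calc_rules cong: if_weak_cong)
qed

lemma good3_2: "good (Suc 0) (pairs 6 - set [(2, 5), (3, 4), (4, 5)])"
proof (rule good_complementI)
  show "complementary g37 [(2, 5), (3, 4), (4, 5)]"
    by (simp only: g37_def g25_def g13_def g10_def g1_def g0_def complementary_def pairs6_def calc_rules sort_rules cong: if_weak_cong)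
  show "list_all (check (csg g37)) (filter (big (Suc 0) (rest [(2, 5), (3, 4), (4, 5)] pairs6))
    (picks (Suc 0) id6))"
    by (simp only: g37_csg check_rules calc_rules cong: if_weak_cong)
qed

lemma good3_3: "good (Suc 0) (pairs 6 - set [(1, 5), (2, 5), (3, 4)])"
proof (rule good_complementI)
  show "complementary g38 [(1, 5), (2, 5), (3, 4)]"
    by (simp only: g38_def g29_def g14_def g4_def g1_def g0_def complementary_def pairs6_def calc_rules sort_rules cong: if_weak_cong)
  show "list_all (check (csg g38)) (filter (big (Suc 0) (rest [(1, 5), (2, 5), (3, 4)] pairs6))
    (picks (Suc 0) id6))"
    by (simp only: g38_csg check_rules calc_rules cong: if_weak_cong)
qed

lemma good3_4: "good (Suc 0) (pairs 6 - set [(0, 2), (1, 5), (3, 4)])"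
proof (rule good_complementI)
  show "complementary g39 [(0, 2), (1, 5), (3, 4)]"
    by (simp only: g39_def g34_def g21_def g4_def g1_def g0_def complementary_def pairs6_def calc_rules sort_rules cong: if_weak_cong)
  show "list_all (check (csg g39)) (filter (big (Suc 0) (rest [(0, 2), (1, 5), (3, 4)] pairs6))
    (picks (Suc 0) id6))"
    by (simp only: g39_csg check_rules calc_rules cong: if_weak_cong)
qed

lemma good4_0: "good (Suc (Suc 0)) (pairs 6 - set [(2, 5), (3, 4), (3, 5), (4, 5)])"
proof (rule good_complementI)
  show "complementary g25 [(2, 5), (3, 4), (3, 5), (4, 5)]"
    by (simp only: g25_def g13_def g10_def g1_def g0_def complementary_def pairs6_def calc_rules sort_rules cong: if_weak_cong)
  show "list_all (check (csg g25)) (filter (big (Suc (Suc 0)) (rest [(2, 5), (3, 4), (3, 5), (4,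
    5)] pairs6)) (picks (Suc (Suc 0)) id6))"
    by (simp only: g25_csg check_rules calc_rules cong: if_weak_cong)
qed

lemma good4_1: "good (Suc (Suc 0)) (pairs 6 - set [(2, 4), (2, 5), (3, 4), (3, 5)])"
proof (rule good_complementI)
  show "complementary g26 [(2, 4), (2, 5), (3, 4), (3, 5)]"
    by (simp only: g26_def g13_def g10_def g1_def g0_def complementary_def pairs6_def calc_rules sort_rules cong: if_weak_cong)
  show "list_all (check (csg g26)) (filter (big (Suc (Suc 0)) (rest [(2, 4), (2, 5), (3, 4), (3,
    5)] pairs6)) (picks (Suc (Suc 0)) id6))"
    by (simp only: g26_csg check_rules calc_rules cong: if_weak_cong)
qed

lemma good4_2: "good (Suc (Suc 0)) (pairs 6 - set [(1, 5), (2, 5), (3, 5), (4, 5)])"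
proof (rule good_complementI)
  show "complementary g28 [(1, 5), (2, 5), (3, 5), (4, 5)]"
    by (simp only: g28_def g27_def g1_def g0_def complementary_def pairs6_def calc_rules sort_rules cong: if_weak_cong)
  show "list_all (check (csg g28)) (filter (big (Suc (Suc 0)) (rest [(1, 5), (2, 5), (3, 5), (4,
    5)] pairs6)) (picks (Suc (Suc 0)) id6))"
    by (simp only: g28_csg check_rules calc_rules cong: if_weak_cong)
qed

lemma good4_3: "good (Suc (Suc 0)) (pairs 6 - set [(1, 5), (2, 5), (3, 4), (4, 5)])"
proof (rule good_complementI)
  show "complementary g29 [(1, 5), (2, 5), (3, 4), (4, 5)]"
    by (simp only: g29_def g14_def g4_def g1_def g0_def complementary_def pairs6_def calc_rules sort_rules cong: if_weak_cong)
  show "list_all (check (csg g29)) (filter (big (Suc (Suc 0)) (rest [(1, 5), (2, 5), (3, 4), (4,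
    5)] pairs6)) (picks (Suc (Suc 0)) id6))"
    by (simp only: g29_csg check_rules calc_rules cong: if_weak_cong)
qed

lemma good4_4: "good (Suc (Suc 0)) (pairs 6 - set [(1, 5), (2, 4), (2, 5), (3, 4)])"
proof (rule good_complementI)
  show "complementary g30 [(1, 5), (2, 4), (2, 5), (3, 4)]"
    by (simp only: g30_def g14_def g4_def g1_def g0_def complementary_def pairs6_def calc_rules sort_rules cong: if_weak_cong)
  show "list_all (check (csg g30)) (filter (big (Suc (Suc 0)) (rest [(1, 5), (2, 4), (2, 5), (3,
    4)] pairs6)) (picks (Suc (Suc 0)) id6))"
    by (simp only: g30_csg check_rules calc_rules cong: if_weak_cong)
qed

lemma good4_5: "good (Suc (Suc 0)) (pairs 6 - set [(1, 2), (3, 4), (3, 5), (4, 5)])"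
proof (rule good_complementI)
  show "complementary g31 [(1, 2), (3, 4), (3, 5), (4, 5)]"
    by (simp only: g31_def g16_def g2_def g1_def g0_def complementary_def pairs6_def calc_rules sort_rules cong: if_weak_cong)
  show "list_all (check (csg g31)) (filter (big (Suc (Suc 0)) (rest [(1, 2), (3, 4), (3, 5), (4,
    5)] pairs6)) (picks (Suc (Suc 0)) id6))"
    by (simp only: g31_csg check_rules calc_rules cong: if_weak_cong)
qed

lemma good4_6: "good (Suc (Suc 0)) (pairs 6 - set [(0, 2), (1, 2), (2, 5), (3, 4)])"
proof (rule good_complementI)
  show "complementary g32 [(0, 2), (1, 2), (2, 5), (3, 4)]"
    by (simp only: g32_def g19_def g2_def g1_def g0_def complementary_def pairs6_def calc_rules sort_rules cong: if_weak_cong)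
  show "list_all (check (csg g32)) (filter (big (Suc (Suc 0)) (rest [(0, 2), (1, 2), (2, 5), (3,
    4)] pairs6)) (picks (Suc (Suc 0)) id6))"
    by (simp only: g32_csg check_rules calc_rules cong: if_weak_cong)
qed

lemma good4_7: "good (Suc (Suc 0)) (pairs 6 - set [(0, 2), (1, 2), (3, 5), (4, 5)])"
proof (rule good_complementI)
  show "complementary g33 [(0, 2), (1, 2), (3, 5), (4, 5)]"
    by (simp only: g33_def g18_def g2_def g1_def g0_def complementary_def pairs6_def calc_rules sort_rules cong: if_weak_cong)
  show "list_all (check (csg g33)) (filter (big (Suc (Suc 0)) (rest [(0, 2), (1, 2), (3, 5), (4,
    5)] pairs6)) (picks (Suc (Suc 0)) id6))"
    by (simp only: g33_csg check_rules calc_rules cong: if_weak_cong)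
qed

lemma good4_8: "good (Suc (Suc 0)) (pairs 6 - set [(0, 2), (1, 5), (2, 5), (3, 4)])"
proof (rule good_complementI)
  show "complementary g34 [(0, 2), (1, 5), (2, 5), (3, 4)]"
    by (simp only: g34_def g21_def g4_def g1_def g0_def complementary_def pairs6_def calc_rules sort_rules cong: if_weak_cong)
  show "list_all (check (csg g34)) (filter (big (Suc (Suc 0)) (rest [(0, 2), (1, 5), (2, 5), (3,
    4)] pairs6)) (picks (Suc (Suc 0)) id6))"
    by (simp only: g34_csg check_rules calc_rules cong: if_weak_cong)
qed

lemma good5_0: "good (Suc (Suc (Suc 0))) (pairs 6 - set [(2, 4), (2, 5), (3, 4), (3, 5), (4, 5)])"
proof (rule good_complementI)
  show "complementary g13 [(2, 4), (2, 5), (3, 4), (3, 5), (4, 5)]"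
    by (simp only: g13_def g10_def g1_def g0_def complementary_def pairs6_def calc_rules sort_rules cong: if_weak_cong)
  show "list_all (check (csg g13)) (filter (big (Suc (Suc (Suc 0))) (rest [(2, 4), (2, 5), (3, 4),
    (3, 5), (4, 5)] pairs6)) (picks (Suc (Suc (Suc 0))) id6))"
    by (simp only: g13_csg check_rules calc_rules cong: if_weak_cong)
qed

text \<open>Vertex 5 has degree 1 here, so even with the new vertex it cannot reach degree 3. The
  filtered list of neighbourhoods is empty and \<open>csg\<close> is never evaluated.\<close>

lemma good5_1: "good (Suc (Suc (Suc 0))) (pairs 6 - set [(1, 5), (2, 5), (3, 4), (3, 5), (4, 5)])"
proof (rule good_complementI)
  show "complementary [(0, 1), (0, 2), (0, 3), (0, 4), (0, 5), (1, 2), (1, 3), (1, 4), (2, 3), (2,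
    4)] [(1, 5), (2, 5), (3, 4), (3, 5), (4, 5)]"
    by (simp only: complementary_def pairs6_def calc_rules sort_rules cong: if_weak_cong)
  show "list_all (check (csg [(0, 1), (0, 2), (0, 3), (0, 4), (0, 5), (1, 2), (1, 3), (1, 4), (2,
    3), (2, 4)])) (filter (big (Suc (Suc (Suc 0))) (rest [(1, 5), (2, 5), (3, 4), (3, 5), (4, 5)]
    pairs6)) (picks (Suc (Suc (Suc 0))) id6))"
    by (simp only: check_rules calc_rules cong: if_weak_cong)
qed

lemma good5_2: "good (Suc (Suc (Suc 0))) (pairs 6 - set [(1, 5), (2, 4), (2, 5), (3, 4), (4, 5)])"
proof (rule good_complementI)
  show "complementary g14 [(1, 5), (2, 4), (2, 5), (3, 4), (4, 5)]"
    by (simp only: g14_def g4_def g1_def g0_def complementary_def pairs6_def calc_rules sort_rules cong: if_weak_cong)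
  show "list_all (check (csg g14)) (filter (big (Suc (Suc (Suc 0))) (rest [(1, 5), (2, 4), (2, 5),
    (3, 4), (4, 5)] pairs6)) (picks (Suc (Suc (Suc 0))) id6))"
    by (simp only: g14_csg check_rules calc_rules cong: if_weak_cong)
qed

lemma good5_3: "good (Suc (Suc (Suc 0))) (pairs 6 - set [(1, 2), (1, 5), (2, 4), (3, 5), (4, 5)])"
proof (rule good_complementI)
  show "complementary g15 [(1, 2), (1, 5), (2, 4), (3, 5), (4, 5)]"
    by (simp only: g15_def g3_def g1_def g0_def complementary_def pairs6_def calc_rules sort_rules cong: if_weak_cong)
  show "list_all (check (csg g15)) (filter (big (Suc (Suc (Suc 0))) (rest [(1, 2), (1, 5), (2, 4),
    (3, 5), (4, 5)] pairs6)) (picks (Suc (Suc (Suc 0))) id6))"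
    by (simp only: g15_csg check_rules calc_rules cong: if_weak_cong)
qed

lemma good5_4: "good (Suc (Suc (Suc 0))) (pairs 6 - set [(1, 2), (2, 5), (3, 4), (3, 5), (4, 5)])"
proof (rule good_complementI)
  show "complementary g16 [(1, 2), (2, 5), (3, 4), (3, 5), (4, 5)]"
    by (simp only: g16_def g2_def g1_def g0_def complementary_def pairs6_def calc_rules sort_rules cong: if_weak_cong)
  show "list_all (check (csg g16)) (filter (big (Suc (Suc (Suc 0))) (rest [(1, 2), (2, 5), (3, 4),
    (3, 5), (4, 5)] pairs6)) (picks (Suc (Suc (Suc 0))) id6))"
    by (simp only: g16_csg check_rules calc_rules cong: if_weak_cong)
qed

lemma good5_5: "good (Suc (Suc (Suc 0))) (pairs 6 - set [(1, 2), (1, 5), (2, 4), (3, 4), (3, 5)])"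
proof (rule good_complementI)
  show "complementary g17 [(1, 2), (1, 5), (2, 4), (3, 4), (3, 5)]"
    by (simp only: g17_def g7_def g1_def g0_def complementary_def pairs6_def calc_rules sort_rules cong: if_weak_cong)
  show "list_all (check (csg g17)) (filter (big (Suc (Suc (Suc 0))) (rest [(1, 2), (1, 5), (2, 4),
    (3, 4), (3, 5)] pairs6)) (picks (Suc (Suc (Suc 0))) id6))"
    by (simp only: g17_csg check_rules calc_rules cong: if_weak_cong)
qed

text \<open>Empty for the same reason: vertex 5 is isolated.\<close>

lemma good5_6: "good (Suc (Suc (Suc 0))) (pairs 6 - set [(0, 5), (1, 5), (2, 5), (3, 5), (4, 5)])"
proof (rule good_complementI)
  show "complementary [(0, 1), (0, 2), (0, 3), (0, 4), (1, 2), (1, 3), (1, 4), (2, 3), (2, 4), (3,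
    4)] [(0, 5), (1, 5), (2, 5), (3, 5), (4, 5)]"
    by (simp only: complementary_def pairs6_def calc_rules sort_rules cong: if_weak_cong)
  show "list_all (check (csg [(0, 1), (0, 2), (0, 3), (0, 4), (1, 2), (1, 3), (1, 4), (2, 3), (2,
    4), (3, 4)])) (filter (big (Suc (Suc (Suc 0))) (rest [(0, 5), (1, 5), (2, 5), (3, 5), (4, 5)]
    pairs6)) (picks (Suc (Suc (Suc 0))) id6))"
    by (simp only: check_rules calc_rules cong: if_weak_cong)
qed

text \<open>Again no admissible neighbourhood: the only neighbour of vertex 5 is 3.\<close>

lemma good5_7: "good (Suc (Suc (Suc 0))) (pairs 6 - set [(0, 5), (1, 5), (2, 5), (3, 4), (4, 5)])"
proof (rule good_complementI)
  show "complementary [(0, 1), (0, 2), (0, 3), (0, 4), (1, 2), (1, 3), (1, 4), (2, 3), (2, 4), (3,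
    5)] [(0, 5), (1, 5), (2, 5), (3, 4), (4, 5)]"
    by (simp only: complementary_def pairs6_def calc_rules sort_rules cong: if_weak_cong)
  show "list_all (check (csg [(0, 1), (0, 2), (0, 3), (0, 4), (1, 2), (1, 3), (1, 4), (2, 3), (2,
    4), (3, 5)])) (filter (big (Suc (Suc (Suc 0))) (rest [(0, 5), (1, 5), (2, 5), (3, 4), (4, 5)]
    pairs6)) (picks (Suc (Suc (Suc 0))) id6))"
    by (simp only: check_rules calc_rules cong: if_weak_cong)
qed

lemma good5_8: "good (Suc (Suc (Suc 0))) (pairs 6 - set [(0, 2), (1, 2), (2, 5), (3, 5), (4, 5)])"
proof (rule good_complementI)
  show "complementary g18 [(0, 2), (1, 2), (2, 5), (3, 5), (4, 5)]"
    by (simp only: g18_def g2_def g1_def g0_def complementary_def pairs6_def calc_rules sort_rules cong: if_weak_cong)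
  show "list_all (check (csg g18)) (filter (big (Suc (Suc (Suc 0))) (rest [(0, 2), (1, 2), (2, 5),
    (3, 5), (4, 5)] pairs6)) (picks (Suc (Suc (Suc 0))) id6))"
    by (simp only: g18_csg check_rules calc_rules cong: if_weak_cong)
qed

lemma good5_9: "good (Suc (Suc (Suc 0))) (pairs 6 - set [(0, 2), (1, 2), (2, 5), (3, 4), (4, 5)])"
proof (rule good_complementI)
  show "complementary g19 [(0, 2), (1, 2), (2, 5), (3, 4), (4, 5)]"
    by (simp only: g19_def g2_def g1_def g0_def complementary_def pairs6_def calc_rules sort_rules cong: if_weak_cong)
  show "list_all (check (csg g19)) (filter (big (Suc (Suc (Suc 0))) (rest [(0, 2), (1, 2), (2, 5),
    (3, 4), (4, 5)] pairs6)) (picks (Suc (Suc (Suc 0))) id6))"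
    by (simp only: g19_csg check_rules calc_rules cong: if_weak_cong)
qed

lemma good5_10: "good (Suc (Suc (Suc 0))) (pairs 6 - set [(0, 2), (1, 2), (3, 4), (3, 5), (4,
    5)])"
proof (rule good_complementI)
  show "complementary g20 [(0, 2), (1, 2), (3, 4), (3, 5), (4, 5)]"
    by (simp only: g20_def g2_def g1_def g0_def complementary_def pairs6_def calc_rules sort_rules cong: if_weak_cong)
  show "list_all (check (csg g20)) (filter (big (Suc (Suc (Suc 0))) (rest [(0, 2), (1, 2), (3, 4),
    (3, 5), (4, 5)] pairs6)) (picks (Suc (Suc (Suc 0))) id6))"
    by (simp only: g20_csg check_rules calc_rules cong: if_weak_cong)
qed

lemma good5_11: "good (Suc (Suc (Suc 0))) (pairs 6 - set [(0, 2), (1, 5), (2, 4), (2, 5), (3,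
    4)])"
proof (rule good_complementI)
  show "complementary g21 [(0, 2), (1, 5), (2, 4), (2, 5), (3, 4)]"
    by (simp only: g21_def g4_def g1_def g0_def complementary_def pairs6_def calc_rules sort_rules cong: if_weak_cong)
  show "list_all (check (csg g21)) (filter (big (Suc (Suc (Suc 0))) (rest [(0, 2), (1, 5), (2, 4),
    (2, 5), (3, 4)] pairs6)) (picks (Suc (Suc (Suc 0))) id6))"
    by (simp only: g21_csg check_rules calc_rules cong: if_weak_cong)
qed

lemma good5_12: "good (Suc (Suc (Suc 0))) (pairs 6 - set [(0, 2), (1, 2), (1, 5), (2, 5), (3,
    4)])"
proof (rule good_complementI)
  show "complementary g22 [(0, 2), (1, 2), (1, 5), (2, 5), (3, 4)]"
    by (simp only: g22_def g6_def g1_def g0_def complementary_def pairs6_def calc_rules sort_rules cong: if_weak_cong)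
  show "list_all (check (csg g22)) (filter (big (Suc (Suc (Suc 0))) (rest [(0, 2), (1, 2), (1, 5),
    (2, 5), (3, 4)] pairs6)) (picks (Suc (Suc (Suc 0))) id6))"
    by (simp only: g22_csg check_rules calc_rules cong: if_weak_cong)
qed

lemma good5_13: "good (Suc (Suc (Suc 0))) (pairs 6 - set [(0, 2), (1, 5), (2, 4), (3, 4), (3,
    5)])"
proof (rule good_complementI)
  show "complementary g23 [(0, 2), (1, 5), (2, 4), (3, 4), (3, 5)]"
    by (simp only: g23_def g5_def g1_def g0_def complementary_def pairs6_def calc_rules sort_rules cong: if_weak_cong)
  show "list_all (check (csg g23)) (filter (big (Suc (Suc (Suc 0))) (rest [(0, 2), (1, 5), (2, 4),
    (3, 4), (3, 5)] pairs6)) (picks (Suc (Suc (Suc 0))) id6))"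
    by (simp only: g23_csg check_rules calc_rules cong: if_weak_cong)
qed

lemma good5_14: "good (Suc (Suc (Suc 0))) (pairs 6 - set [(0, 1), (2, 4), (2, 5), (3, 4), (3,
    5)])"
proof (rule good_complementI)
  show "complementary g24 [(0, 1), (2, 4), (2, 5), (3, 4), (3, 5)]"
    by (simp only: g24_def g9_def g1_def g0_def complementary_def pairs6_def calc_rules sort_rules cong: if_weak_cong)
  show "list_all (check (csg g24)) (filter (big (Suc (Suc (Suc 0))) (rest [(0, 1), (2, 4), (2, 5),
    (3, 4), (3, 5)] pairs6)) (picks (Suc (Suc (Suc 0))) id6))"
    by (simp only: g24_csg check_rules calc_rules cong: if_weak_cong)
qed

text \<open>Vertex 0 has degree 5, more than the 4 allowed in a regular graph, so no choice of
  neighbourhoods passes the filter and \<open>csg\<close> stays unevaluated. The same holds for the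
  next five types.\<close>

lemma good6_0: "good_regular (pairs 6 - set [(2, 3), (2, 4), (2, 5), (3, 4), (3, 5), (4, 5)])"
proof (rule good_regular_complementI)
  show "complementary [(0, 1), (0, 2), (0, 3), (0, 4), (0, 5), (1, 2), (1, 3), (1, 4), (1, 5)]
    [(2, 3), (2, 4), (2, 5), (3, 4), (3, 5), (4, 5)]"
    by (simp only: complementary_def pairs6_def calc_rules sort_rules cong: if_weak_cong)
  show "list_all (check_regular (csg [(0, 1), (0, 2), (0, 3), (0, 4), (0, 5), (1, 2), (1, 3), (1,
    4), (1, 5)]) (rest [(2, 3), (2, 4), (2, 5), (3, 4), (3, 5), (4, 5)] pairs6)) (picks (Suc (Suc
    (Suc 0))) id6)"
    by (simp only: check_rules calc_rules cong: if_weak_cong)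
qed

lemma good6_1: "good_regular (pairs 6 - set [(1, 5), (2, 4), (2, 5), (3, 4), (3, 5), (4, 5)])"
proof (rule good_regular_complementI)
  show "complementary [(0, 1), (0, 2), (0, 3), (0, 4), (0, 5), (1, 2), (1, 3), (1, 4), (2, 3)]
    [(1, 5), (2, 4), (2, 5), (3, 4), (3, 5), (4, 5)]"
    by (simp only: complementary_def pairs6_def calc_rules sort_rules cong: if_weak_cong)
  show "list_all (check_regular (csg [(0, 1), (0, 2), (0, 3), (0, 4), (0, 5), (1, 2), (1, 3), (1,
    4), (2, 3)]) (rest [(1, 5), (2, 4), (2, 5), (3, 4), (3, 5), (4, 5)] pairs6)) (picks (Suc (Suc
    (Suc 0))) id6)"
    by (simp only: check_rules calc_rules cong: if_weak_cong)
qed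

lemma good6_2: "good_regular (pairs 6 - set [(1, 5), (2, 3), (2, 4), (3, 4), (3, 5), (4, 5)])"
proof (rule good_regular_complementI)
  show "complementary [(0, 1), (0, 2), (0, 3), (0, 4), (0, 5), (1, 2), (1, 3), (1, 4), (2, 5)]
    [(1, 5), (2, 3), (2, 4), (3, 4), (3, 5), (4, 5)]"
    by (simp only: complementary_def pairs6_def calc_rules sort_rules cong: if_weak_cong)
  show "list_all (check_regular (csg [(0, 1), (0, 2), (0, 3), (0, 4), (0, 5), (1, 2), (1, 3), (1,
    4), (2, 5)]) (rest [(1, 5), (2, 3), (2, 4), (3, 4), (3, 5), (4, 5)] pairs6)) (picks (Suc (Suc
    (Suc 0))) id6)"
    by (simp only: check_rules calc_rules cong: if_weak_cong)
qed

lemma good6_3: "good_regular (pairs 6 - set [(1, 4), (1, 5), (2, 4), (2, 5), (3, 4), (3, 5)])"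
proof (rule good_regular_complementI)
  show "complementary [(0, 1), (0, 2), (0, 3), (0, 4), (0, 5), (1, 2), (1, 3), (2, 3), (4, 5)]
    [(1, 4), (1, 5), (2, 4), (2, 5), (3, 4), (3, 5)]"
    by (simp only: complementary_def pairs6_def calc_rules sort_rules cong: if_weak_cong)
  show "list_all (check_regular (csg [(0, 1), (0, 2), (0, 3), (0, 4), (0, 5), (1, 2), (1, 3), (2,
    3), (4, 5)]) (rest [(1, 4), (1, 5), (2, 4), (2, 5), (3, 4), (3, 5)] pairs6)) (picks (Suc (Suc
    (Suc 0))) id6)"
    by (simp only: check_rules calc_rules cong: if_weak_cong)
qed

lemma good6_4: "good_regular (pairs 6 - set [(1, 4), (1, 5), (2, 3), (2, 5), (3, 5), (4, 5)])"
proof (rule good_regular_complementI)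
  show "complementary [(0, 1), (0, 2), (0, 3), (0, 4), (0, 5), (1, 2), (1, 3), (2, 4), (3, 4)]
    [(1, 4), (1, 5), (2, 3), (2, 5), (3, 5), (4, 5)]"
    by (simp only: complementary_def pairs6_def calc_rules sort_rules cong: if_weak_cong)
  show "list_all (check_regular (csg [(0, 1), (0, 2), (0, 3), (0, 4), (0, 5), (1, 2), (1, 3), (2,
    4), (3, 4)]) (rest [(1, 4), (1, 5), (2, 3), (2, 5), (3, 5), (4, 5)] pairs6)) (picks (Suc (Suc
    (Suc 0))) id6)"
    by (simp only: check_rules calc_rules cong: if_weak_cong)
qed

lemma good6_5: "good_regular (pairs 6 - set [(1, 4), (1, 5), (2, 3), (2, 5), (3, 4), (4, 5)])"
proof (rule good_regular_complementI)
  show "complementary [(0, 1), (0, 2), (0, 3), (0, 4), (0, 5), (1, 2), (1, 3), (2, 4), (3, 5)]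
    [(1, 4), (1, 5), (2, 3), (2, 5), (3, 4), (4, 5)]"
    by (simp only: complementary_def pairs6_def calc_rules sort_rules cong: if_weak_cong)
  show "list_all (check_regular (csg [(0, 1), (0, 2), (0, 3), (0, 4), (0, 5), (1, 2), (1, 3), (2,
    4), (3, 5)]) (rest [(1, 4), (1, 5), (2, 3), (2, 5), (3, 4), (4, 5)] pairs6)) (picks (Suc (Suc
    (Suc 0))) id6)"
    by (simp only: check_rules calc_rules cong: if_weak_cong)
qed

text \<open>Here the obstruction is a low degree: vertex 5 is isolated, and two new edges cannot
  bring it to 4. In the next two types it has degree 1, which is still too small.\<close>

lemma good6_6: "good_regular (pairs 6 - set [(0, 5), (1, 5), (2, 5), (3, 4), (3, 5), (4, 5)])"
proof (rule good_regular_complementI)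
  show "complementary [(0, 1), (0, 2), (0, 3), (0, 4), (1, 2), (1, 3), (1, 4), (2, 3), (2, 4)]
    [(0, 5), (1, 5), (2, 5), (3, 4), (3, 5), (4, 5)]"
    by (simp only: complementary_def pairs6_def calc_rules sort_rules cong: if_weak_cong)
  show "list_all (check_regular (csg [(0, 1), (0, 2), (0, 3), (0, 4), (1, 2), (1, 3), (1, 4), (2,
    3), (2, 4)]) (rest [(0, 5), (1, 5), (2, 5), (3, 4), (3, 5), (4, 5)] pairs6)) (picks (Suc (Suc
    (Suc 0))) id6)"
    by (simp only: check_rules calc_rules cong: if_weak_cong)
qed

lemma good6_7: "good_regular (pairs 6 - set [(0, 5), (1, 5), (2, 4), (3, 4), (3, 5), (4, 5)])"
proof (rule good_regular_complementI)
  show "complementary [(0, 1), (0, 2), (0, 3), (0, 4), (1, 2), (1, 3), (1, 4), (2, 3), (2, 5)]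
    [(0, 5), (1, 5), (2, 4), (3, 4), (3, 5), (4, 5)]"
    by (simp only: complementary_def pairs6_def calc_rules sort_rules cong: if_weak_cong)
  show "list_all (check_regular (csg [(0, 1), (0, 2), (0, 3), (0, 4), (1, 2), (1, 3), (1, 4), (2,
    3), (2, 5)]) (rest [(0, 5), (1, 5), (2, 4), (3, 4), (3, 5), (4, 5)] pairs6)) (picks (Suc (Suc
    (Suc 0))) id6)"
    by (simp only: check_rules calc_rules cong: if_weak_cong)
qed

lemma good6_8: "good_regular (pairs 6 - set [(0, 5), (1, 5), (2, 4), (2, 5), (3, 4), (3, 5)])"
proof (rule good_regular_complementI)
  show "complementary [(0, 1), (0, 2), (0, 3), (0, 4), (1, 2), (1, 3), (1, 4), (2, 3), (4, 5)]
    [(0, 5), (1, 5), (2, 4), (2, 5), (3, 4), (3, 5)]"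
    by (simp only: complementary_def pairs6_def calc_rules sort_rules cong: if_weak_cong)
  show "list_all (check_regular (csg [(0, 1), (0, 2), (0, 3), (0, 4), (1, 2), (1, 3), (1, 4), (2,
    3), (4, 5)]) (rest [(0, 5), (1, 5), (2, 4), (2, 5), (3, 4), (3, 5)] pairs6)) (picks (Suc (Suc
    (Suc 0))) id6)"
    by (simp only: check_rules calc_rules cong: if_weak_cong)
qed

lemma good6_9: "good_regular (pairs 6 - set [(0, 2), (1, 2), (2, 5), (3, 4), (3, 5), (4, 5)])"
proof (rule good_regular_complementI)
  show "complementary g2 [(0, 2), (1, 2), (2, 5), (3, 4), (3, 5), (4, 5)]"
    by (simp only: g2_def g1_def g0_def complementary_def pairs6_def calc_rules sort_rules cong: if_weak_cong)
  show "list_all (check_regular (csg g2) (rest [(0, 2), (1, 2), (2, 5), (3, 4), (3, 5), (4, 5)]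
    pairs6)) (picks (Suc (Suc (Suc 0))) id6)"
    by (simp only: g2_csg check_rules calc_rules cong: if_weak_cong)
qed

lemma good6_10: "good_regular (pairs 6 - set [(0, 2), (1, 2), (1, 5), (2, 4), (3, 5), (4, 5)])"
proof (rule good_regular_complementI)
  show "complementary g3 [(0, 2), (1, 2), (1, 5), (2, 4), (3, 5), (4, 5)]"
    by (simp only: g3_def g1_def g0_def complementary_def pairs6_def calc_rules sort_rules cong: if_weak_cong)
  show "list_all (check_regular (csg g3) (rest [(0, 2), (1, 2), (1, 5), (2, 4), (3, 5), (4, 5)]
    pairs6)) (picks (Suc (Suc (Suc 0))) id6)"
    by (simp only: g3_csg check_rules calc_rules cong: if_weak_cong)
qed

lemma good6_11: "good_regular (pairs 6 - set [(0, 2), (1, 5), (2, 4), (2, 5), (3, 4), (4, 5)])"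
proof (rule good_regular_complementI)
  show "complementary g4 [(0, 2), (1, 5), (2, 4), (2, 5), (3, 4), (4, 5)]"
    by (simp only: g4_def g1_def g0_def complementary_def pairs6_def calc_rules sort_rules cong: if_weak_cong)
  show "list_all (check_regular (csg g4) (rest [(0, 2), (1, 5), (2, 4), (2, 5), (3, 4), (4, 5)]
    pairs6)) (picks (Suc (Suc (Suc 0))) id6)"
    by (simp only: g4_csg check_rules calc_rules cong: if_weak_cong)
qed

text \<open>No admissible neighbourhoods: vertex 5 is adjacent only to 1 and reaches degree at most
  3.\<close>

lemma good6_12: "good_regular (pairs 6 - set [(0, 5), (1, 4), (2, 3), (2, 5), (3, 5), (4, 5)])"
proof (rule good_regular_complementI)
  show "complementary [(0, 1), (0, 2), (0, 3), (0, 4), (1, 2), (1, 3), (1, 5), (2, 4), (3, 4)]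
    [(0, 5), (1, 4), (2, 3), (2, 5), (3, 5), (4, 5)]"
    by (simp only: complementary_def pairs6_def calc_rules sort_rules cong: if_weak_cong)
  show "list_all (check_regular (csg [(0, 1), (0, 2), (0, 3), (0, 4), (1, 2), (1, 3), (1, 5), (2,
    4), (3, 4)]) (rest [(0, 5), (1, 4), (2, 3), (2, 5), (3, 5), (4, 5)] pairs6)) (picks (Suc (Suc
    (Suc 0))) id6)"
    by (simp only: check_rules calc_rules cong: if_weak_cong)
qed

lemma good6_13: "good_regular (pairs 6 - set [(0, 2), (1, 5), (2, 4), (2, 5), (3, 4), (3, 5)])"
proof (rule good_regular_complementI)
  show "complementary g5 [(0, 2), (1, 5), (2, 4), (2, 5), (3, 4), (3, 5)]"
    by (simp only: g5_def g1_def g0_def complementary_def pairs6_def calc_rules sort_rules cong: if_weak_cong)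
  show "list_all (check_regular (csg g5) (rest [(0, 2), (1, 5), (2, 4), (2, 5), (3, 4), (3, 5)]
    pairs6)) (picks (Suc (Suc (Suc 0))) id6)"
    by (simp only: g5_csg check_rules calc_rules cong: if_weak_cong)
qed

lemma good6_14: "good_regular (pairs 6 - set [(0, 2), (1, 2), (1, 5), (2, 5), (3, 4), (4, 5)])"
proof (rule good_regular_complementI)
  show "complementary g6 [(0, 2), (1, 2), (1, 5), (2, 5), (3, 4), (4, 5)]"
    by (simp only: g6_def g1_def g0_def complementary_def pairs6_def calc_rules sort_rules cong: if_weak_cong)
  show "list_all (check_regular (csg g6) (rest [(0, 2), (1, 2), (1, 5), (2, 5), (3, 4), (4, 5)]
    pairs6)) (picks (Suc (Suc (Suc 0))) id6)"
    by (simp only: g6_csg check_rules calc_rules cong: if_weak_cong)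
qed

lemma good6_15: "good_regular (pairs 6 - set [(0, 2), (1, 2), (1, 5), (2, 4), (3, 4), (3, 5)])"
proof (rule good_regular_complementI)
  show "complementary g7 [(0, 2), (1, 2), (1, 5), (2, 4), (3, 4), (3, 5)]"
    by (simp only: g7_def g1_def g0_def complementary_def pairs6_def calc_rules sort_rules cong: if_weak_cong)
  show "list_all (check_regular (csg g7) (rest [(0, 2), (1, 2), (1, 5), (2, 4), (3, 4), (3, 5)]
    pairs6)) (picks (Suc (Suc (Suc 0))) id6)"
    by (simp only: g7_csg check_rules calc_rules cong: if_weak_cong)
qed

lemma good6_16: "good_regular (pairs 6 - set [(0, 2), (1, 2), (1, 5), (3, 4), (3, 5), (4, 5)])"
proof (rule good_regular_complementI)
  show "complementary g8 [(0, 2), (1, 2), (1, 5), (3, 4), (3, 5), (4, 5)]"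
    by (simp only: g8_def g1_def g0_def complementary_def pairs6_def calc_rules sort_rules cong: if_weak_cong)
  show "list_all (check_regular (csg g8) (rest [(0, 2), (1, 2), (1, 5), (3, 4), (3, 5), (4, 5)]
    pairs6)) (picks (Suc (Suc (Suc 0))) id6)"
    by (simp only: g8_csg check_rules calc_rules cong: if_weak_cong)
qed

lemma good6_17: "good_regular (pairs 6 - set [(0, 1), (1, 5), (2, 4), (2, 5), (3, 4), (3, 5)])"
proof (rule good_regular_complementI)
  show "complementary g9 [(0, 1), (1, 5), (2, 4), (2, 5), (3, 4), (3, 5)]"
    by (simp only: g9_def g1_def g0_def complementary_def pairs6_def calc_rules sort_rules cong: if_weak_cong)
  show "list_all (check_regular (csg g9) (rest [(0, 1), (1, 5), (2, 4), (2, 5), (3, 4), (3, 5)]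
    pairs6)) (picks (Suc (Suc (Suc 0))) id6)"
    by (simp only: g9_csg check_rules calc_rules cong: if_weak_cong)
qed

lemma good6_18: "good_regular (pairs 6 - set [(0, 1), (2, 4), (2, 5), (3, 4), (3, 5), (4, 5)])"
proof (rule good_regular_complementI)
  show "complementary g10 [(0, 1), (2, 4), (2, 5), (3, 4), (3, 5), (4, 5)]"
    by (simp only: g10_def g1_def g0_def complementary_def pairs6_def calc_rules sort_rules cong: if_weak_cong)
  show "list_all (check_regular (csg g10) (rest [(0, 1), (2, 4), (2, 5), (3, 4), (3, 5), (4, 5)]
    pairs6)) (picks (Suc (Suc (Suc 0))) id6)"
    by (simp only: g10_csg check_rules calc_rules cong: if_weak_cong)
qed

lemma good6_19: "good_regular (pairs 6 - set [(0, 1), (0, 2), (1, 5), (2, 4), (3, 4), (3, 5)])"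
proof (rule good_regular_complementI)
  show "complementary g11 [(0, 1), (0, 2), (1, 5), (2, 4), (3, 4), (3, 5)]"
    by (simp only: g11_def g1_def g0_def complementary_def pairs6_def calc_rules sort_rules cong: if_weak_cong)
  show "list_all (check_regular (csg g11) (rest [(0, 1), (0, 2), (1, 5), (2, 4), (3, 4), (3, 5)]
    pairs6)) (picks (Suc (Suc (Suc 0))) id6)"
    by (simp only: g11_csg check_rules calc_rules cong: if_weak_cong)
qed

text \<open>The non-edges form two disjoint triangles, so the graph is K_{3,3}; this is where
  K_{4,4} itself is met and the bound is attained.\<close>

lemma good6_20: "good_regular (pairs 6 - set [(0, 1), (0, 2), (1, 2), (3, 4), (3, 5), (4, 5)])"
proof (rule good_regular_complementI)
  show "complementary g12 [(0, 1), (0, 2), (1, 2), (3, 4), (3, 5), (4, 5)]"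
    by (simp only: g12_def g1_def g0_def complementary_def pairs6_def calc_rules sort_rules cong: if_weak_cong)
  show "list_all (check_regular (csg g12) (rest [(0, 1), (0, 2), (1, 2), (3, 4), (3, 5), (4, 5)]
    pairs6)) (picks (Suc (Suc (Suc 0))) id6)"
    by (simp only: g12_csg check_rules calc_rules cong: if_weak_cong)
qed

section \<open>Completeness of the lists of types\<close>

lemmas grow_rules = grows_def grow.simps is_perm_def lrelabel_def pairs6_def id6_def list.pred_inject

lemma covers_0: "covers (map fst grow0) 0"
  unfolding covers_def
proof (intro allI impI; elim conjE)
  fix C :: "(nat \<times> nat) set" assume "C \<subseteq> pairs 6" "card C = 0"
  then have "C = {}" using finite_subset[OF _ finite_pairs] by auto
  then show "\<exists>p r. p permutes {..<6} \<and> r \<in> set (map fst grow0) \<and> relabel p ` C = set r"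
    using permutes_id by (intro exI[of _ id] exI[of _ "[]"]) (auto simp: grow0_def)
qed

lemma covers_1: "covers (map fst grow1) 1"
proof -
  have "list_all (grows (map fst grow1)) grow0"
    by (simp only: grow0_def grow1_def grow_rules sort_rules calc_rules cong: if_weak_cong)
  from covers_Suc[OF covers_0 this] show ?thesis by (simp add: numeral_eq_Suc)
qed

lemma covers_2: "covers (map fst grow2) 2"
proof -
  have "list_all (grows (map fst grow2)) grow1"
    by (simp only: grow1_def grow2_def grow_rules sort_rules calc_rules cong: if_weak_cong)
  from covers_Suc[OF covers_1 this] show ?thesis by (simp add: numeral_eq_Suc)
qed

lemma covers_3: "covers (map fst grow3) 3"
proof -
  have "list_all (grows (map fst grow3)) grow2"
    by (simp only: grow2_def grow3_def grow_rules sort_rules calc_rules cong: if_weak_cong)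
  from covers_Suc[OF covers_2 this] show ?thesis by (simp add: numeral_eq_Suc)
qed

lemma covers_4: "covers (map fst grow4) 4"
proof -
  have "list_all (grows (map fst grow4)) grow3"
    by (simp only: grow3_def grow4_def grow_rules sort_rules calc_rules cong: if_weak_cong)
  from covers_Suc[OF covers_3 this] show ?thesis by (simp add: numeral_eq_Suc)
qed

lemma covers_5: "covers (map fst grow5) 5"
proof -
  have "list_all (grows (map fst grow5)) grow4"
    by (simp only: grow4_def grow5_def grow_rules sort_rules calc_rules cong: if_weak_cong)
  from covers_Suc[OF covers_4 this] show ?thesis by (simp add: numeral_eq_Suc)
qed

lemma covers_6: "covers reps6 6"
proof -
  have "list_all (grows reps6) grow5"
    by (simp only: grow5_def reps6_def grow_rules sort_rules calc_rules cong: if_weak_cong)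
  from covers_Suc[OF covers_5 this] show ?thesis by (simp add: numeral_eq_Suc)
qed


section \<open>From the listed types to all graphs on six vertices\<close>

lemma good_of_covers:
  assumes R: "covers R k" and g: "\<And>r. r \<in> set R \<Longrightarrow> good d (pairs 6 - set r)"
    and J: "J \<subseteq> pairs 6" "card J + k = 15"
  shows "good d J"
proof -
  obtain p r where p: "p permutes {..<6}" "r \<in> set R" "relabel p ` J = pairs 6 - set r"
    using covers_complement[OF R J] .
  show ?thesis using g[OF p(2)] good_relabel[OF p(1) J(1)] p(3) by simp
qed

lemma good_regular_of_covers:
  assumes R: "covers R k" and g: "\<And>r. r \<in> set R \<Longrightarrow> good_regular (pairs 6 - set r)"
    and K: "K \<subseteq> pairs 6" "card K + k = 15"
  shows "good_regular K"
proof -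
  obtain p r where p: "p permutes {..<6}" "r \<in> set R" "relabel p ` K = pairs 6 - set r"
    using covers_complement[OF R K] .
  show ?thesis using g[OF p(2)] good_regular_relabel[OF p(1) K(1)] p(3) by simp
qed

lemma good2: "r \<in> set (map fst grow2) \<Longrightarrow> good 0 (pairs 6 - set r)"
proof -
  have "list_all (\<lambda>r. good 0 (pairs 6 - set r)) (map fst grow2)"
    by (simp only: grow2_def list.map fst_conv list.pred_inject simp_thms good2_0 good2_1)
  then show "r \<in> set (map fst grow2) \<Longrightarrow> good 0 (pairs 6 - set r)"
    unfolding list_all_iff by blast
qed

lemma good3: "r \<in> set (map fst grow3) \<Longrightarrow> good (Suc 0) (pairs 6 - set r)"
proof -
  have "list_all (\<lambda>r. good (Suc 0) (pairs 6 - set r)) (map fst grow3)"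
    by (simp only: grow3_def list.map fst_conv list.pred_inject simp_thms good3_0 good3_1 good3_2
      good3_3 good3_4)
  then show "r \<in> set (map fst grow3) \<Longrightarrow> good (Suc 0) (pairs 6 - set r)"
    unfolding list_all_iff by blast
qed

lemma good4: "r \<in> set (map fst grow4) \<Longrightarrow> good (Suc (Suc 0)) (pairs 6 - set r)"
proof -
  have "list_all (\<lambda>r. good (Suc (Suc 0)) (pairs 6 - set r)) (map fst grow4)"
    by (simp only: grow4_def list.map fst_conv list.pred_inject simp_thms good4_0 good4_1 good4_2
      good4_3 good4_4 good4_5 good4_6 good4_7 good4_8)
  then show "r \<in> set (map fst grow4) \<Longrightarrow> good (Suc (Suc 0)) (pairs 6 - set r)"
    unfolding list_all_iff by blast
qed

lemma good5: "r \<in> set (map fst grow5) \<Longrightarrow> good (Suc (Suc (Suc 0))) (pairs 6 - set r)"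
proof -
  have "list_all (\<lambda>r. good (Suc (Suc (Suc 0))) (pairs 6 - set r)) (map fst grow5)"
    by (simp only: grow5_def list.map fst_conv list.pred_inject simp_thms good5_0 good5_1 good5_2
      good5_3 good5_4 good5_5 good5_6 good5_7 good5_8 good5_9 good5_10 good5_11 good5_12 good5_13
      good5_14)
  then show "r \<in> set (map fst grow5) \<Longrightarrow> good (Suc (Suc (Suc 0))) (pairs 6 - set r)"
    unfolding list_all_iff by blast
qed

lemma good6: "r \<in> set (reps6) \<Longrightarrow> good_regular (pairs 6 - set r)"
proof -
  have "list_all (\<lambda>r. good_regular (pairs 6 - set r)) (reps6)"
    by (simp only: reps6_def list.map fst_conv list.pred_inject simp_thms good6_0 good6_1 good6_2
      good6_3 good6_4 good6_5 good6_6 good6_7 good6_8 good6_9 good6_10 good6_11 good6_12 good6_13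
      good6_14 good6_15 good6_16 good6_17 good6_18 good6_19 good6_20)
  then show "r \<in> set (reps6) \<Longrightarrow> good_regular (pairs 6 - set r)"
    unfolding list_all_iff by blast
qed


text \<open>A graph with 13 - d of the 15 possible edges has d + 2 non-edges, which selects the list
  of types to use.\<close>

lemma good_all:
  assumes "d \<le> 3" "J \<subseteq> pairs 6" "card J + d = 13"
  shows "good d J"
proof -
  consider "d = 0" | "d = 1" | "d = 2" | "d = 3" using assms(1) by linarith
  then show ?thesis
  proof cases
    case 1
    have "good 0 J"
      by (rule good_of_covers[OF covers_2 good2 assms(2)]) (use assms(3) 1 in simp_all)
    then show ?thesis by (simp add: 1 numeral_eq_Suc)
  next
    case 2
    have "good (Suc 0) J"
      by (rule good_of_covers[OF covers_3 good3 assms(2)]) (use assms(3) 2 in simp_all)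
    then show ?thesis by (simp add: 2 numeral_eq_Suc)
  next
    case 3
    have "good (Suc (Suc 0)) J"
      by (rule good_of_covers[OF covers_4 good4 assms(2)]) (use assms(3) 3 in simp_all)
    then show ?thesis by (simp add: 3 numeral_eq_Suc)
  next
    case 4
    have "good (Suc (Suc (Suc 0))) J"
      by (rule good_of_covers[OF covers_5 good5 assms(2)]) (use assms(3) 4 in simp_all)
    then show ?thesis by (simp add: 4 numeral_eq_Suc)
  qed
qed

lemma good_regular_all:
  assumes "K \<subseteq> pairs 6" "card K = 9"
  shows "good_regular K"
  using good_regular_of_covers[OF covers_6 good6 assms(1)] assms(2) by simp

section \<open>The polynomial of K_{4,4}\<close>

definition k44_edges :: "(nat \<times> nat) list" where
  "k44_edges = [(0, 4), (0, 5), (0, 6), (0, 7), (1, 4), (1, 5), (1, 6), (1, 7),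
    (2, 4), (2, 5), (2, 6), (2, 7), (3, 4), (3, 5), (3, 6), (3, 7)]"

lemma k44_edges_pairs: "set k44_edges \<subseteq> pairs 8" "card (set k44_edges) = 16"
  by (simp_all add: k44_edges_def pairs_def)

lemma K44_eq: "K44 = edge ` set k44_edges"
proof -
  have i4: "i = 0 \<or> i = 1 \<or> i = 2 \<or> i = 3" if "i < 4" for i :: nat using that by linarith
  have j4: "j = 4 \<or> j = 5 \<or> j = 6 \<or> j = 7" if "4 \<le> j" "j < 8" for j :: nat using that by linarith
  have "(i, j) \<in> set k44_edges" if "i < 4" "4 \<le> j" "j < 8" for i j
    using i4[OF that(1)] j4[OF that(2,3)] by (elim disjE) (simp_all add: k44_edges_def)
  moreover have "i < 4 \<and> 4 \<le> j \<and> j < 8" if "(i, j) \<in> set k44_edges" for i j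
    using that by (auto simp: k44_edges_def)
  ultimately have "set k44_edges = {(i, j). i < 4 \<and> 4 \<le> j \<and> j < 8}" by (intro equalityI subrelI) simp_all
  moreover have "edge ` {(i, j). i < 4 \<and> 4 \<le> j \<and> j < 8} = K44"
  proof (intro equalityI subsetI)
    fix x assume "x \<in> K44"
    then obtain i j where "i < 4" "4 \<le> j" "j < 8" "x = edge (i, j)"
      by (auto simp: K44_def edge_def)
    then show "x \<in> edge ` {(i, j). i < 4 \<and> 4 \<le> j \<and> j < 8}" by (intro image_eqI[of _ _ "(i, j)"]) simp_all
  next
    fix x assume "x \<in> edge ` {(i, j). i < 4 \<and> 4 \<le> j \<and> j < 8}"
    then obtain i j where ij: "i < 4" "4 \<le> j" "j < 8" "x = {i, j}" by (auto simp: edge_def)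
    then show "x \<in> K44" unfolding K44_def by blast
  qed
  ultimately show ?thesis by simp
qed

text \<open>Joining 6 to {3, 4, 5}, 7 to {0, 1, 2} and 6 to 7 extends K_{3,3} to K_{4,4}, so the
  table of \<open>g12\<close> also yields the exact polynomial and not just a bound.\<close>

lemma two_hubs_K44: "two_hubs (csg g12) [3, 4, 5] [0, 1, 2] id6 = k8"
  by (simp only: g12_csg check_rules calc_rules cong: if_weak_cong)

lemma cnt_K44: "cnt 8 (set k44_edges) id i = coeff k8 i"
proof -
  \<comment> \<open>\<open>q\<close> sends 3 to 6 and 4, 5, 6 to 3, 4, 5, taking the parts {0, 1, 2,
    3} and {4, 5, 6, 7} to {0, 1, 2, 6} and {3, 4, 5, 7}.\<close>
  define q :: "nat \<Rightarrow> nat" where "q = Transposition.transpose 5 6 \<circ> Transposition.transpose 4 5 \<circ> Transposition.transpose 3 4"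
  have q: "q permutes {..<8}" unfolding q_def by (intro permutes_compose permutes_swap_id) auto
  have e: "distinct g12" "set g12 \<subseteq> pairs 6"
    by (simp_all add: g12_def g1_def g0_def pairs_def)
  have qv: "q 0 = 0" "q 1 = 1" "q 2 = 2" "q 3 = 6" "q 4 = 3" "q 5 = 4" "q 6 = 5" "q 7 = 7"
    by (simp_all add: q_def Transposition.transpose_def)
  have "relabel q ` set k44_edges = set (map (relabel q) k44_edges)" by simp
  also have "\<dots> = insert (6, 7) (set g12 \<union> star 6 (set [3, 4, 5]) \<union> star 7 (set [0, 1, 2]))"
    unfolding k44_edges_def list.map relabel_def fst_conv snd_conv qv
    by (simp add: g12_def g1_def g0_def star_def) auto
  finally have "cnt 8 (set k44_edges) id i = coeff (two_hubs (csg g12) [3, 4, 5] [0, 1, 2] id6) i"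
    using cnt_relabel_id[OF q k44_edges_pairs(1), of i] coeff_two_hubs[OF e, of "[3, 4, 5]" "[0, 1, 2]" i]
    by simp
  then show ?thesis by (simp only: two_hubs_K44)
qed

theorem mainTheorem1:
  shows "uniformly_most_reliable 8 16 K44"
  unfolding K44_eq
proof (rule uniformly_most_reliableI[OF k44_edges_pairs])
  fix E i assume "E \<subseteq> pairs 8" "card E = 16"
  then show "cnt 8 E id i \<le> cnt 8 (set k44_edges) id i"
    unfolding cnt_K44 using cnt_le_k8[OF good_all good_regular_all] by blast
qed

end
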